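(* Let $(A,m,\bullet,\Delta)$ be a connected Com-PreLie bialgebra over a field $\mathbb{K}$ of characteristic zero, with unit $\emptyset$. If the map $f_A:\mathrm{Prim}(A)\longrightarrow\mathrm{Prim}(A)$, $a\mapsto a\bullet\emptyset$, is surjective, then $(A,m,\Delta)$ and $(T(\mathrm{Prim}(A)),\mathbin{\sqcup\!\sqcup},\Delta)$ are isomorphic Hopf algebras.
   Context: A Com-PreLie algebra is a vector space $A$ with bilinear products $\cdot$ (also denoted $m$) and $\bullet$ such that $\cdot$ is associative and commutative, $(a\bullet b)\bullet c-a\bullet(b\bullet c)=(a\bullet c)\bullet b-a\bullet(c\bullet b)$ and $(a\cdot b)\bullet c=(a\bullet c)\cdot b+a\cdot(b\bullet c)$ for all $a,b,c$; it is unitary if $(A,\cdot)$ has a unit. A Com-PreLie bialgebra is $(A,\cdot,\bullet,\Delta)$ with $(A,\cdot,\bullet)$ a unitary Com-PreLie algebra, $(A,\cdot,\Delta)$ a bialgebra, and $\Delta(a\bullet b)=a^{(1)}\otimes a^{(2)}\bullet b+a^{(1)}\bullet b^{(1)}\otimes a^{(2)}\cdot b^{(2)}$ for all $a,b$ (Sweedler notation). $\mathrm{Prim}(A)=\{a\in A:\Delta(a)=a\otimes\emptyset+\emptyset\otimes a\}$; if $a$ is primitive then $a\bullet\emptyset$ is primitive, so $f_A$ is well defined. Connected means connected as a coalgebra: for every $x$ in the augmentation ideal $A_+=\ker\varepsilon$ there is $n\ge1$ with $\tilde\Delta^{(n)}(x)=0$, where $\tilde\Delta(x)=\Delta(x)-x\otimes\emptyset-\emptyset\otimes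 x$ on $A_+$ and $\tilde\Delta^{(n)}:A_+\to A_+^{\otimes(n+1)}$ are its iterates. For a vector space $V$, $(T(V),\mathbin{\sqcup\!\sqcup},\Delta)$ is the shuffle Hopf algebra: $T(V)$ with the shuffle product and the deconcatenation coproduct. *)

theory Defs
  imports Complex_Main "HOL-Library.Poly_Mapping"
begin

section \<open>Free vector spaces and their quotients\<close>

text \<open>The free vector space on a type is the type of finitely supported functions
  \<open>'x \<Rightarrow>\<^sub>0 'k\<close>, with basis the elements \<open>fbasis x\<close>.\<close>

definition fscale :: "'k::field \<Rightarrow> ('x \<Rightarrow>\<^sub>0 'k) \<Rightarrow> ('x \<Rightarrow>\<^sub>0 'k)"
  where "fscale c p = Poly_Mapping.map ((*) c) p"

definition fbasis :: "'x \<Rightarrow> ('x \<Rightarrow>\<^sub>0 'k::field)"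
  where "fbasis x = Poly_Mapping.single x 1"

definition lin_ext :: "('k::field \<Rightarrow> 'v::ab_group_add \<Rightarrow> 'v) \<Rightarrow> ('x \<Rightarrow> 'v) \<Rightarrow> ('x \<Rightarrow>\<^sub>0 'k) \<Rightarrow> 'v"
  where "lin_ext s f p =
    (\<Sum>x\<in>Poly_Mapping.keys p. s (Poly_Mapping.lookup p x) (f x))"

lemma lookup_fscale: "Poly_Mapping.lookup (fscale c p) x = c * Poly_Mapping.lookup p x"
  unfolding fscale_def by (simp add: Poly_Mapping.map.rep_eq when_def)

lemma vector_space_fscale: "vector_space (fscale :: 'k::field \<Rightarrow> ('x \<Rightarrow>\<^sub>0 'k) \<Rightarrow> _)"
  by unfold_locales
    (auto intro!: poly_mapping_eqI simp: lookup_fscale lookup_add algebra_simps)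

text \<open>The quotient of a free vector space by a subspace \<open>N\<close> is realised inside the free vector
  space by choosing one representative in each coset, linearly in the coset: \<open>quot_rep N\<close> is a
  linear idempotent with kernel \<open>N\<close>, the element \<open>quot_rep N p\<close> stands for the coset \<open>p + N\<close>, and
  equality of elements of the quotient is equality in HOL (see \<open>quot_rep_eq_iff\<close>). Dependence on
  the choice never arises, as every linear map out of the quotient used below is given by a map
  that vanishes on \<open>N\<close>.\<close>

definition quot_rep :: "('x \<Rightarrow>\<^sub>0 'k::field) set \<Rightarrow> ('x \<Rightarrow>\<^sub>0 'k) \<Rightarrow> ('x \<Rightarrow>\<^sub>0 'k)"
  where "quot_rep N = (SOME P. Vector_Spaces.linear fscale fscale P \<and>
    (\<forall>p. P p = 0 \<longleftrightarrow> p \<in> N) \<and> (\<forall>p. P (P p) = P p))"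

lemma quot_rep_spec:
  fixes N :: "('x \<Rightarrow>\<^sub>0 'k::field) set"
  assumes N: "module.subspace fscale N"
  shows "Vector_Spaces.linear fscale fscale (quot_rep N) \<and>
    (\<forall>p. quot_rep N p = 0 \<longleftrightarrow> p \<in> N) \<and> (\<forall>p. quot_rep N (quot_rep N p) = quot_rep N p)"
proof -
  interpret F: vector_space "fscale :: 'k \<Rightarrow> ('x \<Rightarrow>\<^sub>0 'k) \<Rightarrow> _"
    by (rule vector_space_fscale)
  interpret FF: vector_space_pair "fscale :: 'k \<Rightarrow> ('x \<Rightarrow>\<^sub>0 'k) \<Rightarrow> _"
    "fscale :: 'k \<Rightarrow> ('x \<Rightarrow>\<^sub>0 'k) \<Rightarrow> _" ..
  obtain g where g: "range g \<subseteq> N" "Vector_Spaces.linear fscale fscale g" "\<forall>v\<in>N. g v = v"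
    using FF.linear_exists_left_inverse_on[OF F.linear_id N] by auto
  let ?P = "\<lambda>p. p - g p"
  have lin: "Vector_Spaces.linear fscale fscale ?P"
    using FF.linear_compose_sub[OF F.linear_ident g(2)] by simp
  have gN: "g p \<in> N" for p using g(1) by auto
  have g0: "g (p - g p) = 0" for p
    using g gN[of p] FF.linear_diff[OF g(2), of p "g p"] by simp
  have "\<exists>P. Vector_Spaces.linear fscale fscale P \<and>
      (\<forall>p. P p = 0 \<longleftrightarrow> p \<in> N) \<and> (\<forall>p. P (P p) = P p)"
  proof (intro exI[of _ ?P] conjI allI)
    show "?P p = 0 \<longleftrightarrow> p \<in> N" for p
      using gN[of p] g(3) by (metis eq_iff_diff_eq_0)
  qed (use lin g0 in auto)
  then show ?thesis unfolding quot_rep_def by (rule someI_ex)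
qed

lemma quot_rep_eq_iff:
  assumes "module.subspace fscale N"
  shows "quot_rep N p = quot_rep N q \<longleftrightarrow> p - q \<in> N"
proof -
  interpret Vector_Spaces.linear fscale fscale "quot_rep N" using quot_rep_spec[OF assms] by blast
  show ?thesis using quot_rep_spec[OF assms] diff[of p q] by (metis eq_iff_diff_eq_0)
qed

section \<open>Tensor powers and the tensor space\<close>

text \<open>For a subspace \<open>V\<close>, the words over \<open>V\<close> span a free vector space, and its quotient by the
  relations of multilinearity in the letters is \<open>T(V) = (\<Oplus>n. V\<^sup>\<otimes>\<^sup>n)\<close>. A word
  \<open>[v\<^sub>1, \<dots>, v\<^sub>n]\<close> becomes the pure tensor \<open>v\<^sub>1 \<otimes> \<dots> \<otimes> v\<^sub>n\<close>. In particular the two-fold and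
  three-fold tensor products are obtained without bracketing.\<close>

definition tensor_rels :: "('k::field \<Rightarrow> 'v::ab_group_add \<Rightarrow> 'v) \<Rightarrow> 'v set \<Rightarrow> ('v list \<Rightarrow>\<^sub>0 'k) set"
  where "tensor_rels s V = module.span fscale
    ({fbasis (u @ (x + y) # w) - fbasis (u @ x # w) - fbasis (u @ y # w) | u w x y.
        u \<in> lists V \<and> w \<in> lists V \<and> x \<in> V \<and> y \<in> V} \<union>
     {fbasis (u @ s c x # w) - fscale c (fbasis (u @ x # w)) | u w c x.
        u \<in> lists V \<and> w \<in> lists V \<and> x \<in> V})"

definition tens :: "('k::field \<Rightarrow> 'v::ab_group_add \<Rightarrow> 'v) \<Rightarrow> 'v set \<Rightarrow> 'v list \<Rightarrow> ('v list \<Rightarrow>\<^sub>0 'k)"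
  where "tens s V w = quot_rep (tensor_rels s V) (fbasis w)"

definition tensor_space :: "('k::field \<Rightarrow> 'v::ab_group_add \<Rightarrow> 'v) \<Rightarrow> 'v set \<Rightarrow> ('v list \<Rightarrow>\<^sub>0 'k) set"
  where "tensor_space s V = quot_rep (tensor_rels s V) ` {p. Poly_Mapping.keys p \<subseteq> lists V}"

definition tensor_power ::
    "('k::field \<Rightarrow> 'v::ab_group_add \<Rightarrow> 'v) \<Rightarrow> 'v set \<Rightarrow> nat \<Rightarrow> ('v list \<Rightarrow>\<^sub>0 'k) set"
  where "tensor_power s V n =
    quot_rep (tensor_rels s V) ` {p. Poly_Mapping.keys p \<subseteq> {w \<in> lists V. length w = n}}"

text \<open>Sweedler sums: if \<open>t = \<Sum> t\<^sup>(\<^sup>1\<^sup>) \<otimes> t\<^sup>(\<^sup>2\<^sup>)\<close>, then \<open>sweedler s g t\<close> is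
  \<open>\<Sum> g(t\<^sup>(\<^sup>1\<^sup>), t\<^sup>(\<^sup>2\<^sup>))\<close> for a bilinear map \<open>g\<close> with values in a space with scaling \<open>s\<close>.
  The chosen representative of \<open>t\<close> may involve relations in degrees other than 2, whence the
  value 0 on words of other lengths (see \<open>sweedler_tens\<close>).\<close>

definition sweedler ::
    "('k::field \<Rightarrow> 'v::ab_group_add \<Rightarrow> 'v) \<Rightarrow> ('a \<Rightarrow> 'a \<Rightarrow> 'v) \<Rightarrow> ('a list \<Rightarrow>\<^sub>0 'k) \<Rightarrow> 'v"
  where "sweedler s g = lin_ext s (\<lambda>w. case w of [x, y] \<Rightarrow> g x y | _ \<Rightarrow> 0)"

lemma linear_lin_ext:
  assumes "vector_space s"
  shows "Vector_Spaces.linear fscale s (lin_ext s f)"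
proof -
  interpret V: vector_space s by fact
  have alt: "lin_ext s f p = (\<Sum>x\<in>S. s (Poly_Mapping.lookup p x) (f x))"
    if "finite S" "Poly_Mapping.keys p \<subseteq> S" for p S
    unfolding lin_ext_def by (rule sum.mono_neutral_left) (use that in \<open>auto simp: in_keys_iff\<close>)
  have add: "lin_ext s f (p + q) = lin_ext s f p + lin_ext s f q" for p q
  proof -
    let ?S = "Poly_Mapping.keys p \<union> Poly_Mapping.keys q"
    show ?thesis
      using alt[of ?S p] alt[of ?S q] alt[of ?S "p + q"] Poly_Mapping.keys_add[of p q]
      by (simp add: lookup_add V.scale_left_distrib sum.distrib)
  qed
  have scale: "lin_ext s f (fscale c p) = s c (lin_ext s f p)" for c p
  proof -
    have "Poly_Mapping.keys (fscale c p) \<subseteq> Poly_Mapping.keys p"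
      by (auto simp: in_keys_iff lookup_fscale)
    then show ?thesis
      using alt[of "Poly_Mapping.keys p" p] alt[of "Poly_Mapping.keys p" "fscale c p"]
      by (simp add: lookup_fscale V.scale_sum_right)
  qed
  show ?thesis
    unfolding Vector_Spaces.linear_iff using vector_space_fscale assms add scale by blast
qed

lemma lin_ext_fbasis: "vector_space s \<Longrightarrow> lin_ext s f (fbasis x) = f x"
  unfolding lin_ext_def fbasis_def by (simp add: vector_space.vector_space_assms(4))

lemma subspace_tensor_rels:
  "module.subspace fscale (tensor_rels (s :: 'k::field \<Rightarrow> 'v::ab_group_add \<Rightarrow> 'v) V)"
proof -
  interpret F: vector_space "fscale :: 'k \<Rightarrow> ('v list \<Rightarrow>\<^sub>0 'k) \<Rightarrow> _"
    by (rule vector_space_fscale)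
  show ?thesis unfolding tensor_rels_def by (rule F.subspace_span)
qed

text \<open>Every map on words that is multilinear in the letters extends to the tensor space.\<close>

lemma lin_ext_quot_tensor:
  assumes s: "vector_space s'"
    and add: "\<And>u w x y. u \<in> lists V \<Longrightarrow> w \<in> lists V \<Longrightarrow> x \<in> V \<Longrightarrow> y \<in> V \<Longrightarrow>
        f (u @ (x + y) # w) = f (u @ x # w) + f (u @ y # w)"
    and scl: "\<And>u w c x. u \<in> lists V \<Longrightarrow> w \<in> lists V \<Longrightarrow> x \<in> V \<Longrightarrow>
        f (u @ s c x # w) = s' c (f (u @ x # w))"
  shows "lin_ext s' f (quot_rep (tensor_rels s V) p) = lin_ext s' f p"
proof -
  interpret L: Vector_Spaces.linear fscale s' "lin_ext s' f" using linear_lin_ext[OF s] .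
  have "L.vs1.subspace {q. lin_ext s' f q = 0}"
    by (rule L.vs1.subspaceI) (auto simp: L.add L.scale L.zero)
  then have "tensor_rels s V \<subseteq> {q. lin_ext s' f q = 0}"
    unfolding tensor_rels_def
    by (rule L.vs1.span_minimal[rotated])
      (auto simp: L.diff L.scale lin_ext_fbasis[OF s] add[unfolded in_lists_conv_set]
        scl[unfolded in_lists_conv_set])
  then have ker: "lin_ext s' f q = 0" if "q \<in> tensor_rels s V" for q
    using that by auto
  have "quot_rep (tensor_rels s V) (quot_rep (tensor_rels s V) p) = quot_rep (tensor_rels s V) p"
    using quot_rep_spec[OF subspace_tensor_rels] by blast
  then have "quot_rep (tensor_rels s V) p - p \<in> tensor_rels s V"
    using quot_rep_eq_iff[OF subspace_tensor_rels] by blast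
  from ker[OF this] show ?thesis by (simp add: L.diff)
qed

lemma sweedler_tens:
  assumes s: "vector_space s'" and xy: "x \<in> V" "y \<in> V"
    and "\<And>x x' y. x \<in> V \<Longrightarrow> x' \<in> V \<Longrightarrow> y \<in> V \<Longrightarrow> g (x + x') y = g x y + g x' y"
    and "\<And>x y y'. x \<in> V \<Longrightarrow> y \<in> V \<Longrightarrow> y' \<in> V \<Longrightarrow> g x (y + y') = g x y + g x y'"
    and "\<And>c x y. x \<in> V \<Longrightarrow> y \<in> V \<Longrightarrow> g (s c x) y = s' c (g x y)"
    and "\<And>c x y. x \<in> V \<Longrightarrow> y \<in> V \<Longrightarrow> g x (s c y) = s' c (g x y)"
  shows "sweedler s' g (tens s V [x, y]) = g x y"
proof -
  interpret vector_space s' by fact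
  have "sweedler s' g (tens s V [x, y]) = sweedler s' g (fbasis [x, y])"
    unfolding sweedler_def tens_def
    by (rule lin_ext_quot_tensor[OF s])
      (use assms in \<open>auto split: list.splits simp: append_eq_Cons_conv Cons_eq_append_conv\<close>)
  then show ?thesis by (simp add: sweedler_def lin_ext_fbasis[OF s])
qed

section \<open>Bialgebras and Hopf algebras\<close>

record (overloaded) ('k, 'a) bialg =
  carr :: "'a set"
  scl :: "'k \<Rightarrow> 'a \<Rightarrow> 'a"
  mul :: "'a \<Rightarrow> 'a \<Rightarrow> 'a"
  one :: 'a
  cop :: "'a \<Rightarrow> ('a list \<Rightarrow>\<^sub>0 'k)"
  cou :: "'a \<Rightarrow> 'k"

abbreviation btens :: "('k::field, 'a::ab_group_add, 'm) bialg_scheme \<Rightarrow> 'a list \<Rightarrow> ('a list \<Rightarrow>\<^sub>0 'k)"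
  where "btens H \<equiv> tens (scl H) (carr H)"

locale bialgebra =
  fixes H :: "('k::field, 'a::ab_group_add) bialg"
  assumes vs: "vector_space (scl H)"
    and carr_subspace: "module.subspace (scl H) (carr H)"
    and mul_closed: "x \<in> carr H \<Longrightarrow> y \<in> carr H \<Longrightarrow> mul H x y \<in> carr H"
    and mul_add_left: "x \<in> carr H \<Longrightarrow> y \<in> carr H \<Longrightarrow> z \<in> carr H \<Longrightarrow>
      mul H (x + y) z = mul H x z + mul H y z"
    and mul_add_right: "x \<in> carr H \<Longrightarrow> y \<in> carr H \<Longrightarrow> z \<in> carr H \<Longrightarrow>
      mul H x (y + z) = mul H x y + mul H x z"
    and mul_scl_left: "x \<in> carr H \<Longrightarrow> y \<in> carr H \<Longrightarrow> mul H (scl H c x) y = scl H c (mul H x y)"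
    and mul_scl_right: "x \<in> carr H \<Longrightarrow> y \<in> carr H \<Longrightarrow> mul H x (scl H c y) = scl H c (mul H x y)"
    and mul_assoc: "x \<in> carr H \<Longrightarrow> y \<in> carr H \<Longrightarrow> z \<in> carr H \<Longrightarrow>
      mul H (mul H x y) z = mul H x (mul H y z)"
    and one_closed: "one H \<in> carr H"
    and one_mul: "x \<in> carr H \<Longrightarrow> mul H (one H) x = x"
    and mul_one: "x \<in> carr H \<Longrightarrow> mul H x (one H) = x"
    and cop_closed: "x \<in> carr H \<Longrightarrow> cop H x \<in> tensor_power (scl H) (carr H) 2"
    and cop_add: "x \<in> carr H \<Longrightarrow> y \<in> carr H \<Longrightarrow> cop H (x + y) = cop H x + cop H y"
    and cop_scl: "x \<in> carr H \<Longrightarrow> cop H (scl H c x) = fscale c (cop H x)"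
    and cou_add: "x \<in> carr H \<Longrightarrow> y \<in> carr H \<Longrightarrow> cou H (x + y) = cou H x + cou H y"
    and cou_scl: "x \<in> carr H \<Longrightarrow> cou H (scl H c x) = c * cou H x"
    and coassoc: "x \<in> carr H \<Longrightarrow>
      sweedler fscale (\<lambda>x1 x2. sweedler fscale (\<lambda>y1 y2. btens H [y1, y2, x2]) (cop H x1)) (cop H x) =
      sweedler fscale (\<lambda>x1 x2. sweedler fscale (\<lambda>y1 y2. btens H [x1, y1, y2]) (cop H x2)) (cop H x)"
    and counit_left: "x \<in> carr H \<Longrightarrow>
      sweedler (scl H) (\<lambda>x1 x2. scl H (cou H x1) x2) (cop H x) = x"
    and counit_right: "x \<in> carr H \<Longrightarrow>
      sweedler (scl H) (\<lambda>x1 x2. scl H (cou H x2) x1) (cop H x) = x"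
    and cop_mul: "x \<in> carr H \<Longrightarrow> y \<in> carr H \<Longrightarrow> cop H (mul H x y) =
      sweedler fscale (\<lambda>x1 x2. sweedler fscale (\<lambda>y1 y2.
        btens H [mul H x1 y1, mul H x2 y2]) (cop H y)) (cop H x)"
    and cop_one: "cop H (one H) = btens H [one H, one H]"
    and cou_mul: "x \<in> carr H \<Longrightarrow> y \<in> carr H \<Longrightarrow> cou H (mul H x y) = cou H x * cou H y"
    and cou_one: "cou H (one H) = 1"

definition is_antipode :: "('k::field, 'a::ab_group_add) bialg \<Rightarrow> ('a \<Rightarrow> 'a) \<Rightarrow> bool"
  where "is_antipode H S \<longleftrightarrow>
    (\<forall>x\<in>carr H. S x \<in> carr H) \<and>
    (\<forall>x\<in>carr H. \<forall>y\<in>carr H. S (x + y) = S x + S y) \<and>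
    (\<forall>c. \<forall>x\<in>carr H. S (scl H c x) = scl H c (S x)) \<and>
    (\<forall>x\<in>carr H. sweedler (scl H) (\<lambda>x1 x2. mul H (S x1) x2) (cop H x) = scl H (cou H x) (one H)) \<and>
    (\<forall>x\<in>carr H. sweedler (scl H) (\<lambda>x1 x2. mul H x1 (S x2)) (cop H x) = scl H (cou H x) (one H))"

definition hopf_algebra :: "('k::field, 'a::ab_group_add) bialg \<Rightarrow> bool"
  where "hopf_algebra H \<longleftrightarrow> bialgebra H \<and> (\<exists>S. is_antipode H S)"

text \<open>Compatibility with the antipodes is not required of a morphism of Hopf algebras, since every
  morphism of bialgebras between Hopf algebras commutes with the antipodes.\<close>

definition hopf_iso ::
    "('k::field, 'a::ab_group_add) bialg \<Rightarrow> ('k, 'b::ab_group_add) bialg \<Rightarrow> ('a \<Rightarrow> 'b) \<Rightarrow> bool"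
  where "hopf_iso H H' \<phi> \<longleftrightarrow>
    bij_betw \<phi> (carr H) (carr H') \<and>
    (\<forall>x\<in>carr H. \<forall>y\<in>carr H. \<phi> (x + y) = \<phi> x + \<phi> y) \<and>
    (\<forall>c. \<forall>x\<in>carr H. \<phi> (scl H c x) = scl H' c (\<phi> x)) \<and>
    (\<forall>x\<in>carr H. \<forall>y\<in>carr H. \<phi> (mul H x y) = mul H' (\<phi> x) (\<phi> y)) \<and>
    \<phi> (one H) = one H' \<and>
    (\<forall>x\<in>carr H. cop H' (\<phi> x) =
      sweedler fscale (\<lambda>x1 x2. btens H' [\<phi> x1, \<phi> x2]) (cop H x)) \<and>
    (\<forall>x\<in>carr H. cou H' (\<phi> x) = cou H x)"

definition hopf_isomorphic ::
    "('k::field, 'a::ab_group_add) bialg \<Rightarrow> ('k, 'b::ab_group_add) bialg \<Rightarrow> bool"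
  where "hopf_isomorphic H H' \<longleftrightarrow> hopf_algebra H \<and> hopf_algebra H' \<and> (\<exists>\<phi>. hopf_iso H H' \<phi>)"

definition Prim :: "('k::field, 'a::ab_group_add) bialg \<Rightarrow> 'a set"
  where "Prim H = {a \<in> carr H. cop H a = btens H [a, one H] + btens H [one H, a]}"

definition red_cop :: "('k::field, 'a::ab_group_add) bialg \<Rightarrow> 'a \<Rightarrow> ('a list \<Rightarrow>\<^sub>0 'k)"
  where "red_cop H x = cop H x - btens H [x, one H] - btens H [one H, x]"

text \<open>Writing \<open>R\<close> for the reduced coproduct, the iterates are \<open>R\<^sup>(\<^sup>0\<^sup>) = Id\<close> and
  \<open>R\<^sup>(\<^sup>n\<^sup>+\<^sup>1\<^sup>) = (R \<otimes> Id\<^sup>\<otimes>\<^sup>n) \<circ> R\<^sup>(\<^sup>n\<^sup>)\<close>, computed in the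
  tensor powers of the whole space, into which those of the augmentation ideal embed.\<close>

fun red_cop_iter :: "('k::field, 'a::ab_group_add) bialg \<Rightarrow> nat \<Rightarrow> 'a \<Rightarrow> ('a list \<Rightarrow>\<^sub>0 'k)"
  where
    "red_cop_iter H 0 x = btens H [x]"
  | "red_cop_iter H (Suc n) x = lin_ext fscale
      (\<lambda>w. case w of [] \<Rightarrow> 0 | y # u \<Rightarrow> sweedler fscale (\<lambda>y1 y2. btens H (y1 # y2 # u)) (red_cop H y))
      (red_cop_iter H n x)"

definition connected_bialgebra :: "('k::field, 'a::ab_group_add) bialg \<Rightarrow> bool"
  where "connected_bialgebra H \<longleftrightarrow>
    (\<forall>x\<in>carr H. cou H x = 0 \<longrightarrow> (\<exists>n\<ge>1. red_cop_iter H n x = 0))"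

section \<open>Com-PreLie bialgebras\<close>

locale com_prelie_algebra = vector_space scale
  for scale :: "'k::field \<Rightarrow> 'a::ab_group_add \<Rightarrow> 'a" +
  fixes m :: "'a \<Rightarrow> 'a \<Rightarrow> 'a" and bul :: "'a \<Rightarrow> 'a \<Rightarrow> 'a"
  assumes m_linear_left: "Vector_Spaces.linear scale scale (\<lambda>a. m a b)"
    and m_linear_right: "Vector_Spaces.linear scale scale (\<lambda>b. m a b)"
    and bul_linear_left: "Vector_Spaces.linear scale scale (\<lambda>a. bul a b)"
    and bul_linear_right: "Vector_Spaces.linear scale scale (\<lambda>b. bul a b)"
    and m_assoc: "m (m a b) c = m a (m b c)"
    and m_comm: "m a b = m b a"
    and prelie: "bul (bul a b) c - bul a (bul b c) = bul (bul a c) b - bul a (bul c b)"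
    and leibniz: "bul (m a b) c = m (bul a c) b + m a (bul b c)"

locale unitary_com_prelie_algebra = com_prelie_algebra scale m bul
  for scale :: "'k::field \<Rightarrow> 'a::ab_group_add \<Rightarrow> 'a" and m bul +
  fixes e :: 'a
  assumes unit: "m e a = a"

abbreviation type_bialg ::
    "('k::field \<Rightarrow> 'a::ab_group_add \<Rightarrow> 'a) \<Rightarrow> ('a \<Rightarrow> 'a \<Rightarrow> 'a) \<Rightarrow> 'a \<Rightarrow>
     ('a \<Rightarrow> ('a list \<Rightarrow>\<^sub>0 'k)) \<Rightarrow> ('a \<Rightarrow> 'k) \<Rightarrow> ('k, 'a) bialg"
  where "type_bialg scale m e \<Delta> \<epsilon> \<equiv>
    \<lparr>carr = UNIV, scl = scale, mul = m, one = e, cop = \<Delta>, cou = \<epsilon>\<rparr>"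

locale com_prelie_bialgebra = unitary_com_prelie_algebra scale m bul e
  for scale :: "'k::field \<Rightarrow> 'a::ab_group_add \<Rightarrow> 'a" and m bul e +
  fixes \<Delta> :: "'a \<Rightarrow> ('a list \<Rightarrow>\<^sub>0 'k)" and \<epsilon> :: "'a \<Rightarrow> 'k"
  assumes bialg: "bialgebra (type_bialg scale m e \<Delta> \<epsilon>)"
    and \<Delta>_bul: "\<Delta> (bul a b) =
      sweedler fscale (\<lambda>a1 a2. tens scale UNIV [a1, bul a2 b]) (\<Delta> a) +
      sweedler fscale (\<lambda>a1 a2. sweedler fscale (\<lambda>b1 b2.
        tens scale UNIV [bul a1 b1, m a2 b2]) (\<Delta> b)) (\<Delta> a)"

section \<open>The shuffle Hopf algebra\<close>

text \<open>The shuffles of two words are listed with multiplicity, unlike in the set-valued library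
  function \<open>shuffles\<close>.\<close>

fun shuffle_list :: "'x list \<Rightarrow> 'x list \<Rightarrow> 'x list list"
  where
    "shuffle_list [] v = [v]"
  | "shuffle_list u [] = [u]"
  | "shuffle_list (a # u) (b # v) =
      map ((#) a) (shuffle_list u (b # v)) @ map ((#) b) (shuffle_list (a # u) v)"

text \<open>The operations are given on words and extended linearly to representatives; they respect
  the relations of multilinearity. The elements of \<open>T(V) \<otimes> T(V)\<close> are represented by
  combinations of two-letter words whose letters are elements of \<open>T(V)\<close>.\<close>

definition shuffle_bialg ::
    "('k::field \<Rightarrow> 'v::ab_group_add \<Rightarrow> 'v) \<Rightarrow> 'v set \<Rightarrow> ('k, 'v list \<Rightarrow>\<^sub>0 'k) bialg"
  where "shuffle_bialg s V =
    \<lparr>carr = tensor_space s V,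
     scl = fscale,
     mul = (\<lambda>p q. lin_ext fscale (\<lambda>u. lin_ext fscale (\<lambda>v.
       \<Sum>w\<leftarrow>shuffle_list u v. tens s V w) q) p),
     one = tens s V [],
     cop = lin_ext fscale (\<lambda>w. \<Sum>i\<le>length w.
       tens fscale (tensor_space s V) [tens s V (take i w), tens s V (drop i w)]),
     cou = (\<lambda>p. Poly_Mapping.lookup p [])\<rparr>"

end

theory Submission
  imports Defs "HOL-Computational_Algebra.Polynomial"
begin

text \<open>Connectedness makes the convolution logarithm of the identity well defined. In a commutative
  bialgebra of characteristic zero it kills products in the augmentation ideal, and it fixes the
  primitive elements; following it by a linear projection onto \<open>Prim(A)\<close> gives a map
  \<open>\<pi> : A \<rightarrow> Prim(A)\<close> with both properties. The map \<open>\<psi>(x) = \<epsilon>(x) + \<Sum> \<pi>(x\<^sup>(\<^sup>1\<^sup>)) \<psi>(x\<^sup>(\<^sup>2\<^sup>))\<close> (concatenation in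
  \<open>T(Prim(A))\<close>) is then a morphism of bialgebras to the shuffle algebra, injective because it is so on
  \<open>Prim(A)\<close>.

  The pre-Lie product makes it surjective. For primitive \<open>a\<close> the bialgebra axiom reduces to
  \<open>\<Delta>(a \<bullet> b) = \<emptyset> \<otimes> a \<bullet> b + \<Sum> a \<bullet> b\<^sup>(\<^sup>1\<^sup>) \<otimes> b\<^sup>(\<^sup>2\<^sup>)\<close>. Choosing \<open>g(v)\<close> primitive with
  \<open>g(v) \<bullet> \<emptyset> = v\<close>, the elements \<open>\<phi>(v\<^sub>1 \<dots> v\<^sub>n) = g(v\<^sub>1) \<bullet> (\<dots> (g(v\<^sub>n) \<bullet> \<emptyset>))\<close> therefore have the
  deconcatenation coproduct, so that \<open>\<psi>(\<phi>(w))\<close> is \<open>w\<close> plus shorter words.\<close>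

text \<open>Tensors are represented by chosen elements of cosets, so they are tested by functionals:
  contracting one factor of \<Delta>, on either side, by functionals that vanish at \<emptyset>
  lowers the coradical filtration. Hence an equation f(x) = \<Sum> B(x1, f(x2)) with B(\<emptyset>,
  _) = 0 has only the solution 0. Compatibility of \<psi> with the coproducts and the second
  antipode law follow by applying this to a difference, multiplicativity of \<psi> by a version in
  two variables.

  Injectivity on Prim(A) is enough because the kernel of \<psi> is stable under contractions that
  factor through \<psi>; by induction on the filtration its elements are then primitive, hence 0.

  The section g of f_A is arbitrary, so \<phi> is a map on words only, and T(Prim(A)) is exhausted
  by induction on the length of words.

  The Hopf axioms of the shuffle algebra (associativity, coassociativity, antipode and the rest) are
  transported along \<psi> instead of being checked on words.\<close>

abbreviation lin where "lin \<equiv> Vector_Spaces.linear"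

definition bilin ::
    "('k::field \<Rightarrow> 'a::ab_group_add \<Rightarrow> 'a) \<Rightarrow> ('k \<Rightarrow> 'b::ab_group_add \<Rightarrow> 'b) \<Rightarrow>
     ('k \<Rightarrow> 'c::ab_group_add \<Rightarrow> 'c) \<Rightarrow> ('a \<Rightarrow> 'b \<Rightarrow> 'c) \<Rightarrow> bool"
  where "bilin s1 s2 s3 g \<longleftrightarrow> (\<forall>b. lin s1 s3 (\<lambda>a. g a b)) \<and> (\<forall>a. lin s2 s3 (g a))"

definition trilin ::
    "('k::field \<Rightarrow> 'a::ab_group_add \<Rightarrow> 'a) \<Rightarrow> ('k \<Rightarrow> 'c::ab_group_add \<Rightarrow> 'c) \<Rightarrow>
     ('a \<Rightarrow> 'a \<Rightarrow> 'a \<Rightarrow> 'c) \<Rightarrow> bool"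
  where "trilin s s' h \<longleftrightarrow> (\<forall>b c. lin s s' (\<lambda>a. h a b c)) \<and>
    (\<forall>a c. lin s s' (\<lambda>b. h a b c)) \<and> (\<forall>a b. lin s s' (\<lambda>c. h a b c))"

section \<open>Linear, bilinear and trilinear maps\<close>

lemma lin_iff:
  "lin s1 s2 f \<longleftrightarrow> vector_space s1 \<and> vector_space s2 \<and>
     (\<forall>x y. f (x + y) = f x + f y) \<and> (\<forall>c x. f (s1 c x) = s2 c (f x))"
  by (rule Vector_Spaces.linear_iff)

lemma lin_module_hom: "lin s1 s2 f \<Longrightarrow> module_hom s1 s2 f"
  by (simp add: Vector_Spaces.linear_def)

lemmas lin_add = module_hom.add[OF lin_module_hom]
  and lin_scale = module_hom.scale[OF lin_module_hom]
  and lin_0 = module_hom.zero[OF lin_module_hom]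
  and lin_neg = module_hom.neg[OF lin_module_hom]
  and lin_diff = module_hom.diff[OF lin_module_hom]
  and lin_sum = module_hom.sum[OF lin_module_hom]

lemma lin_vs: assumes "lin s1 s2 f" shows "vector_space s1" "vector_space s2"
  using assms by (auto simp: lin_iff)

lemma vector_space_mult: "vector_space ((*) :: 'k::field \<Rightarrow> 'k \<Rightarrow> 'k)"
  by unfold_locales (auto simp: algebra_simps)

lemma vs_scale_simps:
  assumes "vector_space s"
  shows "s c (x + y) = s c x + s c y" "s (c + d) x = s c x + s d x" "s c (s d x) = s (c * d) x"
    "s 1 x = x" "s c 0 = 0" "s 0 x = 0" "s c (x - y) = s c x - s c y" "s (c - d) x = s c x - s d x"
    "s c (- x) = - s c x" "s (- c) x = - s c x"
proof -
  interpret vector_space s by fact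
  show "s c (x + y) = s c x + s c y" "s (c + d) x = s c x + s d x" "s c (s d x) = s (c * d) x"
    "s 1 x = x" "s c 0 = 0" "s 0 x = 0" "s c (x - y) = s c x - s c y" "s (c - d) x = s c x - s d x"
    "s c (- x) = - s c x" "s (- c) x = - s c x"
    by (auto simp: algebra_simps)
qed

lemma vs_scale_sum: "vector_space s \<Longrightarrow> s c (sum f I) = (\<Sum>i\<in>I. s c (f i))"
proof -
  assume "vector_space s"
  then interpret vector_space s .
  show ?thesis by (rule scale_sum_right)
qed

lemma lin_ident: "vector_space s \<Longrightarrow> lin s s (\<lambda>x. x)"
  by (simp add: lin_iff)

lemma lin_comp: "lin s1 s2 f \<Longrightarrow> lin s2 s3 g \<Longrightarrow> lin s1 s3 (\<lambda>x. g (f x))"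
  by (simp add: lin_iff)

lemma lin_plus: "lin s1 s2 f \<Longrightarrow> lin s1 s2 g \<Longrightarrow> lin s1 s2 (\<lambda>x. f x + g x)"
  by (simp add: lin_iff vs_scale_simps)

lemma lin_minus: "lin s1 s2 f \<Longrightarrow> lin s1 s2 g \<Longrightarrow> lin s1 s2 (\<lambda>x. f x - g x)"
  by (simp add: lin_iff vs_scale_simps)

lemma lin_uminus: "lin s1 s2 f \<Longrightarrow> lin s1 s2 (\<lambda>x. - f x)"
  by (simp add: lin_iff vs_scale_simps)

lemma lin_scale_const: "lin s1 s2 f \<Longrightarrow> lin s1 s2 (\<lambda>x. s2 c (f x))"
  by (simp add: lin_iff vs_scale_simps mult.commute)

lemma lin_scale_var: "vector_space s2 \<Longrightarrow> lin s1 (*) f \<Longrightarrow> lin s1 s2 (\<lambda>x. s2 (f x) v)"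
  by (simp add: lin_iff vs_scale_simps)

lemma lin_zero: "vector_space s1 \<Longrightarrow> vector_space s2 \<Longrightarrow> lin s1 s2 (\<lambda>x. 0)"
  by (simp add: lin_iff vs_scale_simps)

lemma lin_sum_fun:
  "vector_space s1 \<Longrightarrow> vector_space s2 \<Longrightarrow> (\<And>i. i \<in> I \<Longrightarrow> lin s1 s2 (f i)) \<Longrightarrow>
    lin s1 s2 (\<lambda>x. \<Sum>i\<in>I. f i x)"
  by (induction I rule: infinite_finite_induct) (auto intro: lin_zero lin_plus)

lemma bilin_left: "bilin s1 s2 s3 g \<Longrightarrow> lin s s1 f \<Longrightarrow> lin s s3 (\<lambda>x. g (f x) y)"
  using lin_comp[of s s1 f s3 "\<lambda>a. g a y"] unfolding bilin_def by blast

lemma bilin_right: "bilin s1 s2 s3 g \<Longrightarrow> lin s s2 f \<Longrightarrow> lin s s3 (\<lambda>x. g y (f x))"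
  using lin_comp[of s s2 f s3 "g y"] unfolding bilin_def by blast

lemma bilinI: "(\<And>b. lin s1 s3 (\<lambda>a. g a b)) \<Longrightarrow> (\<And>a. lin s2 s3 (\<lambda>b. g a b)) \<Longrightarrow> bilin s1 s2 s3 g"
  unfolding bilin_def by blast

lemma trilinI: "(\<And>b c. lin s s' (\<lambda>a. h a b c)) \<Longrightarrow> (\<And>a c. lin s s' (\<lambda>b. h a b c)) \<Longrightarrow>
    (\<And>a b. lin s s' (\<lambda>c. h a b c)) \<Longrightarrow> trilin s s' h"
  unfolding trilin_def by blast

lemma bilin_simps:
  assumes "bilin s1 s2 s3 g"
  shows "g (a + a') b = g a b + g a' b" "g a (b + b') = g a b + g a b'"
    "g (s1 c a) b = s3 c (g a b)" "g a (s2 c b) = s3 c (g a b)" "g 0 b = 0" "g a 0 = 0"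
    "g (a - a') b = g a b - g a' b" "g a (b - b') = g a b - g a b'"
    "g (- a) b = - g a b" "g a (- b) = - g a b"
proof -
  have l: "lin s1 s3 (\<lambda>a. g a b)" for b
    using assms unfolding bilin_def by blast
  have r: "lin s2 s3 (g a)" for a
    using assms unfolding bilin_def by blast
  show "g (a + a') b = g a b + g a' b" "g (s1 c a) b = s3 c (g a b)" "g 0 b = 0"
    "g (a - a') b = g a b - g a' b" "g (- a) b = - g a b"
    using lin_add[OF l] lin_scale[OF l] lin_0[OF l] lin_diff[OF l] lin_neg[OF l] by auto
  show "g a (b + b') = g a b + g a b'" "g a (s2 c b) = s3 c (g a b)" "g a 0 = 0"
    "g a (b - b') = g a b - g a b'" "g a (- b) = - g a b"
    using lin_add[OF r] lin_scale[OF r] lin_0[OF r] lin_diff[OF r] lin_neg[OF r] by auto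
qed

lemma bilin_vs: assumes "bilin s1 s2 s3 g" shows "vector_space s1" "vector_space s2" "vector_space s3"
  using assms lin_vs unfolding bilin_def by blast+

lemma bilin_sum:
  assumes "bilin s1 s2 s3 g"
  shows "g (\<Sum>i\<in>I. f i) b = (\<Sum>i\<in>I. g (f i) b)" "g a (\<Sum>i\<in>I. h i) = (\<Sum>i\<in>I. g a (h i))"
  using assms lin_sum[of s1 s3 "\<lambda>a. g a b"] lin_sum[of s2 s3 "g a"] unfolding bilin_def by auto

text \<open>Expanding the \<open>a i\<close> in a basis reduces the claim to the coordinate functionals.\<close>

lemma bilin_sum_eq_0I:
  assumes vs: "vector_space s" and B: "bilin s s' s'' B" and fin: "finite I"
    and zero: "\<And>\<gamma>. lin s (*) \<gamma> \<Longrightarrow> (\<Sum>i\<in>I. s' (\<gamma> (a i)) (w i)) = 0"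
  shows "(\<Sum>i\<in>I. B (a i) (w i)) = 0"
proof -
  interpret vector_space s by fact
  interpret VP: vector_space_pair s "(*)" using vs vector_space_mult
    by (simp add: vector_space_pair_def)
  define E where "E = extend_basis {}"
  have indE: "independent E" and spE: "span E = UNIV"
    unfolding E_def using independent_extend_basis[OF independent_empty]
      span_extend_basis[OF independent_empty] by auto
  define S where "S = (\<Union>i\<in>I. {v. representation E (a i) v \<noteq> 0})"
  have finS: "finite S"
    unfolding S_def using fin finite_representation by auto
  have exp: "a i = (\<Sum>v\<in>S. s (representation E (a i) v) v)" if "i \<in> I" for i
  proof -
    have "(\<Sum>v\<in>S. s (representation E (a i) v) v) =
        (\<Sum>v | representation E (a i) v \<noteq> 0. s (representation E (a i) v) v)"
      by (rule sum.mono_neutral_right) (use finS that in \<open>auto simp: S_def\<close>)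
    also have "\<dots> = a i" by (rule sum_nonzero_representation_eq) (use indE spE in auto)
    finally show ?thesis ..
  qed
  have linr: "lin s (*) (\<lambda>x. representation E x v)" for v
    unfolding lin_iff using vs vector_space_mult representation_add[OF indE] representation_scale[OF indE]
      spE by auto
  have "(\<Sum>i\<in>I. B (a i) (w i)) = (\<Sum>i\<in>I. B (\<Sum>v\<in>S. s (representation E (a i) v) v) (w i))"
    by (intro sum.cong refl) (use exp in auto)
  also have "\<dots> = (\<Sum>i\<in>I. \<Sum>v\<in>S. B v (s' (representation E (a i) v) (w i)))"
    by (simp add: bilin_sum[OF B] bilin_simps[OF B])
  also have "\<dots> = (\<Sum>v\<in>S. B v (\<Sum>i\<in>I. s' (representation E (a i) v) (w i)))"
    by (subst sum.swap) (simp add: bilin_sum[OF B])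
  also have "\<dots> = 0" by (simp add: zero[OF linr] bilin_simps[OF B])
  finally show ?thesis .
qed

lemma functional_separation:
  assumes vs: "vector_space s" and "\<And>\<gamma>. lin s (*) \<gamma> \<Longrightarrow> \<gamma> x = 0"
  shows "x = 0"
proof -
  have "bilin s (*) s (\<lambda>a c. s c a)"
    using lin_scale_var[OF vs lin_ident[OF vector_space_mult]]
      lin_scale_const[OF lin_ident[OF vs]] by (intro bilinI) auto
  from bilin_sum_eq_0I[OF vs this, of "{()}" "\<lambda>_. x" "\<lambda>_. 1"] assms(2)
  show ?thesis by (simp add: vs_scale_simps[OF vs])
qed

section \<open>Pure tensors\<close>

lemma lin_lin_ext: "vector_space s \<Longrightarrow> lin fscale s (lin_ext s f)"
  by (rule linear_lin_ext)

lemma lin_compose_lin_ext: "lin s s' f \<Longrightarrow> f (lin_ext s g p) = lin_ext s' (\<lambda>w. f (g w)) p"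
  unfolding lin_ext_def by (simp add: lin_sum lin_scale)

lemma lin_sweedler: "vector_space s \<Longrightarrow> lin fscale s (sweedler s g)"
  unfolding sweedler_def by (rule lin_lin_ext)

lemma lin_quot_tensor: "lin fscale fscale (quot_rep (tensor_rels s V))"
  using quot_rep_spec[OF subspace_tensor_rels] by blast

lemma quot_tensor_rels: "p \<in> tensor_rels s V \<Longrightarrow> quot_rep (tensor_rels s V) p = 0"
  using quot_rep_spec[OF subspace_tensor_rels] by blast

lemma fscale_simps [simp]:
  "fscale c 0 = 0" "fscale 0 p = 0" "fscale 1 p = p"
  by (simp_all add: vs_scale_simps[OF vector_space_fscale])

lemma poly_mapping_expand: "p = (\<Sum>w\<in>Poly_Mapping.keys p. fscale (Poly_Mapping.lookup p w) (fbasis w))"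
proof (rule poly_mapping_eqI)
  fix k
  have "Poly_Mapping.lookup (\<Sum>w\<in>Poly_Mapping.keys p. fscale (Poly_Mapping.lookup p w) (fbasis w)) k
      = (\<Sum>w\<in>Poly_Mapping.keys p. if w = k then Poly_Mapping.lookup p w else 0)"
    by (simp add: lookup_sum lookup_fscale fbasis_def lookup_single when_def if_distrib cong: if_cong)
  also have "\<dots> = Poly_Mapping.lookup p k"
    by (simp add: in_keys_iff)
  finally show "Poly_Mapping.lookup p k = Poly_Mapping.lookup
      (\<Sum>w\<in>Poly_Mapping.keys p. fscale (Poly_Mapping.lookup p w) (fbasis w)) k" ..
qed

lemma quot_tensor_expand:
  "quot_rep (tensor_rels s V) p =
    (\<Sum>w\<in>Poly_Mapping.keys p. fscale (Poly_Mapping.lookup p w) (tens s V w))"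
  by (subst poly_mapping_expand[of p])
    (simp only: lin_sum[OF lin_quot_tensor] lin_scale[OF lin_quot_tensor] tens_def)

lemma tens_add:
  assumes "u \<in> lists V" "w \<in> lists V" "x \<in> V" "y \<in> V"
  shows "tens s V (u @ (x + y) # w) = tens s V (u @ x # w) + tens s V (u @ y # w)"
proof -
  interpret F: vector_space fscale by (rule vector_space_fscale)
  have "fbasis (u @ (x + y) # w) - fbasis (u @ x # w) - fbasis (u @ y # w) \<in> tensor_rels s V"
    unfolding tensor_rels_def by (rule F.span_base) (use assms in blast)
  from quot_tensor_rels[OF this] show ?thesis
    by (simp only: tens_def lin_diff[OF lin_quot_tensor]) (simp add: algebra_simps)
qed

lemma tens_scale:
  assumes "u \<in> lists V" "w \<in> lists V" "x \<in> V"
  shows "tens s V (u @ s c x # w) = fscale c (tens s V (u @ x # w))"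
proof -
  interpret F: vector_space fscale by (rule vector_space_fscale)
  have "fbasis (u @ s c x # w) - fscale c (fbasis (u @ x # w)) \<in> tensor_rels s V"
    unfolding tensor_rels_def by (rule F.span_base) (use assms in blast)
  from quot_tensor_rels[OF this] show ?thesis
    by (simp add: tens_def lin_diff[OF lin_quot_tensor] lin_scale[OF lin_quot_tensor])
qed

text \<open>Only the multilinearity relations over \<open>V\<close> are factored out, so the formula
  holds for every word, also with letters outside \<open>V\<close>.\<close>

lemma lin_ext_tens:
  assumes s: "vector_space s'"
    and add: "\<And>u w x y. u \<in> lists V \<Longrightarrow> w \<in> lists V \<Longrightarrow> x \<in> V \<Longrightarrow> y \<in> V \<Longrightarrow>
        f (u @ (x + y) # w) = f (u @ x # w) + f (u @ y # w)"
    and scl: "\<And>u w c x. u \<in> lists V \<Longrightarrow> w \<in> lists V \<Longrightarrow> x \<in> V \<Longrightarrow>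
        f (u @ s c x # w) = s' c (f (u @ x # w))"
  shows "lin_ext s' f (tens s V w) = f w"
  unfolding tens_def using lin_ext_quot_tensor[of s' V f s, OF s add scl]
  by (simp add: lin_ext_fbasis[OF s])

lemma lin_tens_UNIV:
  assumes "vector_space s"
  shows "lin s fscale (\<lambda>x. tens s UNIV (u @ x # w))"
  unfolding lin_iff using assms vector_space_fscale tens_add[of u UNIV w _ _ s] tens_scale[of u UNIV w _ s]
  by auto

lemmas lin_tens_UNIV_1 = lin_tens_UNIV[where u="[]", simplified]
  and lin_tens_UNIV_2 = lin_tens_UNIV[where u="[a]" for a, simplified]
  and lin_tens_UNIV_3 = lin_tens_UNIV[where u="[a,b]" for a b, simplified]

lemma bilin_tens_UNIV: "vector_space s \<Longrightarrow> bilin s s fscale (\<lambda>a b. tens s UNIV [a, b])"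
  by (intro bilinI lin_tens_UNIV_1 lin_tens_UNIV_2)

section \<open>Sweedler sums in a bialgebra\<close>

locale type_bialgebra =
  fixes scale :: "'k::field \<Rightarrow> 'a::ab_group_add \<Rightarrow> 'a" and m :: "'a \<Rightarrow> 'a \<Rightarrow> 'a" and e :: 'a
    and \<Delta> :: "'a \<Rightarrow> ('a list \<Rightarrow>\<^sub>0 'k)" and \<epsilon> :: "'a \<Rightarrow> 'k"
  assumes bialg: "bialgebra (type_bialg scale m e \<Delta> \<epsilon>)"
begin

abbreviation "tp a b \<equiv> tens scale UNIV [a, b]"

lemma vs: "vector_space scale"
  using bialgebra.vs[OF bialg] by simp

lemmas vs_simps = vs_scale_simps[OF vs]

lemma bilin_m: "bilin scale scale scale m"
  using bialgebra.mul_add_left[OF bialg] bialgebra.mul_add_right[OF bialg]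
    bialgebra.mul_scl_left[OF bialg] bialgebra.mul_scl_right[OF bialg] vs
  by (intro bilinI) (auto simp: lin_iff)

lemma m_assoc: "m (m x y) z = m x (m y z)"
  using bialgebra.mul_assoc[OF bialg] by simp

lemma m_e [simp]: "m e x = x" "m x e = x"
  using bialgebra.one_mul[OF bialg] bialgebra.mul_one[OF bialg] by simp_all

lemma lin_counit: "lin scale (*) \<epsilon>"
  using bialgebra.cou_add[OF bialg] bialgebra.cou_scl[OF bialg] vs vector_space_mult
  by (auto simp: lin_iff)

lemma counit_m [simp]: "\<epsilon> (m x y) = \<epsilon> x * \<epsilon> y" and counit_e [simp]: "\<epsilon> e = 1"
  using bialgebra.cou_mul[OF bialg] bialgebra.cou_one[OF bialg] by simp_all

lemma lin_cop: "lin scale fscale \<Delta>"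
  using bialgebra.cop_add[OF bialg] bialgebra.cop_scl[OF bialg] vs vector_space_fscale
  by (auto simp: lin_iff)

text \<open>Coefficients are absorbed into the first tensor factor. A list records the pairs because
  distinct words may then give the same pair.\<close>

lemma cop_expand: "\<exists>L. \<Delta> x = (\<Sum>i<length L. tp (fst (L ! i)) (snd (L ! i)))"
proof -
  obtain p where p: "\<Delta> x = quot_rep (tensor_rels scale UNIV) p"
    "Poly_Mapping.keys p \<subseteq> {w. length w = 2}"
    using bialgebra.cop_closed[OF bialg, of x] unfolding tensor_power_def by auto
  obtain ws where ws: "set ws = Poly_Mapping.keys p" "distinct ws"
    using finite_distinct_list[OF finite_keys, of p] by auto
  let ?f = "\<lambda>w. (scale (Poly_Mapping.lookup p w) (w ! 0), w ! 1)"
  have eq: "fscale (Poly_Mapping.lookup p w) (tens scale UNIV w) = tp (fst (?f w)) (snd (?f w))"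
    if "w \<in> Poly_Mapping.keys p" for w
  proof -
    have "length w = 2" using p(2) that by auto
    then obtain a b where w: "w = [a, b]"
      by (auto simp: length_Suc_conv numeral_2_eq_2)
    show ?thesis unfolding w using lin_scale[OF lin_tens_UNIV_1[OF vs]] by auto
  qed
  have "\<Delta> x = (\<Sum>w\<in>set ws. tp (fst (?f w)) (snd (?f w)))"
    unfolding p(1) quot_tensor_expand ws(1) by (intro sum.cong refl eq) auto
  also have "\<dots> = (\<Sum>i<length ws. tp (fst (map ?f ws ! i)) (snd (map ?f ws ! i)))"
    using sum.distinct_set_conv_list[OF ws(2), of "\<lambda>w. tp (fst (?f w)) (snd (?f w))"]
    by (simp add: sum_list_sum_nth atLeast0LessThan)
  finally show ?thesis by (intro exI[of _ "map ?f ws"]) simp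
qed

definition cterms :: "'a \<Rightarrow> ('a \<times> 'a) list"
  where "cterms x = (SOME L. \<Delta> x = (\<Sum>i<length L. tp (fst (L ! i)) (snd (L ! i))))"

text \<open>\<open>Sw g x\<close> is \<open>\<Sum> g(x\<^sup>(\<^sup>1\<^sup>), x\<^sup>(\<^sup>2\<^sup>))\<close>. Unlike \<open>sweedler\<close> it is a genuine finite sum over pairs of
  elements, so that additive maps and summations can be moved through it without assuming that \<open>g\<close>
  is bilinear; independence of the chosen pairs does need bilinearity.\<close>

definition Sw :: "('a \<Rightarrow> 'a \<Rightarrow> 'w::comm_monoid_add) \<Rightarrow> 'a \<Rightarrow> 'w"
  where "Sw g x = (\<Sum>i<length (cterms x). g (fst (cterms x ! i)) (snd (cterms x ! i)))"

lemma cop_eq_Sw: "\<Delta> x = Sw (\<lambda>a b. tp a b) x"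
  using someI_ex[OF cop_expand[of x]] unfolding Sw_def cterms_def .

lemma Sw_cong: "(\<And>a b. g a b = h a b) \<Longrightarrow> Sw g x = Sw h x"
  by presburger

lemma Sw_plus: "Sw (\<lambda>a b. g a b + h a b) x = Sw g x + Sw h x"
  by (simp add: Sw_def sum.distrib)

lemma Sw_minus: "Sw (\<lambda>a b. g a b - h a b) x = Sw g x - Sw (h :: _ \<Rightarrow> _ \<Rightarrow> 'w::ab_group_add) x"
  by (simp add: Sw_def sum_subtractf)

lemma Sw_zero [simp]: "Sw (\<lambda>a b. 0) x = 0"
  by (simp add: Sw_def)

lemma Sw_sum: "Sw (\<lambda>a b. \<Sum>i\<in>I. g i a b) x = (\<Sum>i\<in>I. Sw (g i) x)"
  unfolding Sw_def by (rule sum.swap)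

lemma Sw_lin: "lin s s' f \<Longrightarrow> f (Sw g x) = Sw (\<lambda>a b. f (g a b)) x"
  unfolding Sw_def by (rule lin_sum)

lemma Sw_scale: "vector_space s \<Longrightarrow> s c (Sw g x) = Sw (\<lambda>a b. s c (g a b)) x"
  unfolding Sw_def by (rule vs_scale_sum)

lemma Sw_swap: "Sw (\<lambda>a b. Sw (\<lambda>c d. g a b c d) y) x = Sw (\<lambda>c d. Sw (\<lambda>a b. g a b c d) x) y"
  unfolding Sw_def by (rule sum.swap)

lemma sweedler_tp: "bilin scale scale s g \<Longrightarrow> sweedler s g (tp a b) = g a b"
  by (rule sweedler_tens) (auto simp: bilin_simps bilin_vs)

lemma sweedler_cop:
  assumes "bilin scale scale s g"
  shows "sweedler s g (\<Delta> x) = Sw g x"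
proof -
  have "sweedler s g (\<Delta> x) = sweedler s g (Sw (\<lambda>a b. tp a b) x)"
    by (rule arg_cong[OF cop_eq_Sw])
  also have "\<dots> = Sw g x"
    by (simp add: Sw_lin[OF lin_sweedler[OF bilin_vs(3)[OF assms]]] sweedler_tp[OF assms])
  finally show ?thesis .
qed

lemma lin_Sw:
  assumes "bilin scale scale s g"
  shows "lin scale s (Sw g)"
proof -
  have "Sw g = (\<lambda>x. sweedler s g (\<Delta> x))" using sweedler_cop[OF assms] by auto
  then show ?thesis using lin_comp[OF lin_cop lin_sweedler] bilin_vs(3)[OF assms] by simp
qed

lemma lin_Sw_par:
  assumes "\<And>a b. lin s s' (\<lambda>x. g x a b)"
  shows "lin s s' (\<lambda>x. Sw (g x) y)"
  using lin_vs[OF assms] assms unfolding Sw_def by (intro lin_sum_fun) auto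

text \<open>A bilinear \<open>g\<close> factors through the tensor square, so the pairs fixed by
  \<open>cterms\<close> may be replaced by any others with the same sum of tensors. This evaluates
  \<open>Sw\<close> wherever a coproduct is known explicitly.\<close>

lemma Sw_bilin_cong:
  assumes "finite I" and "bilin scale scale s g" and "\<Delta> x = (\<Sum>i\<in>I. tp (a i) (b i))"
  shows "Sw g x = (\<Sum>i\<in>I. g (a i) (b i))"
proof -
  have "Sw g x = sweedler s g (\<Sum>i\<in>I. tp (a i) (b i))"
    unfolding sweedler_cop[OF assms(2), symmetric] assms(3) ..
  also have "\<dots> = (\<Sum>i\<in>I. g (a i) (b i))"
    by (simp add: lin_sum[OF lin_sweedler[OF bilin_vs(3)[OF assms(2)]]] sweedler_tp[OF assms(2)])
  finally show ?thesis .
qed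

lemma trilin_lin:
  assumes "trilin scale s h"
  shows "lin scale s (\<lambda>a. h a b c)" "lin scale s (\<lambda>b. h a b c)" "lin scale s (\<lambda>c. h a b c)"
  using assms unfolding trilin_def by auto

lemma trilin_tens: "trilin scale fscale (\<lambda>a b c. tens scale UNIV [a, b, c])"
  by (intro trilinI lin_tens_UNIV_1 lin_tens_UNIV_2 lin_tens_UNIV_3 vs)

lemma bilin_Sw_left:
  assumes "trilin scale s h" shows "bilin scale scale s (\<lambda>a b. Sw (\<lambda>c d. h c d b) a)"
  by (intro bilinI lin_Sw lin_Sw_par trilin_lin[OF assms])

lemma bilin_Sw_right:
  assumes "trilin scale s h" shows "bilin scale scale s (\<lambda>a b. Sw (\<lambda>c d. h a c d) b)"
  by (intro bilinI lin_Sw lin_Sw_par trilin_lin[OF assms])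

text \<open>The bialgebra axiom is the instance where \<open>h\<close> is the universal trilinear
  map into the tensor cube; every other \<open>h\<close> factors through that one by
  \<open>?F\<close>.\<close>

lemma Sw_coassoc:
  assumes h: "trilin scale s h"
  shows "Sw (\<lambda>a b. Sw (\<lambda>c d. h c d b) a) x = Sw (\<lambda>a b. Sw (\<lambda>c d. h a c d) b) x"
proof -
  let ?T = "\<lambda>a b c. tens scale UNIV [a, b, c]"
  let ?F = "lin_ext s (\<lambda>w. case w of [a, b, c] \<Rightarrow> h a b c | _ \<Rightarrow> 0)"
  have s: "vector_space s" using lin_vs[OF trilin_lin(1)[OF h]] by auto
  have F: "lin fscale s ?F" by (rule lin_lin_ext[OF s])
  have FT: "?F (?T a b c) = h a b c" for a b c
    by (subst lin_ext_tens[OF s])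
      (auto split: list.splits simp: append_eq_Cons_conv Cons_eq_append_conv
        lin_add[OF trilin_lin(1)[OF h]] lin_add[OF trilin_lin(2)[OF h]] lin_add[OF trilin_lin(3)[OF h]]
        lin_scale[OF trilin_lin(1)[OF h]] lin_scale[OF trilin_lin(2)[OF h]]
        lin_scale[OF trilin_lin(3)[OF h]] vs_scale_simps[OF s])
  have "Sw (\<lambda>a b. Sw (\<lambda>c d. ?T c d b) a) x = Sw (\<lambda>a b. Sw (\<lambda>c d. ?T a c d) b) x"
    using bialgebra.coassoc[OF bialg, of x]
    by (simp add: sweedler_cop bilin_Sw_left[OF trilin_tens] bilin_Sw_right[OF trilin_tens]
      bilinI lin_tens_UNIV_1 lin_tens_UNIV_2 lin_tens_UNIV_3 vs)
  from arg_cong[OF this, of ?F] show ?thesis by (simp add: Sw_lin[OF F] FT)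
qed

lemma Sw_counit_left:
  assumes f: "lin scale s f"
  shows "Sw (\<lambda>a b. s (\<epsilon> a) (f b)) x = f x"
proof -
  have b: "bilin scale scale scale (\<lambda>a b. scale (\<epsilon> a) b)"
    by (intro bilinI lin_scale_var lin_scale_const lin_ident vs lin_counit)
  have "Sw (\<lambda>a b. scale (\<epsilon> a) b) x = x"
    using bialgebra.counit_left[OF bialg, of x] by (simp add: sweedler_cop[OF b])
  from arg_cong[OF this, of f] show ?thesis by (simp add: Sw_lin[OF f] lin_scale[OF f])
qed

lemma Sw_counit_right:
  assumes f: "lin scale s f"
  shows "Sw (\<lambda>a b. s (\<epsilon> b) (f a)) x = f x"
proof -
  have b: "bilin scale scale scale (\<lambda>a b. scale (\<epsilon> b) a)"
    by (intro bilinI lin_scale_var lin_scale_const lin_ident vs lin_counit)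
  have "Sw (\<lambda>a b. scale (\<epsilon> b) a) x = x"
    using bialgebra.counit_right[OF bialg, of x] by (simp add: sweedler_cop[OF b])
  from arg_cong[OF this, of f] show ?thesis by (simp add: Sw_lin[OF f] lin_scale[OF f])
qed

lemma bilin_lin:
  assumes "bilin scale scale s g"
  shows "lin scale s (\<lambda>a. g a b)" "lin scale s (\<lambda>b. g a b)"
  using assms unfolding bilin_def by auto

lemma Sw_m:
  assumes g: "bilin scale scale s g"
  shows "Sw g (m x y) = Sw (\<lambda>a b. Sw (\<lambda>c d. g (m a c) (m b d)) y) x"
proof -
  have inner: "bilin scale scale s (\<lambda>c d. h (m a c) (m b d))"
    if "bilin scale scale s h" for a b and h :: "'a \<Rightarrow> 'a \<Rightarrow> 'w::ab_group_add" and s :: "'k \<Rightarrow> 'w \<Rightarrow> 'w"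
    by (intro bilinI lin_comp[OF _ bilin_lin(1)[OF that]] lin_comp[OF _ bilin_lin(2)[OF that]]
      bilin_lin[OF bilin_m])
  have outer: "bilin scale scale s (\<lambda>a b. Sw (\<lambda>c d. h (m a c) (m b d)) y)"
    if "bilin scale scale s h" for h :: "'a \<Rightarrow> 'a \<Rightarrow> 'w::ab_group_add" and s :: "'k \<Rightarrow> 'w \<Rightarrow> 'w"
    by (intro bilinI lin_Sw_par lin_comp[OF _ bilin_lin(1)[OF that]] lin_comp[OF _ bilin_lin(2)[OF that]]
      bilin_lin[OF bilin_m])
  note t = bilin_tens_UNIV[OF vs]
  have "\<Delta> (m x y) = Sw (\<lambda>a b. Sw (\<lambda>c d. tp (m a c) (m b d)) y) x"
    using bialgebra.cop_mul[OF bialg, of x y]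
    by (simp add: sweedler_cop[OF inner[OF t]] sweedler_cop[OF outer[OF t]])
  then have "sweedler s g (\<Delta> (m x y)) = sweedler s g \<dots>" by simp
  then show ?thesis
    by (simp add: sweedler_cop[OF g] Sw_lin[OF lin_sweedler[OF bilin_vs(3)[OF g]]] sweedler_tp[OF g])
qed

lemma Sw_e:
  assumes g: "bilin scale scale s g"
  shows "Sw g e = g e e"
  using bialgebra.cop_one[OF bialg] Sw_bilin_cong[of "{()}" s g e "\<lambda>_. e" "\<lambda>_. e"] g by simp

lemma Sw_Prim:
  assumes g: "bilin scale scale s g" and "x \<in> Prim (type_bialg scale m e \<Delta> \<epsilon>)"
  shows "Sw g x = g x e + g e x"
  \<comment> \<open>The two summands of a primitive coproduct are indexed by the booleans:
    \<open>True\<close> for x \<otimes> e, \<open>False\<close> for e \<otimes> x.\<close>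
  using assms(2) Sw_bilin_cong[of "UNIV" s g x "\<lambda>t. if t then x else e" "\<lambda>t. if t then e else x"] g
  by (simp add: Prim_def UNIV_bool add.commute)

end

section \<open>The coradical filtration\<close>

text \<open>The tensor product of the functionals, extended by 0 to words of other lengths; it tests
  elements of tensor powers by scalars.\<close>

primrec word_eval :: "('a \<Rightarrow> 'k::field) list \<Rightarrow> 'a list \<Rightarrow> 'k"
  where
    "word_eval [] w = (if w = [] then 1 else 0)"
  | "word_eval (\<alpha> # \<alpha>s) w = (case w of [] \<Rightarrow> 0 | x # u \<Rightarrow> \<alpha> x * word_eval \<alpha>s u)"

lemma word_eval_add:
  "\<forall>\<alpha>\<in>set \<alpha>s. lin s (*) \<alpha> \<Longrightarrow>
    word_eval \<alpha>s (u @ (x + y) # w) = word_eval \<alpha>s (u @ x # w) + word_eval \<alpha>s (u @ y # w)"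
  by (induction \<alpha>s arbitrary: u)
    (auto split: list.splits simp: Cons_eq_append_conv append_eq_Cons_conv lin_add algebra_simps)

lemma word_eval_scale:
  "\<forall>\<alpha>\<in>set \<alpha>s. lin s (*) \<alpha> \<Longrightarrow>
    word_eval \<alpha>s (u @ s c x # w) = c * word_eval \<alpha>s (u @ x # w)"
  by (induction \<alpha>s arbitrary: u)
    (auto split: list.splits simp: Cons_eq_append_conv append_eq_Cons_conv lin_scale algebra_simps)

context type_bialgebra
begin

text \<open>As A is the direct sum of its augmentation ideal and the line of \<open>e\<close>, these
  are the functionals on the augmentation ideal.\<close>

definition aug_functional :: "('a \<Rightarrow> 'k) \<Rightarrow> bool"
  where "aug_functional \<alpha> \<longleftrightarrow> lin scale (*) \<alpha> \<and> \<alpha> e = 0"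

definition rcontr :: "('a \<Rightarrow> 'k) \<Rightarrow> 'a \<Rightarrow> 'a"
  where "rcontr \<alpha> = Sw (\<lambda>a b. scale (\<alpha> b) a)"

definition lcontr :: "('a \<Rightarrow> 'k) \<Rightarrow> 'a \<Rightarrow> 'a"
  where "lcontr \<alpha> = Sw (\<lambda>a b. scale (\<alpha> a) b)"

text \<open>For \<open>n \<ge> 1\<close>, \<open>fil n\<close> is the \<open>(n - 1)\<close>-st term of the coradical filtration; it is
  expressed by contractions, so that no tensor powers are needed.\<close>

primrec fil :: "nat \<Rightarrow> 'a \<Rightarrow> bool"
  where
    "fil 0 x \<longleftrightarrow> x = 0"
  | "fil (Suc n) x \<longleftrightarrow> (\<forall>\<alpha>. aug_functional \<alpha> \<longrightarrow> fil n (rcontr \<alpha> x))"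

definition aug_proj :: "'a \<Rightarrow> 'a"
  where "aug_proj x = x - scale (\<epsilon> x) e"

lemma bilin_scale_left: "lin scale (*) \<alpha> \<Longrightarrow> lin scale s f \<Longrightarrow> bilin scale scale s (\<lambda>a b. s (\<alpha> a) (f b))"
  and bilin_scale_right: "lin scale (*) \<alpha> \<Longrightarrow> lin scale s f \<Longrightarrow> bilin scale scale s (\<lambda>a b. s (\<alpha> b) (f a))"
  by (intro bilinI lin_scale_var lin_scale_const; simp add: lin_vs)+

lemma bilin_rcontr: "lin scale (*) \<alpha> \<Longrightarrow> bilin scale scale scale (\<lambda>a b. scale (\<alpha> b) a)"
  and bilin_lcontr: "lin scale (*) \<alpha> \<Longrightarrow> bilin scale scale scale (\<lambda>a b. scale (\<alpha> a) b)"
  by (rule bilin_scale_left bilin_scale_right; simp add: lin_ident vs)+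

lemma lin_rcontr: "lin scale (*) \<alpha> \<Longrightarrow> lin scale scale (rcontr \<alpha>)"
  unfolding rcontr_def by (intro lin_Sw bilin_rcontr)

lemma lin_lcontr: "lin scale (*) \<alpha> \<Longrightarrow> lin scale scale (lcontr \<alpha>)"
  unfolding lcontr_def by (intro lin_Sw bilin_lcontr)

lemma rcontr_e: "lin scale (*) \<alpha> \<Longrightarrow> rcontr \<alpha> e = scale (\<alpha> e) e"
  unfolding rcontr_def by (rule Sw_e[OF bilin_rcontr])

lemma lcontr_e: "lin scale (*) \<alpha> \<Longrightarrow> lcontr \<alpha> e = scale (\<alpha> e) e"
  unfolding lcontr_def by (rule Sw_e[OF bilin_lcontr])

lemma lin_rcontr_eq: "lin scale s f \<Longrightarrow> f (rcontr \<alpha> x) = Sw (\<lambda>a b. s (\<alpha> b) (f a)) x"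
  unfolding rcontr_def by (simp add: Sw_lin lin_scale)

lemma lin_lcontr_eq: "lin scale s f \<Longrightarrow> f (lcontr \<alpha> x) = Sw (\<lambda>a b. s (\<alpha> a) (f b)) x"
  unfolding lcontr_def by (simp add: Sw_lin lin_scale)

text \<open>Both sides are \<Sum> \<alpha>(x1) \<beta>(x2). This trades information about left
  contractions for information about right ones.\<close>

lemma functional_rcontr_lcontr:
  assumes "lin scale (*) \<alpha>" "lin scale (*) \<beta>"
  shows "\<alpha> (rcontr \<beta> x) = \<beta> (lcontr \<alpha> x)"
  using lin_rcontr_eq[OF assms(1), of \<beta> x] lin_lcontr_eq[OF assms(2), of \<alpha> x]
  by (simp add: mult.commute)

lemma counit_rcontr:
  assumes "lin scale (*) \<alpha>" shows "\<epsilon> (rcontr \<alpha> x) = \<alpha> x"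
  using lin_rcontr_eq[OF lin_counit, of \<alpha> x] Sw_counit_left[OF assms, of x]
  by (simp add: mult.commute)

text \<open>Both sides are \<Sum> \<gamma>(x1) \<alpha>(x3) x2, by coassociativity.\<close>

lemma rcontr_lcontr_commute:
  assumes "lin scale (*) \<alpha>" "lin scale (*) \<gamma>"
  shows "rcontr \<alpha> (lcontr \<gamma> x) = lcontr \<gamma> (rcontr \<alpha> x)"
proof -
  have "trilin scale scale (\<lambda>a b c. scale (\<gamma> a) (scale (\<alpha> c) b))"
    by (intro trilinI lin_scale_var lin_scale_const lin_ident assms vs)
  from Sw_coassoc[OF this, of x] show ?thesis
    unfolding lin_lcontr_eq[OF lin_rcontr[OF assms(1)]] lin_rcontr_eq[OF lin_lcontr[OF assms(2)]]
    unfolding rcontr_def lcontr_def Sw_scale[OF vs] by (simp add: vs_simps mult.commute)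
qed

lemma lin_aug_proj: "lin scale scale aug_proj"
  unfolding aug_proj_def[abs_def] by (intro lin_minus lin_scale_var lin_ident vs lin_counit)

lemma aug_proj_e [simp]: "aug_proj e = 0"
  by (simp add: aug_proj_def vs_simps)

lemma counit_aug_proj [simp]: "\<epsilon> (aug_proj x) = 0"
  by (simp add: aug_proj_def lin_diff[OF lin_counit] lin_scale[OF lin_counit])

lemma aug_functional_aug_proj: "lin scale (*) \<gamma> \<Longrightarrow> aug_functional (\<lambda>x. \<gamma> (aug_proj x))"
  unfolding aug_functional_def using lin_comp[OF lin_aug_proj] lin_0 by auto

lemma aug_functional_lin: "aug_functional \<alpha> \<Longrightarrow> lin scale (*) \<alpha>"
  by (simp add: aug_functional_def)

lemma aug_functional_separation:
  assumes "\<epsilon> x = 0" and "\<And>\<alpha>. aug_functional \<alpha> \<Longrightarrow> \<alpha> x = 0"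
  shows "x = 0"
  using assms(2)[OF aug_functional_aug_proj] assms(1)
  by (intro functional_separation[OF vs, of x]) (auto simp: aug_proj_def vs_simps)

lemma fil_lin: "fil n x \<Longrightarrow> fil n y \<Longrightarrow> fil n (x + scale c y)"
proof (induction n arbitrary: x y)
  case 0
  then show ?case by (simp add: vs_simps)
next
  case (Suc n)
  then show ?case
    by (auto simp: lin_add[OF lin_rcontr[OF aug_functional_lin]]
      lin_scale[OF lin_rcontr[OF aug_functional_lin]])
qed

lemma fil_zero: "fil n 0"
  by (induction n) (auto simp: lin_0[OF lin_rcontr[OF aug_functional_lin]])

lemma fil_Suc: "fil n x \<Longrightarrow> fil (Suc n) x"
proof (induction n arbitrary: x)
  case 0
  then show ?case by (simp add: lin_0[OF lin_rcontr[OF aug_functional_lin]])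
next
  case (Suc n)
  then show ?case by simp
qed

lemma fil_mono: "fil n x \<Longrightarrow> n \<le> k \<Longrightarrow> fil k x"
  by (induction k) (auto simp: le_Suc_eq intro: fil_Suc simp del: fil.simps)

lemma fil_e: "fil (Suc n) e"
  using rcontr_e by (auto simp: aug_functional_def vs_simps fil_zero)

text \<open>The counit of a contraction by \<alpha> is \<alpha>(x), so every augmentation functional
  vanishes at x, and hence at its projection to the augmentation ideal.\<close>

lemma fil_1:
  assumes "fil 1 x" shows "x = scale (\<epsilon> x) e"
proof -
  have "rcontr \<alpha> x = 0" if "aug_functional \<alpha>" for \<alpha>
    using assms[unfolded One_nat_def] that by simp
  then have "\<alpha> x = 0" if "aug_functional \<alpha>" for \<alpha>
    using counit_rcontr[OF aug_functional_lin[OF that], of x] that lin_0[OF lin_counit] by simp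
  then have "aug_proj x = 0"
    by (intro aug_functional_separation counit_aug_proj)
      (auto simp: aug_proj_def lin_diff lin_scale aug_functional_def)
  then show ?thesis by (simp add: aug_proj_def)
qed

text \<open>The filtration is defined by right contractions; left ones commute with them and
  therefore lower it too. The induction starts with the multiples of \<open>e\<close>, which are
  killed because \<gamma> vanishes at \<open>e\<close>.\<close>

lemma fil_lcontr: "fil (Suc n) x \<Longrightarrow> aug_functional \<gamma> \<Longrightarrow> fil n (lcontr \<gamma> x)"
proof (induction n arbitrary: x)
  case 0
  have "x = scale (\<epsilon> x) e" using 0 fil_1 by simp
  then have "lcontr \<gamma> x = scale (\<epsilon> x) (lcontr \<gamma> e)"
    using lin_scale[OF lin_lcontr[OF aug_functional_lin[OF 0(2)]]] by metis
  then show ?case using 0 by (simp add: lcontr_e aug_functional_def vs_simps)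
next
  case (Suc n)
  then show ?case
    using rcontr_lcontr_commute[OF aug_functional_lin aug_functional_lin] by simp
qed

lemma fil_fold_rcontr:
  "(\<And>\<alpha>s. length \<alpha>s = n \<Longrightarrow> \<forall>\<alpha>\<in>set \<alpha>s. aug_functional \<alpha> \<Longrightarrow> foldr rcontr \<alpha>s x = 0) \<Longrightarrow> fil n x"
proof (induction n arbitrary: x)
  case 0
  then show ?case by (metis fil.simps(1) foldr_Nil id_apply length_0_conv list.set(1) ball_empty)
next
  case (Suc n)
  have "fil n (rcontr \<alpha> x)" if \<alpha>: "aug_functional \<alpha>" for \<alpha>
  proof (rule Suc.IH)
    fix \<alpha>s :: "('a \<Rightarrow> 'k) list" assume "length \<alpha>s = n" "\<forall>\<alpha>\<in>set \<alpha>s. aug_functional \<alpha>"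
    then show "foldr rcontr \<alpha>s (rcontr \<alpha> x) = 0"
      \<comment> \<open>\<open>foldr\<close> applies the last functional first, so \<alpha> is
        appended at the end.\<close>
      using Suc.prems[of "\<alpha>s @ [\<alpha>]"] \<alpha> by simp
  qed
  then show ?case by simp
qed

text \<open>The reduced coproduct splits the first letter y into two. Its correction terms y
  \<otimes> e and e \<otimes> y die because \<beta> and \<alpha> vanish at \<open>e\<close>, and
  \<alpha> \<otimes> \<beta> on the rest is \<alpha> of the contraction by \<beta>.\<close>

lemma lin_ext_word_eval_red_cop_iter_Suc:
  assumes \<alpha>: "aug_functional \<alpha>" and \<beta>: "aug_functional \<beta>" and \<alpha>s: "\<forall>\<alpha>\<in>set \<alpha>s. aug_functional \<alpha>"
  shows "lin_ext (*) (word_eval (\<alpha> # \<beta> # \<alpha>s)) (red_cop_iter (type_bialg scale m e \<Delta> \<epsilon>) (Suc n) x) =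
    lin_ext (*) (word_eval ((\<lambda>y. \<alpha> (rcontr \<beta> y)) # \<alpha>s)) (red_cop_iter (type_bialg scale m e \<Delta> \<epsilon>) n x)"
proof -
  let ?H = "type_bialg scale m e \<Delta> \<epsilon>"
  let ?E = "lin_ext (*) (word_eval (\<alpha> # \<beta> # \<alpha>s))"
  let ?G = "\<lambda>w. case w of [] \<Rightarrow> 0 | y # u \<Rightarrow>
    sweedler fscale (\<lambda>y1 y2. btens ?H (y1 # y2 # u)) (red_cop ?H y)"
  have E: "lin fscale (*) ?E" by (rule lin_lin_ext[OF vector_space_mult])
  have tens: "?E (tens scale UNIV w) = word_eval (\<alpha> # \<beta> # \<alpha>s) w" for w
    using \<alpha> \<beta> \<alpha>s
    by (intro lin_ext_tens vector_space_mult word_eval_add word_eval_scale) (auto simp: aug_functional_def)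
  have "?E (?G w) = word_eval ((\<lambda>y. \<alpha> (rcontr \<beta> y)) # \<alpha>s) w" for w
  proof (cases w)
    case Nil
    then show ?thesis by (simp add: lin_0[OF E])
  next
    case (Cons y u)
    let ?t = "\<lambda>y1 y2. tens scale UNIV (y1 # y2 # u)"
    have b: "bilin scale scale fscale ?t"
      using lin_tens_UNIV[OF vs, of "[]"] lin_tens_UNIV[OF vs, of "[_]"] by (intro bilinI) auto
    have "?G w = Sw ?t y - ?t y e - ?t e y"
      using Cons by (simp add: red_cop_def lin_diff[OF lin_sweedler[OF vector_space_fscale]]
        sweedler_cop[OF b] sweedler_tp[OF b])
    then have "?E (?G w) = Sw (\<lambda>y1 y2. \<alpha> y1 * (\<beta> y2 * word_eval \<alpha>s u)) y"
      using \<alpha> \<beta> by (simp add: lin_diff[OF E] Sw_lin[OF E] tens aug_functional_def)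
    also have "\<dots> = \<alpha> (rcontr \<beta> y) * word_eval \<alpha>s u"
      using lin_rcontr_eq[OF aug_functional_lin[OF \<alpha>], of \<beta> y]
      by (simp add: Sw_def sum_distrib_right mult.assoc mult.left_commute)
    finally show ?thesis using Cons by simp
  qed
  then have eq: "(\<lambda>w. ?E (?G w)) = word_eval ((\<lambda>y. \<alpha> (rcontr \<beta> y)) # \<alpha>s)" by (rule ext)
  show ?thesis unfolding red_cop_iter.simps(2) lin_compose_lin_ext[OF E] eq ..
qed

text \<open>The bridge from the definition of connectedness, by iterated reduced coproducts, to the
  filtration \<open>fil\<close>, by iterated contractions.\<close>

lemma lin_ext_word_eval_red_cop_iter:
  "aug_functional \<alpha> \<Longrightarrow> \<forall>\<alpha>\<in>set \<alpha>s. aug_functional \<alpha> \<Longrightarrow>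
    lin_ext (*) (word_eval (\<alpha> # \<alpha>s)) (red_cop_iter (type_bialg scale m e \<Delta> \<epsilon>) (length \<alpha>s) x) =
    \<alpha> (foldr rcontr \<alpha>s x)"
proof (induction \<alpha>s arbitrary: \<alpha>)
  case Nil
  then have "lin_ext (*) (word_eval [\<alpha>]) (tens scale UNIV [x]) = word_eval [\<alpha>] [x]"
    by (intro lin_ext_tens vector_space_mult word_eval_add word_eval_scale)
      (auto simp: aug_functional_def)
  moreover have "word_eval [\<alpha>] [x] = \<alpha> x" by simp
  ultimately show ?case by (simp del: word_eval.simps)
next
  case (Cons \<beta> \<alpha>s)
  have "aug_functional (\<lambda>y. \<alpha> (rcontr \<beta> y))"
    using Cons.prems lin_comp[OF lin_rcontr, of \<beta> "(*)" \<alpha>]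
    by (auto simp: aug_functional_def rcontr_e vs_simps lin_0)
  then show ?case
    using Cons lin_ext_word_eval_red_cop_iter_Suc[of \<alpha> \<beta> \<alpha>s "length \<alpha>s" x]
    by (simp del: red_cop_iter.simps word_eval.simps)
qed

text \<open>A convolution \<open>\<Sum> B(x\<^sup>(\<^sup>1\<^sup>), f(x\<^sup>(\<^sup>2\<^sup>)))\<close> with \<open>B(e, _) = 0\<close> only sees \<open>f\<close> one step lower in the
  filtration.\<close>

lemma Sw_eq_0I:
  assumes B: "bilin scale s' s'' B" and Be: "\<And>w. B e w = 0" and f: "lin scale s' f"
    and zero: "\<And>\<gamma>. aug_functional \<gamma> \<Longrightarrow> f (lcontr \<gamma> x) = 0"
  shows "Sw (\<lambda>a b. B a (f b)) x = 0"
proof -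
  have "B a w = B (aug_proj a) w" for a w
    by (simp add: aug_proj_def bilin_simps[OF B] Be vs_scale_simps[OF bilin_vs(3)[OF B]])
  then have "Sw (\<lambda>a b. B a (f b)) x = Sw (\<lambda>a b. B (aug_proj a) (f b)) x" by simp
  also have "\<dots> = 0"
    unfolding Sw_def
  proof (rule bilin_sum_eq_0I[OF vs B finite_lessThan])
    fix \<gamma> :: "'a \<Rightarrow> 'k" assume \<gamma>: "lin scale (*) \<gamma>"
    show "(\<Sum>i<length (cterms x). s' (\<gamma> (aug_proj (fst (cterms x ! i)))) (f (snd (cterms x ! i)))) = 0"
      using zero[OF aug_functional_aug_proj[OF \<gamma>]]
      unfolding lin_lcontr_eq[OF f] Sw_def .
  qed
  finally show ?thesis .
qed

end

section \<open>Convolution recursions and series on a connected bialgebra\<close>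

locale connected_type_bialgebra = type_bialgebra scale m e \<Delta> \<epsilon>
  for scale :: "'k::field \<Rightarrow> 'a::ab_group_add \<Rightarrow> 'a" and m :: "'a \<Rightarrow> 'a \<Rightarrow> 'a" and e :: 'a
    and \<Delta> :: "'a \<Rightarrow> ('a list \<Rightarrow>\<^sub>0 'k)" and \<epsilon> :: "'a \<Rightarrow> 'k" +
  assumes conn: "connected_bialgebra (type_bialg scale m e \<Delta> \<epsilon>)"
begin

lemma ex_fil: "\<exists>n. fil n x"
proof -
  let ?y = "aug_proj x"
  have "\<epsilon> y = 0 \<Longrightarrow> \<exists>n. red_cop_iter (type_bialg scale m e \<Delta> \<epsilon>) n y = 0" for y
    using conn unfolding connected_bialgebra_def by fastforce
  then obtain n where "red_cop_iter (type_bialg scale m e \<Delta> \<epsilon>) n ?y = 0"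
    using counit_aug_proj by blast
  then have zero: "\<alpha> (foldr rcontr \<alpha>s ?y) = 0"
    if "aug_functional \<alpha>" "length \<alpha>s = n" "\<forall>\<alpha>\<in>set \<alpha>s. aug_functional \<alpha>" for \<alpha> \<alpha>s
    using lin_ext_word_eval_red_cop_iter[of \<alpha> \<alpha>s ?y] that lin_0[OF lin_lin_ext[OF vector_space_mult]]
    by metis
  \<comment> \<open>One contraction more than n: the vanishing above concerns functionals that are 0
    at \<open>e\<close>, and precomposing an arbitrary \<gamma> with one further contraction
    produces such a functional.\<close>
  have "fil (Suc n) ?y"
  proof (rule fil_fold_rcontr)
    fix \<alpha>s :: "('a \<Rightarrow> 'k) list" assume \<alpha>s: "length \<alpha>s = Suc n" "\<forall>\<alpha>\<in>set \<alpha>s. aug_functional \<alpha>"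
    then obtain \<beta> \<beta>s where \<beta>: "\<alpha>s = \<beta> # \<beta>s" by (cases \<alpha>s) auto
    show "foldr rcontr \<alpha>s ?y = 0"
    proof (rule functional_separation[OF vs])
      fix \<gamma> :: "'a \<Rightarrow> 'k" assume "lin scale (*) \<gamma>"
      then have "aug_functional (\<lambda>y. \<gamma> (rcontr \<beta> y))"
        using \<beta> \<alpha>s lin_comp[OF lin_rcontr, of \<beta> "(*)" \<gamma>]
        by (auto simp: aug_functional_def rcontr_e vs_simps lin_0)
      from zero[OF this, of \<beta>s] show "\<gamma> (foldr rcontr \<alpha>s ?y) = 0"
        using \<beta> \<alpha>s by simp
    qed
  qed
  then have "fil (Suc n) (?y + scale (\<epsilon> x) e)" by (intro fil_lin fil_e)
  then show ?thesis by (auto simp: aug_proj_def simp del: fil.simps)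
qed

text \<open>Because B(e, _) = 0, the right-hand side sees u only one step lower in the filtration.
  This is the uniqueness principle for convolution recursions: the difference of two solutions
  satisfies the hypotheses.\<close>

lemma conv_fixed_point_eq_0:
  assumes B: "bilin scale s s B" and Be: "\<And>w. B e w = 0" and u: "lin scale s u"
    and rec: "\<And>x. u x = Sw (\<lambda>a b. B a (u b)) x"
  shows "u x = 0"
proof -
  obtain n where "fil n x" using ex_fil by blast
  then show ?thesis
  proof (induction n arbitrary: x)
    case 0
    then show ?case using lin_0[OF u] by simp
  next
    case (Suc n)
    then show ?case
      unfolding rec[of x] using fil_lcontr by (intro Sw_eq_0I[OF B Be u]) blast
  qed
qed

primrec conv_iter :: "('a \<Rightarrow> 'w \<Rightarrow> 'w::ab_group_add) \<Rightarrow> ('a \<Rightarrow> 'w) \<Rightarrow> nat \<Rightarrow> 'a \<Rightarrow> 'w"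
  where
    "conv_iter B h 0 = h"
  | "conv_iter B h (Suc n) = Sw (\<lambda>a b. B a (conv_iter B h n b))"

lemma lin_conv_iter:
  assumes B: "bilin scale s s B" and h: "lin scale s h"
  shows "lin scale s (conv_iter B h n)"
proof (induction n)
  case (Suc n)
  then show ?case by (auto intro!: lin_Sw bilinI bilin_left[OF B] bilin_right[OF B] lin_ident vs)
qed (use h in simp)

lemma conv_iter_eq_0:
  assumes B: "bilin scale s s B" and Be: "\<And>w. B e w = 0" and h: "lin scale s h"
  shows "fil n x \<Longrightarrow> conv_iter B h n x = 0"
proof (induction n arbitrary: x)
  case 0
  then show ?case using lin_0[OF h] by simp
next
  case (Suc n)
  then show ?case using fil_lcontr by (auto intro!: Sw_eq_0I[OF B Be lin_conv_iter[OF B h]])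
qed

definition deg :: "'a \<Rightarrow> nat"
  where "deg x = (LEAST n. fil n x)"

text \<open>The series terminates at x because the n-th iterate vanishes on \<open>fil n\<close>. By
  \<open>conv_series_eq\<close> any larger cut-off gives the same value, so elements of different
  degrees can share one.\<close>

definition conv_series ::
    "('k \<Rightarrow> 'w \<Rightarrow> 'w::ab_group_add) \<Rightarrow> (nat \<Rightarrow> 'k) \<Rightarrow> ('a \<Rightarrow> 'w \<Rightarrow> 'w) \<Rightarrow> ('a \<Rightarrow> 'w) \<Rightarrow> 'a \<Rightarrow> 'w"
  where "conv_series s c B h x = (\<Sum>n<deg x. s (c n) (conv_iter B h n x))"

lemma fil_deg: "fil (deg x) x"
  unfolding deg_def using ex_fil by (rule LeastI_ex)

lemma conv_series_eq:
  assumes B: "bilin scale s s B" and Be: "\<And>w. B e w = 0" and h: "lin scale s h" and N: "fil N x"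
  shows "conv_series s c B h x = (\<Sum>n<N. s (c n) (conv_iter B h n x))"
proof -
  have le: "deg x \<le> N" unfolding deg_def using N by (rule Least_le)
  have "conv_iter B h n x = 0" if "deg x \<le> n" for n
    using conv_iter_eq_0[OF B Be h] fil_mono[OF fil_deg that] by blast
  then show ?thesis
    unfolding conv_series_def using le vs_scale_simps(5)[OF bilin_vs(3)[OF B]]
    by (intro sum.mono_neutral_left) auto
qed

lemma lin_conv_series:
  assumes B: "bilin scale s s B" and Be: "\<And>w. B e w = 0" and h: "lin scale s h"
  shows "lin scale s (conv_series s c B h)"
proof -
  note s = bilin_vs(3)[OF B]
  note eq = conv_series_eq[OF B Be h, where c=c]
  have "conv_series s c B h (x + scale d y) = conv_series s c B h x + s d (conv_series s c B h y)" for x y d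
  proof -
    define N where "N = max (deg x) (deg y)"
    have N: "fil N x" "fil N y" unfolding N_def by (auto intro: fil_mono[OF fil_deg])
    show ?thesis
      unfolding eq[OF N(1)] eq[OF N(2)] eq[OF fil_lin[OF N]]
      by (simp add: lin_add[OF lin_conv_iter[OF B h]] lin_scale[OF lin_conv_iter[OF B h]]
        vs_scale_simps[OF s] vs_scale_sum[OF s] sum.distrib mult.commute)
  qed note * = this
  have "conv_series s c B h 0 = 0" using eq[OF fil_zero[of 0]] by simp
  then show ?thesis
    unfolding lin_iff using s vs *[of _ 1] *[of 0] by (auto simp: vs_simps vs_scale_simps[OF s])
qed

abbreviation "conv_sum s \<equiv> conv_series s (\<lambda>_. 1)"

lemma conv_sum_rec:
  assumes B: "bilin scale s s B" and Be: "\<And>w. B e w = 0" and h: "lin scale s h"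
  shows "conv_sum s B h x = h x + Sw (\<lambda>a b. B a (conv_sum s B h b)) x"
proof -
  \<comment> \<open>A cut-off for x and for all second factors of the chosen pairs at once; it
    exists because \<open>Sw\<close> is a finite sum.\<close>
  define N where "N = Max (insert (deg x) ((\<lambda>i. deg (snd (cterms x ! i))) ` {..<length (cterms x)}))"
  have Nx: "fil N x" unfolding N_def by (rule fil_mono[OF fil_deg]) auto
  have Ni: "fil N (snd (cterms x ! i))" if "i < length (cterms x)" for i
    unfolding N_def by (rule fil_mono[OF fil_deg]) (use that in auto)
  note s1 = vs_scale_simps(4)[OF bilin_vs(3)[OF B]]
  note eq = conv_series_eq[OF B Be h, where c="\<lambda>_. 1", unfolded s1]
  have "Sw (\<lambda>a b. B a (conv_sum s B h b)) x = Sw (\<lambda>a b. B a (\<Sum>n<N. conv_iter B h n b)) x"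
    unfolding Sw_def by (intro sum.cong refl) (use eq[OF Ni] in auto)
  also have "\<dots> = (\<Sum>n<N. conv_iter B h (Suc n) x)"
    by (simp add: bilin_sum[OF B] Sw_sum)
  finally show ?thesis
    unfolding eq[OF fil_Suc[OF Nx]] by (subst sum.lessThan_Suc_shift) simp
qed

text \<open>The identity is the convolution unit plus \<open>aug_proj\<close>, so its convolution
  inverse is a geometric series in the negative of \<open>aug_proj\<close>. The recursion of the
  series is one of the two antipode laws.\<close>

lemma ex_antipode: "\<exists>S. is_antipode (type_bialg scale m e \<Delta> \<epsilon>) S"
proof -
  define B where "B = (\<lambda>a y. - m (aug_proj a) y)"
  define h where "h = (\<lambda>x. scale (\<epsilon> x) e)"
  have B: "bilin scale scale scale B" unfolding B_def
    by (intro bilinI lin_uminus bilin_left[OF bilin_m] bilin_right[OF bilin_m] lin_aug_proj lin_ident vs)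
  have Be: "B e w = 0" for w by (simp add: B_def bilin_simps[OF bilin_m])
  have h: "lin scale scale h" unfolding h_def by (intro lin_scale_var vs lin_counit)
  define S where "S = conv_sum scale B h"
  have S: "lin scale scale S" unfolding S_def by (rule lin_conv_series[OF B Be h])
  have mB: "m a y = scale (\<epsilon> a) y - B a y" for a y
    by (simp add: B_def aug_proj_def bilin_simps[OF bilin_m])
  have conv: "Sw (\<lambda>a b. m a (f b)) x = f x - Sw (\<lambda>a b. B a (f b)) x" if "lin scale scale f" for f x
    by (simp add: mB Sw_minus Sw_counit_left[OF that])
  have right: "Sw (\<lambda>a b. m a (S b)) x = h x" for x
    using conv[OF S, of x] conv_sum_rec[OF B Be h, of x] by (simp add: S_def)
  have bS: "bilin scale scale scale (\<lambda>a b. m (S a) b)"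
    by (intro bilinI bilin_left[OF bilin_m] bilin_right[OF bilin_m] S lin_ident vs)
  have bS': "bilin scale scale scale (\<lambda>a b. m a (S b))"
    by (intro bilinI bilin_left[OF bilin_m] bilin_right[OF bilin_m] S lin_ident vs)
  (* By associativity id * (S * id) = (id * S) * id = id, so id * u = 0 for u = S * id - h. *)
  let ?u = "\<lambda>x. Sw (\<lambda>a b. m (S a) b) x - h x"
  have left: "?u x = 0" for x
  proof (rule conv_fixed_point_eq_0[OF B Be, of ?u])
    show u: "lin scale scale ?u" by (intro lin_minus lin_Sw bS h)
    fix x
    have tri: "trilin scale scale (\<lambda>a c d. m (m a (S c)) d)"
      by (intro trilinI bilin_left[OF bilin_m] bilin_right[OF bilin_m] S lin_ident vs)
    have "Sw (\<lambda>a b. m a (Sw (\<lambda>c d. m (S c) d) b)) x = Sw (\<lambda>a b. Sw (\<lambda>c d. m (m a (S c)) d) b) x"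
      by (simp add: Sw_lin[OF bilin_lin(2)[OF bilin_m]] m_assoc)
    also have "\<dots> = Sw (\<lambda>a b. Sw (\<lambda>c d. m (m c (S d)) b) a) x"
      by (rule Sw_coassoc[OF tri, symmetric])
    also have "\<dots> = Sw (\<lambda>a b. m (h a) b) x"
      by (simp add: Sw_lin[OF bilin_lin(1)[OF bilin_m], symmetric] right)
    also have "\<dots> = x"
      by (simp add: h_def bilin_simps[OF bilin_m] Sw_counit_left[OF lin_ident[OF vs]])
    finally have 1: "Sw (\<lambda>a b. m a (Sw (\<lambda>c d. m (S c) d) b)) x = x" .
    have 2: "Sw (\<lambda>a b. m a (h b)) x = x"
      by (simp add: h_def bilin_simps[OF bilin_m] Sw_counit_right[OF lin_ident[OF vs]])
    have "Sw (\<lambda>a b. m a (?u b)) x = 0"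
      by (simp add: bilin_simps[OF bilin_m] Sw_minus 1 2)
    then show "?u x = Sw (\<lambda>a b. B a (?u b)) x"
      using conv[OF u, of x] by simp
  qed
  show ?thesis
    unfolding is_antipode_def using right left
    by (intro exI[of _ S])
      (simp add: sweedler_cop[OF bS] sweedler_cop[OF bS'] h_def lin_add[OF S] lin_scale[OF S])
qed

end

section \<open>The Eulerian idempotent\<close>

definition binomial_poly :: "nat \<Rightarrow> 'k::field_char_0 poly"
  where "binomial_poly j = smult (1 / fact j) (\<Prod>i<j. [:- of_nat i, 1:])"

lemma poly_binomial_poly: "poly (binomial_poly j) (of_nat k) = of_nat (k choose j)"
  by (simp add: binomial_poly_def poly_prod binomial_gbinomial gbinomial_prod_rev atLeast0LessThan)

lemma binomial_poly_0: "binomial_poly 0 = 1" and binomial_poly_1: "binomial_poly (Suc 0) = [:0, 1:]"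
  by (simp_all add: binomial_poly_def)

lemma coeff_0_binomial_poly: "0 < j \<Longrightarrow> coeff (binomial_poly j) 0 = 0"
  using poly_binomial_poly[of j 0] by (simp add: poly_0_coeff_0 binomial_eq_0)

text \<open>In characteristic zero the difference would have infinitely many roots. This turns
  identities between convolution powers into identities between coefficients.\<close>

lemma poly_eq_if_eq_on_nat:
  fixes p q :: "'k::field_char_0 poly"
  assumes "\<And>k. poly p (of_nat k) = poly q (of_nat k)"
  shows "p = q"
proof (rule ccontr)
  assume "p \<noteq> q"
  then have "finite {x. poly (p - q) x = 0}" by (intro poly_roots_finite) simp
  moreover have "range of_nat \<subseteq> {x. poly (p - q) x = 0}" using assms by auto
  moreover have "infinite (range (of_nat :: nat \<Rightarrow> 'k))"
    using inj_of_nat finite_imageD infinite_UNIV_nat by blast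
  ultimately show False using finite_subset by blast
qed

locale commutative_connected_bialgebra = connected_type_bialgebra scale m e \<Delta> \<epsilon>
  for scale :: "'k::field_char_0 \<Rightarrow> 'a::ab_group_add \<Rightarrow> 'a" and m :: "'a \<Rightarrow> 'a \<Rightarrow> 'a" and e :: 'a
    and \<Delta> :: "'a \<Rightarrow> ('a list \<Rightarrow>\<^sub>0 'k)" and \<epsilon> :: "'a \<Rightarrow> 'k" +
  assumes m_comm: "m x y = m y x"
begin

definition unit_counit :: "'a \<Rightarrow> 'a"
  where "unit_counit x = scale (\<epsilon> x) e"

text \<open>The k-fold convolution power of the identity.\<close>

definition adams :: "nat \<Rightarrow> 'a \<Rightarrow> 'a"
  where "adams = conv_iter m unit_counit"

text \<open>Under this action \<open>e\<close> acts by 0, as the convolution series require. The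
  iterates \<open>proj_power\<close> are the convolution powers of the identity minus the
  convolution unit.\<close>

definition proj_prod :: "'a \<Rightarrow> 'a \<Rightarrow> 'a"
  where "proj_prod a y = m (aug_proj a) y"

definition proj_power :: "nat \<Rightarrow> 'a \<Rightarrow> 'a"
  where "proj_power = conv_iter proj_prod unit_counit"

text \<open>The coefficient of \<open>t\<close> in \<open>t choose n\<close> is \<open>(-1)^(n-1) / n\<close>, so \<open>euler\<close> is the convolution
  logarithm of the identity.\<close>

definition euler :: "'a \<Rightarrow> 'a"
  where "euler = conv_series scale (\<lambda>n. coeff (binomial_poly n) 1) proj_prod unit_counit"

lemma lin_unit_counit: "lin scale scale unit_counit"
  unfolding unit_counit_def[abs_def] by (intro lin_scale_var vs lin_counit)

lemma bilin_proj_prod: "bilin scale scale scale proj_prod"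
  unfolding proj_prod_def[abs_def]
  by (intro bilinI bilin_left[OF bilin_m] bilin_right[OF bilin_m] lin_aug_proj lin_ident vs)

lemma proj_prod_e: "proj_prod e y = 0"
  by (simp add: proj_prod_def bilin_simps[OF bilin_m])

lemma lin_adams: "lin scale scale (adams k)"
  unfolding adams_def by (rule lin_conv_iter[OF bilin_m lin_unit_counit])

lemma lin_proj_power: "lin scale scale (proj_power k)"
  unfolding proj_power_def by (rule lin_conv_iter[OF bilin_proj_prod lin_unit_counit])

lemma proj_power_0: "proj_power 0 x = scale (\<epsilon> x) e"
  by (simp add: proj_power_def unit_counit_def)

lemma proj_power_Suc: "proj_power (Suc n) x = Sw (\<lambda>a b. proj_prod a (proj_power n b)) x"
  by (simp add: proj_power_def)

lemma bilin_proj_power: "bilin scale scale scale (\<lambda>a b. proj_prod a (proj_power n b))"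
  by (intro bilinI bilin_left[OF bilin_proj_prod] bilin_right[OF bilin_proj_prod] lin_proj_power
    lin_ident vs)

lemma proj_power_eq_0: "fil n x \<Longrightarrow> proj_power n x = 0"
  unfolding proj_power_def by (rule conv_iter_eq_0[OF bilin_proj_prod proj_prod_e lin_unit_counit])

lemma euler_eq: "fil N x \<Longrightarrow> euler x = (\<Sum>n<N. scale (coeff (binomial_poly n) 1) (proj_power n x))"
  unfolding euler_def proj_power_def
  by (rule conv_series_eq[OF bilin_proj_prod proj_prod_e lin_unit_counit])

lemma lin_euler: "lin scale scale euler"
  unfolding euler_def by (rule lin_conv_series[OF bilin_proj_prod proj_prod_e lin_unit_counit])

text \<open>Commutativity enters through \<open>swap\<close>: it makes the convolution of algebra
  morphisms into A again an algebra morphism.\<close>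

lemma adams_m: "adams k (m x y) = m (adams k x) (adams k y)"
proof (induction k arbitrary: x y)
  case 0
  show ?case by (simp add: adams_def unit_counit_def bilin_simps[OF bilin_m] vs_simps mult.commute)
next
  case (Suc k)
  have b: "bilin scale scale scale (\<lambda>a b. m a (adams k b))"
    by (intro bilinI bilin_left[OF bilin_m] bilin_right[OF bilin_m] lin_adams lin_ident vs)
  have rec: "adams (Suc k) = Sw (\<lambda>a b. m a (adams k b))"
    by (simp add: adams_def)
  have swap: "m (m a c) (m b d) = m (m a b) (m c d)" for a b c d
    by (metis m_assoc m_comm)
  show ?case
    unfolding rec Sw_m[OF b] Suc.IH Sw_lin[OF bilin_lin(1)[OF bilin_m]]
    unfolding Sw_lin[OF bilin_lin(2)[OF bilin_m]] by (intro Sw_cong swap)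
qed

text \<open>The binomial theorem for the sum of the convolution unit and \<open>aug_proj\<close>;
  the induction step is Pascal's rule.\<close>

lemma adams_expand_atMost: "adams k x = (\<Sum>j\<le>k. scale (of_nat (k choose j)) (proj_power j x))"
proof (induction k arbitrary: x)
  case 0
  show ?case by (simp add: adams_def proj_power_def vs_simps)
next
  case (Suc k)
  have "m a y = proj_prod a y + scale (\<epsilon> a) y" for a y
    by (simp add: proj_prod_def aug_proj_def bilin_simps[OF bilin_m])
  then have "adams (Suc k) x =
      Sw (\<lambda>a b. proj_prod a (adams k b)) x + Sw (\<lambda>a b. scale (\<epsilon> a) (adams k b)) x"
    by (simp add: adams_def Sw_plus)
  also have "Sw (\<lambda>a b. scale (\<epsilon> a) (adams k b)) x = adams k x"
    by (rule Sw_counit_left[OF lin_adams])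
  also have "Sw (\<lambda>a b. proj_prod a (adams k b)) x =
      (\<Sum>j\<le>k. scale (of_nat (k choose j)) (proj_power (Suc j) x))"
    by (simp add: Suc.IH bilin_sum[OF bilin_proj_prod] bilin_simps[OF bilin_proj_prod] Sw_sum
      proj_power_Suc Sw_scale[OF vs])
  also have "adams k x = proj_power 0 x +
      (\<Sum>j\<le>k. scale (of_nat (k choose Suc j)) (proj_power (Suc j) x))"
    using sum.atMost_Suc_shift[of "\<lambda>j. scale (of_nat (k choose j)) (proj_power j x)" k]
    by (simp add: Suc.IH vs_simps binomial_eq_0)
  also have "(\<Sum>j\<le>k. scale (of_nat (k choose j)) (proj_power (Suc j) x)) + \<dots> =
      (\<Sum>j\<le>Suc k. scale (of_nat (Suc k choose j)) (proj_power j x))"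
    by (subst sum.atMost_Suc_shift) (simp add: vs_simps sum.distrib algebra_simps)
  finally show ?case .
qed

text \<open>A number of terms independent of k is what makes the right-hand side polynomial in
  k.\<close>

lemma adams_expand:
  assumes "fil N x"
  shows "adams k x = (\<Sum>j<N. scale (of_nat (k choose j)) (proj_power j x))"
proof -
  have "proj_power j x = 0" if "N \<le> j" for j
    using proj_power_eq_0 fil_mono[OF assms that] by blast
  then have "(\<Sum>j\<le>k. scale (of_nat (k choose j)) (proj_power j x)) =
      (\<Sum>j\<in>{..k} \<inter> {..<N}. scale (of_nat (k choose j)) (proj_power j x))"
    by (intro sum.mono_neutral_right ballI) (auto simp: vs_simps not_less)
  also have "\<dots> = (\<Sum>j<N. scale (of_nat (k choose j)) (proj_power j x))"
    by (intro sum.mono_neutral_left ballI) (auto simp: vs_simps binomial_eq_0 not_le)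
  finally show ?thesis by (simp add: adams_expand_atMost)
qed

text \<open>The Adams operations are multiplicative and polynomial in \<open>k\<close>; on the augmentation ideal they
  have no constant term, so the linear term of their value at a product vanishes.\<close>

lemma euler_m_eq_0:
  assumes x: "\<epsilon> x = 0" and y: "\<epsilon> y = 0"
  shows "euler (m x y) = 0"
proof (rule functional_separation[OF vs])
  fix \<gamma> :: "'a \<Rightarrow> 'k" assume \<gamma>: "lin scale (*) \<gamma>"
  define N where "N = Max {deg x, deg y, deg (m x y)}"
  have N: "fil N x" "fil N y" "fil N (m x y)"
    unfolding N_def by (auto intro!: fil_mono[OF fil_deg])
  \<comment> \<open>Two polynomials with value \<gamma>(\<open>adams k (m x y)\<close>) at k, one
    computed directly, the other by multiplicativity. Applying \<gamma> makes their coefficients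
    scalars.\<close>
  define P where "P = (\<Sum>j<N. smult (\<gamma> (proj_power j (m x y))) (binomial_poly j))"
  define Q where "Q = (\<Sum>i<N. \<Sum>j<N.
    smult (\<gamma> (m (proj_power i x) (proj_power j y))) (binomial_poly i * binomial_poly j))"
  have "poly P (of_nat k) = poly Q (of_nat k)" for k
  proof -
    have "poly P (of_nat k) = \<gamma> (adams k (m x y))"
      unfolding P_def adams_expand[OF N(3)]
      by (simp add: poly_sum poly_binomial_poly lin_sum[OF \<gamma>] lin_scale[OF \<gamma>] mult.commute)
    also have "\<dots> = poly Q (of_nat k)"
      unfolding adams_m Q_def adams_expand[OF N(1)] adams_expand[OF N(2)]
      by (simp add: poly_sum poly_binomial_poly bilin_sum[OF bilin_m] bilin_simps[OF bilin_m]
        lin_sum[OF \<gamma>] lin_scale[OF \<gamma>] vs_scale_sum[OF vs] sum_distrib_left algebra_simps)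
        (subst sum.swap, simp add: mult.left_commute)
    finally show ?thesis .
  qed
  then have PQ: "P = Q" by (rule poly_eq_if_eq_on_nat)
  have "\<gamma> (m (proj_power i x) (proj_power j y)) * coeff (binomial_poly i * binomial_poly j) 1 = 0" for i j
  proof (cases "i = 0 \<or> j = 0")
    case True
    then show ?thesis
      using x y by (auto simp: proj_power_0 vs_simps bilin_simps[OF bilin_m] lin_0[OF \<gamma>])
  next
    case False
    then show ?thesis by (simp add: coeff_mult coeff_0_binomial_poly)
  qed
  then have "coeff Q 1 = 0" by (simp only: Q_def coeff_sum coeff_smult sum.neutral_const)
  moreover have "coeff P 1 = \<gamma> (euler (m x y))"
    unfolding P_def euler_eq[OF N(3)]
    by (simp add: coeff_sum lin_sum[OF \<gamma>] lin_scale[OF \<gamma>] mult.commute)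
  ultimately show "\<gamma> (euler (m x y)) = 0" using PQ by simp
qed

lemma proj_power_Suc_e: "proj_power (Suc n) e = 0"
  unfolding proj_power_Suc Sw_e[OF bilin_proj_power] by (rule proj_prod_e)

abbreviation "Pr \<equiv> Prim (type_bialg scale m e \<Delta> \<epsilon>)"

lemma counit_Prim: "x \<in> Pr \<Longrightarrow> \<epsilon> x = 0"
proof -
  assume x: "x \<in> Pr"
  have b: "bilin scale scale scale (\<lambda>a b. scale (\<epsilon> a) b)"
    by (intro bilinI lin_scale_var lin_scale_const lin_ident vs lin_counit)
  \<comment> \<open>The counit law for \<Delta>(x) = x \<otimes> e + e \<otimes> x reads
    \<epsilon>(x) e + x = x.\<close>
  have "scale (\<epsilon> x) e = 0"
    using Sw_counit_left[OF lin_ident[OF vs], of x] Sw_Prim[OF b x] by (simp add: vs_simps)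
  then have "\<epsilon> (scale (\<epsilon> x) e) = 0" by (simp add: lin_0[OF lin_counit])
  then show ?thesis by (simp add: lin_scale[OF lin_counit])
qed

text \<open>One factor of each summand of \<Delta>(x) is \<open>e\<close>, on which
  \<open>aug_proj\<close> vanishes, so all powers beyond the first kill x.\<close>

lemma euler_Prim:
  assumes x: "x \<in> Pr"
  shows "euler x = x"
proof -
  have J: "aug_proj x = x" using counit_Prim[OF x] by (simp add: aug_proj_def vs_simps)
  have Suc: "proj_power (Suc n) x = m x (proj_power n e)" for n
    unfolding proj_power_Suc Sw_Prim[OF bilin_proj_power x] proj_prod_e by (simp add: proj_prod_def J)
  have "proj_power (Suc (Suc n)) x = 0" for n
    unfolding Suc proj_power_Suc_e by (simp add: bilin_simps[OF bilin_m])
  moreover have "proj_power (Suc 0) x = x"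
    unfolding Suc by (simp add: proj_power_0 vs_simps)
  \<comment> \<open>A bound of at least 2, so that the terms n = 0 and n = 1 both occur in the
    sum.\<close>
  moreover have "fil (Suc (Suc (deg x))) x" by (rule fil_mono[OF fil_deg]) simp
  ultimately show ?thesis
    using counit_Prim[OF x] unfolding euler_eq[OF \<open>fil (Suc (Suc (deg x))) x\<close>]
    by (simp add: sum.lessThan_Suc_shift binomial_poly_1 proj_power_0 vs_simps del: sum.lessThan_Suc)
qed

lemma subspace_Prim: "module.subspace scale Pr"
proof -
  interpret vector_space scale by (rule vs)
  note l = lin_tens_UNIV_1[OF vs] and r = lin_tens_UNIV_2[OF vs]
  show ?thesis
    by (rule subspaceI)
      (auto simp: Prim_def lin_0[OF lin_cop] lin_0[OF l] lin_0[OF r] lin_add[OF lin_cop] lin_add[OF l]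
        lin_add[OF r] lin_scale[OF lin_cop] lin_scale[OF l] lin_scale[OF r]
        vs_scale_simps[OF vector_space_fscale])
qed

text \<open>In a bialgebra that is not cocommutative the values of \<open>euler\<close> need not be
  primitive. Composing with a linear projection \<open>P\<close> repairs this, still kills products
  of elements of the augmentation ideal and still fixes the primitives. The last clause makes \<pi>
  a derivation over the counit.\<close>

lemma ex_primitive_projection:
  "\<exists>\<pi>. lin scale scale \<pi> \<and> range \<pi> \<subseteq> Pr \<and> (\<forall>x\<in>Pr. \<pi> x = x) \<and>
    (\<forall>x y. \<pi> (m x y) = scale (\<epsilon> x) (\<pi> y) + scale (\<epsilon> y) (\<pi> x))"
proof -
  interpret vector_space scale by (rule vs)
  interpret vector_space_pair scale scale by unfold_locales
  obtain P where P: "range P \<subseteq> Pr" "lin scale scale P" "\<forall>v\<in>Pr. P v = v"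
    using linear_exists_left_inverse_on[OF linear_id subspace_Prim] by auto
  define \<pi> where "\<pi> x = P (euler x)" for x
  have lin: "lin scale scale \<pi>" unfolding \<pi>_def[abs_def] by (rule lin_comp[OF lin_euler P(2)])
  have "fil 1 e" using fil_e[of 0] by simp
  then have "euler e = 0" using euler_eq[of 1 e] by (simp add: binomial_poly_0 vs_simps)
  then have e0: "\<pi> e = 0" by (simp add: \<pi>_def lin_0[OF P(2)])
  have "\<pi> (m x y) = scale (\<epsilon> x) (\<pi> y) + scale (\<epsilon> y) (\<pi> x)" for x y
  proof -
    have "m x y = m (aug_proj x) (aug_proj y) + scale (\<epsilon> x) y + scale (\<epsilon> y) x
        - scale (\<epsilon> x) (scale (\<epsilon> y) e)"
      by (simp add: aug_proj_def bilin_simps[OF bilin_m] vs_simps mult.commute algebra_simps)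
    moreover have "\<pi> (m (aug_proj x) (aug_proj y)) = 0"
      by (simp add: \<pi>_def euler_m_eq_0 lin_0[OF P(2)])
    ultimately show ?thesis by (simp add: lin_add[OF lin] lin_diff[OF lin] lin_scale[OF lin] e0 vs_simps)
  qed
  then show ?thesis
    using lin P(1,3) euler_Prim by (intro exI[of _ \<pi>]) (auto simp: \<pi>_def)
qed

end

section \<open>The shuffle algebra of a subspace\<close>

lemma lin_ext_lin_param:
  assumes s: "vector_space s" "vector_space s'" and "\<And>w. lin s s' (\<lambda>x. f x w)"
  shows "lin s s' (\<lambda>x. lin_ext s' (f x) p)"
  unfolding lin_ext_def using assms by (intro lin_sum_fun lin_scale_const) auto

lemma lin_sum_list: "lin s s' f \<Longrightarrow> f (\<Sum>x\<leftarrow>xs. g x) = (\<Sum>x\<leftarrow>xs. f (g x))"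
  by (induction xs) (auto simp: lin_0 lin_add)

text \<open>The two lists agree only up to order, whence the formulation with sums.\<close>

lemma sum_list_shuffle_list_commute:
  "(\<Sum>w\<leftarrow>shuffle_list u v. f w) = ((\<Sum>w\<leftarrow>shuffle_list v u. f w) :: 'b::comm_monoid_add)"
proof (induction u v arbitrary: f rule: shuffle_list.induct)
  case (1 v)
  then show ?case by (cases v) auto
next
  case (2 v va)
  then show ?case by simp
next
  case (3 a u b v)
  then show ?case by (simp add: o_def add.commute)
qed

lemma set_shuffle_list: "w \<in> set (shuffle_list u v) \<Longrightarrow> set w = set u \<union> set v"
  by (induction u v arbitrary: w rule: shuffle_list.induct) (auto simp: image_iff)

locale subspace_tensors =
  fixes s :: "'k::field \<Rightarrow> 'v::ab_group_add \<Rightarrow> 'v" and V :: "'v set"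
  assumes vs: "vector_space s" and subspace: "module.subspace s V"
begin

abbreviation "t w \<equiv> tens s V w"
abbreviation "TS \<equiv> tensor_space s V"
abbreviation "tt p q \<equiv> tens fscale TS [p, q]"

lemma V_closed: "0 \<in> V" "x \<in> V \<Longrightarrow> y \<in> V \<Longrightarrow> x + y \<in> V" "x \<in> V \<Longrightarrow> s c x \<in> V"
proof -
  interpret vector_space s by (rule vs)
  show "0 \<in> V" "x \<in> V \<Longrightarrow> y \<in> V \<Longrightarrow> x + y \<in> V" "x \<in> V \<Longrightarrow> s c x \<in> V"
    using subspace by (auto simp: subspace_def)
qed

definition multilin :: "('k \<Rightarrow> 'w \<Rightarrow> 'w) \<Rightarrow> ('v list \<Rightarrow> 'w::ab_group_add) \<Rightarrow> bool"
  where "multilin s' f \<longleftrightarrow> (\<forall>u\<in>lists V. \<forall>w\<in>lists V. \<forall>c. \<forall>x\<in>V. \<forall>y\<in>V.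
    f (u @ (s c x + y) # w) = s' c (f (u @ x # w)) + f (u @ y # w))"

lemma lin_ext_t:
  assumes s': "vector_space s'" and f: "multilin s' f"
  shows "lin_ext s' f (t w) = f w"
proof -
  have add: "f (u @ (x + y) # w) = f (u @ x # w) + f (u @ y # w)"
    if "u \<in> lists V" "w \<in> lists V" "x \<in> V" "y \<in> V" for u w x y
    using f[unfolded multilin_def, rule_format, OF that, of 1]
    by (simp add: vs_scale_simps[OF vs] vs_scale_simps[OF s'])
  \<comment> \<open>A zero letter gives 0 by additivity; with y = 0 the equation in
    \<open>multilin\<close> then becomes homogeneity.\<close>
  have "f (u @ 0 # w) = 0" if "u \<in> lists V" "w \<in> lists V" for u w
    using add[OF that V_closed(1) V_closed(1)] by simp
  then have "f (u @ s c x # w) = s' c (f (u @ x # w))"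
    if "u \<in> lists V" "w \<in> lists V" "x \<in> V" for u w c x
    using f[unfolded multilin_def, rule_format, OF that V_closed(1), of c] that by simp
  with add show ?thesis by (intro lin_ext_tens s') auto
qed

lemma t_lin:
  assumes "u \<in> lists V" "w \<in> lists V" "x \<in> V" "y \<in> V"
  shows "t (u @ (s c x + y) # w) = fscale c (t (u @ x # w)) + t (u @ y # w)"
  using assms by (simp add: tens_add tens_scale V_closed)

lemma TS_t: "w \<in> lists V \<Longrightarrow> t w \<in> TS"
  unfolding tensor_space_def tens_def by (rule imageI) (auto simp: fbasis_def)

lemma TS_expand:
  assumes "p \<in> TS"
  obtains W c where "finite W" "W \<subseteq> lists V" "p = (\<Sum>w\<in>W. fscale (c w) (t w))"
proof -
  obtain q where "p = quot_rep (tensor_rels s V) q" "Poly_Mapping.keys q \<subseteq> lists V"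
    using assms unfolding tensor_space_def by auto
  then show ?thesis using that[of "Poly_Mapping.keys q" "Poly_Mapping.lookup q"]
    by (simp add: quot_tensor_expand)
qed

lemma TS_zero: "0 \<in> TS"
  unfolding tensor_space_def using lin_0[OF lin_quot_tensor] by (intro image_eqI[of _ _ 0]) auto

lemma TS_add:
  assumes "p \<in> TS" "q \<in> TS" shows "p + q \<in> TS"
proof -
  obtain p' q' where "p = quot_rep (tensor_rels s V) p'" "Poly_Mapping.keys p' \<subseteq> lists V"
    "q = quot_rep (tensor_rels s V) q'" "Poly_Mapping.keys q' \<subseteq> lists V"
    using assms unfolding tensor_space_def by blast
  then show ?thesis
    unfolding tensor_space_def using Poly_Mapping.keys_add[of p' q']
    by (intro image_eqI[of _ _ "p' + q'"]) (auto simp: lin_add[OF lin_quot_tensor])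
qed

lemma TS_scale:
  assumes "p \<in> TS" shows "fscale c p \<in> TS"
proof -
  obtain p' where p': "p = quot_rep (tensor_rels s V) p'" "Poly_Mapping.keys p' \<subseteq> lists V"
    using assms unfolding tensor_space_def by blast
  have "Poly_Mapping.keys (fscale c p') \<subseteq> Poly_Mapping.keys p'"
    by (auto simp: in_keys_iff lookup_fscale)
  then show ?thesis
    unfolding tensor_space_def using p'
    by (intro image_eqI[of _ _ "fscale c p'"]) (auto simp: lin_scale[OF lin_quot_tensor])
qed

lemma TS_sum: "(\<And>i. i \<in> I \<Longrightarrow> f i \<in> TS) \<Longrightarrow> sum f I \<in> TS"
  by (induction I rule: infinite_finite_induct) (auto intro: TS_zero TS_add)

lemma lin_eq_on_TS:
  assumes "lin fscale s' f" "lin fscale s' g" and "\<And>w. w \<in> lists V \<Longrightarrow> f (t w) = g (t w)" and "p \<in> TS"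
  shows "f p = g p"
proof -
  obtain W c where W: "finite W" "W \<subseteq> lists V" "p = (\<Sum>w\<in>W. fscale (c w) (t w))"
    using TS_expand[OF assms(4)] by blast
  show ?thesis
    unfolding W(3) lin_sum[OF assms(1)] lin_sum[OF assms(2)] lin_scale[OF assms(1)] lin_scale[OF assms(2)]
    using W(2) by (intro sum.cong refl arg_cong[where f="s' _"] assms(3)) blast
qed

lemma TS_induct [consumes 1, case_names zero step]:
  assumes "p \<in> TS" and "P 0"
    and "\<And>c w p. w \<in> lists V \<Longrightarrow> p \<in> TS \<Longrightarrow> P p \<Longrightarrow> P (fscale c (t w) + p)"
  shows "P p"
proof -
  obtain W c where W: "finite W" "W \<subseteq> lists V" "p = (\<Sum>w\<in>W. fscale (c w) (t w))"
    using TS_expand[OF assms(1)] by blast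
  have "(\<Sum>w\<in>W. fscale (c w) (t w)) \<in> TS \<and> P (\<Sum>w\<in>W. fscale (c w) (t w))"
    using W(1,2)
  proof (induction W)
    case empty
    then show ?case by (simp add: TS_zero assms(2))
  next
    case (insert w W)
    then have "w \<in> lists V" "(\<Sum>w\<in>W. fscale (c w) (t w)) \<in> TS" "P (\<Sum>w\<in>W. fscale (c w) (t w))"
      by blast+
    then show ?case using insert.hyps assms(3) by (simp add: TS_add TS_scale TS_t)
  qed
  then show ?thesis unfolding W(3) ..
qed

lemma lin_in_TS:
  assumes f: "lin fscale fscale f" and "\<And>w. w \<in> lists V \<Longrightarrow> f (t w) \<in> TS" and "p \<in> TS"
  shows "f p \<in> TS"
proof -
  obtain W c where W: "finite W" "W \<subseteq> lists V" "p = (\<Sum>w\<in>W. fscale (c w) (t w))"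
    using TS_expand[OF assms(3)] by blast
  show ?thesis
    unfolding W(3) lin_sum[OF f] lin_scale[OF f] using W(2) by (intro TS_sum TS_scale assms(2)) blast
qed

text \<open>Words with letters outside \<open>V\<close> are sent to 0, so that \<open>prepend v p\<close> depends linearly on
  \<open>v \<in> V\<close> without restriction on \<open>p\<close>.\<close>

definition prepend :: "'v \<Rightarrow> ('v list \<Rightarrow>\<^sub>0 'k) \<Rightarrow> ('v list \<Rightarrow>\<^sub>0 'k)"
  where "prepend v = lin_ext fscale (\<lambda>w. if w \<in> lists V then t (v # w) else 0)"

lemma lin_prepend: "lin fscale fscale (prepend v)"
  unfolding prepend_def by (rule lin_lin_ext[OF vector_space_fscale])

lemma prepend_t:
  assumes "v \<in> V" "w \<in> lists V" shows "prepend v (t w) = t (v # w)"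
proof -
  have "multilin fscale (\<lambda>w. if w \<in> lists V then t (v # w) else 0)"
    unfolding multilin_def using assms(1) V_closed
    by (auto simp: t_lin[of "v # _", simplified] subset_iff simp flip: in_lists_conv_set)
  then show ?thesis unfolding prepend_def using assms(2)
    by (subst lin_ext_t[OF vector_space_fscale]) auto
qed

lemma lin_prepend_param:
  assumes f: "lin s' s f" and "range f \<subseteq> V"
  shows "lin s' fscale (\<lambda>x. prepend (f x) p)"
  unfolding prepend_def
proof (rule lin_ext_lin_param)
  have V: "f x \<in> V" for x using assms(2) by auto
  show s': "vector_space s'" using lin_vs(1)[OF f] .
  have "t ((f x + f y) # w) = t (f x # w) + t (f y # w)" "t (s c (f x) # w) = fscale c (t (f x # w))"
    if "w \<in> lists V" for x y c w
    using tens_add[of "[]" V w "f x" "f y" s] tens_scale[of "[]" V w "f x" s c] that V by auto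
  then show "lin s' fscale (\<lambda>x. if w \<in> lists V then t (f x # w) else 0)" for w
    unfolding lin_iff using s' vector_space_fscale by (auto simp: lin_add[OF f] lin_scale[OF f])
qed (rule vector_space_fscale)

lemma prepend_TS: "v \<in> V \<Longrightarrow> p \<in> TS \<Longrightarrow> prepend v p \<in> TS"
  by (erule lin_in_TS[OF lin_prepend, rotated]) (simp add: prepend_t TS_t)

definition shuffle_sum :: "'v list \<Rightarrow> 'v list \<Rightarrow> ('v list \<Rightarrow>\<^sub>0 'k)"
  where "shuffle_sum u v = (\<Sum>w\<leftarrow>shuffle_list u v. t w)"

lemma shuffle_sum_Nil [simp]: "shuffle_sum [] v = t v" "shuffle_sum u [] = t u"
  by (cases u; simp add: shuffle_sum_def)+

lemma shuffle_sum_Cons: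
  assumes "a \<in> V" "b \<in> V" "u \<in> lists V" "v \<in> lists V"
  shows "shuffle_sum (a # u) (b # v) =
    prepend a (shuffle_sum u (b # v)) + prepend b (shuffle_sum (a # u) v)"
proof -
  have "prepend c (shuffle_sum u' v') = (\<Sum>w\<leftarrow>shuffle_list u' v'. t (c # w))"
    if "c \<in> V" "u' \<in> lists V" "v' \<in> lists V" for c u' v'
    unfolding shuffle_sum_def lin_sum_list[OF lin_prepend]
    by (intro arg_cong[where f=sum_list] map_cong refl prepend_t)
      (use that set_shuffle_list[of _ u' v'] in auto)
  then show ?thesis using assms by (simp add: shuffle_sum_def o_def)
qed

lemma shuffle_sum_commute: "shuffle_sum u v = shuffle_sum v u"
  unfolding shuffle_sum_def by (rule sum_list_shuffle_list_commute)

lemma shuffle_sum_TS: "u \<in> lists V \<Longrightarrow> v \<in> lists V \<Longrightarrow> shuffle_sum u v \<in> TS"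
proof (induction v arbitrary: u)
  case Nil
  then show ?case by (simp add: TS_t)
next
  case (Cons b v)
  from Cons.prems show ?case
  proof (induction u)
    case Nil
    then show ?case by (simp add: TS_t)
  next
    case (Cons a u)
    then show ?case using Cons.prems \<open>\<And>u. _ \<Longrightarrow> _ \<Longrightarrow> shuffle_sum u v \<in> TS\<close>[of "a # u"]
      by (simp add: shuffle_sum_Cons TS_add prepend_TS)
  qed
qed

text \<open>The recursion for shuffles removes a letter from either word, so an induction on
  \<open>v\<close> encloses one on \<open>u\<close>. Linearity in the letters of the second word
  follows by commutativity.\<close>

lemma shuffle_sum_lin:
  assumes w: "w \<in> lists V" and x: "x \<in> V" and y: "y \<in> V"
  shows "u \<in> lists V \<Longrightarrow> v \<in> lists V \<Longrightarrow> shuffle_sum (u @ (s c x + y) # w) v =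
    fscale c (shuffle_sum (u @ x # w) v) + shuffle_sum (u @ y # w) v"
proof (induction v arbitrary: u)
  case Nil
  then show ?case using w x y by (simp add: t_lin)
next
  case (Cons b v)
  have b: "b \<in> V" "v \<in> lists V" using Cons.prems by auto
  have xy: "s c x + y \<in> V" using x y V_closed by auto
  note outer = Cons.IH[OF _ b(2)]
  have p: "prepend (s c x + y) p = fscale c (prepend x p) + prepend y p" for p
  proof -
    have 1: "t ((s c x + y) # w) = fscale c (t (x # w)) + t (y # w)" if "w \<in> lists V" for w
      using t_lin[of "[]" w x y c] that x y by simp
    have "prepend (s c x + y) p = lin_ext fscale
      (\<lambda>w. fscale c (if w \<in> lists V then t (x # w) else 0) + (if w \<in> lists V then t (y # w) else 0)) p"
      unfolding prepend_def by (intro arg_cong2[where f="lin_ext fscale"] ext) (auto simp: 1)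
    also have "\<dots> = fscale c (prepend x p) + prepend y p"
      unfolding prepend_def lin_ext_def
      by (simp add: vs_scale_simps[OF vector_space_fscale] sum.distrib
        vs_scale_sum[OF vector_space_fscale] mult.commute)
    finally show ?thesis .
  qed
  note p' = p[unfolded add.commute[of "s c x" y]]
  note simps = shuffle_sum_Cons lin_add[OF lin_prepend] lin_scale[OF lin_prepend]
    vs_scale_simps[OF vector_space_fscale] algebra_simps
  from Cons.prems(1) show ?case
  proof (induction u)
    case Nil
    then show ?case using outer[of "[]"] w x y xy b by (simp add: simps p')
  next
    case (Cons a u)
    then show ?case using outer[of "a # u"] w x y xy b by (simp add: simps)
  qed
qed

abbreviation "SH \<equiv> shuffle_bialg s V"

lemma mul_SH: "mul SH p q = lin_ext fscale (\<lambda>u. lin_ext fscale (shuffle_sum u) q) p"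
  by (simp add: shuffle_bialg_def shuffle_sum_def[abs_def])

lemma lin_mul_SH_left: "lin fscale fscale (\<lambda>p. mul SH p q)"
  unfolding mul_SH by (rule lin_lin_ext[OF vector_space_fscale])

lemma lin_mul_SH_right: "lin fscale fscale (mul SH p)"
  unfolding mul_SH[abs_def] by (intro lin_ext_lin_param lin_lin_ext vector_space_fscale)

lemma mul_SH_t: "u \<in> lists V \<Longrightarrow> v \<in> lists V \<Longrightarrow> mul SH (t u) (t v) = shuffle_sum u v"
proof -
  assume uv: "u \<in> lists V" "v \<in> lists V"
  have 1: "lin_ext fscale (shuffle_sum u) (t v) = shuffle_sum u v" if "u \<in> lists V" for u
    using that shuffle_sum_lin[of _ _ _ _ u] unfolding shuffle_sum_commute[of _ u]
    by (intro lin_ext_t vector_space_fscale) (auto simp: multilin_def shuffle_sum_commute[of u])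
  have "mul SH (t u) (t v) = lin_ext fscale (\<lambda>u. lin_ext fscale (shuffle_sum u) (t v)) (t u)"
    by (rule mul_SH)
  also have "\<dots> = lin_ext fscale (shuffle_sum u) (t v)"
    using V_closed uv by (intro lin_ext_t vector_space_fscale) (auto simp: multilin_def 1 shuffle_sum_lin)
  finally show ?thesis using 1 uv by simp
qed

lemma mul_SH_one:
  assumes "p \<in> TS" shows "mul SH (t []) p = p" "mul SH p (t []) = p"
  by (rule lin_eq_on_TS[OF lin_mul_SH_right lin_ident[OF vector_space_fscale] _ assms];
      simp add: mul_SH_t)
     (rule lin_eq_on_TS[OF lin_mul_SH_left lin_ident[OF vector_space_fscale] _ assms];
      simp add: mul_SH_t)

text \<open>The shuffle recursion for arbitrary tensors, obtained from words by linearity first in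
  \<open>q\<close> and then in \<open>p\<close>.\<close>

lemma mul_SH_prepend:
  assumes a: "a \<in> V" "b \<in> V" and p: "p \<in> TS" and q: "q \<in> TS"
  shows "mul SH (prepend a p) (prepend b q) =
    prepend a (mul SH p (prepend b q)) + prepend b (mul SH (prepend a p) q)"
proof -
  note l = lin_comp[OF lin_prepend lin_mul_SH_left] lin_comp[OF lin_mul_SH_left lin_prepend]
    lin_comp[OF lin_prepend lin_mul_SH_right] lin_comp[OF lin_mul_SH_right lin_prepend]
    lin_comp[OF lin_comp[OF lin_prepend lin_mul_SH_left] lin_prepend]
    lin_comp[OF lin_comp[OF lin_prepend lin_mul_SH_right] lin_prepend]
  have "mul SH (prepend a (t u)) (prepend b q) =
      prepend a (mul SH (t u) (prepend b q)) + prepend b (mul SH (prepend a (t u)) q)"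
    if "u \<in> lists V" for u
  proof (rule lin_eq_on_TS[OF _ _ _ q, where s'=fscale])
    show "lin fscale fscale (\<lambda>q. mul SH (prepend a (t u)) (prepend b q))" by (rule l)
    show "lin fscale fscale (\<lambda>q. prepend a (mul SH (t u) (prepend b q)) + prepend b (mul SH (prepend a (t u)) q))"
      by (intro lin_plus l)
  qed (use that a in \<open>simp add: prepend_t mul_SH_t shuffle_sum_Cons\<close>)
  then show ?thesis
    by (intro lin_eq_on_TS[OF _ _ _ p, where s'=fscale and f="\<lambda>p. mul SH (prepend a p) (prepend b q)"]
      lin_plus l)
qed

lemma tt_simps:
  "p \<in> TS \<Longrightarrow> q \<in> TS \<Longrightarrow> r \<in> TS \<Longrightarrow> tt (p + q) r = tt p r + tt q r"
  "p \<in> TS \<Longrightarrow> q \<in> TS \<Longrightarrow> r \<in> TS \<Longrightarrow> tt p (q + r) = tt p q + tt p r"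
  "p \<in> TS \<Longrightarrow> q \<in> TS \<Longrightarrow> tt (fscale c p) q = fscale c (tt p q)"
  "p \<in> TS \<Longrightarrow> q \<in> TS \<Longrightarrow> tt p (fscale c q) = fscale c (tt p q)"
  using tens_add[of "[]" TS "[r]" p q fscale] tens_add[of "[p]" TS "[]" q r fscale]
    tens_scale[of "[]" TS "[q]" p fscale c] tens_scale[of "[p]" TS "[]" q fscale c] by auto

lemma lin_tt:
  assumes "lin s' fscale f" "range f \<subseteq> TS" "p \<in> TS"
  shows "lin s' fscale (\<lambda>x. tt (f x) p)" "lin s' fscale (\<lambda>x. tt p (f x))"
proof -
  have "f x \<in> TS" for x using assms(2) by auto
  then show "lin s' fscale (\<lambda>x. tt (f x) p)" "lin s' fscale (\<lambda>x. tt p (f x))"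
    unfolding lin_iff using lin_vs(1)[OF assms(1)] vector_space_fscale assms(3)
    by (auto simp: lin_add[OF assms(1)] lin_scale[OF assms(1)] tt_simps)
qed

text \<open>The operator \<open>prepend v \<otimes> id\<close>. Pure tensors are multilinear only
  over \<open>TS\<close>; sending other pairs to 0 keeps the operator linear in \<open>v\<close>
  \<in> \<open>V\<close> for every argument.\<close>

definition prepend_left :: "'v \<Rightarrow> (('v list \<Rightarrow>\<^sub>0 'k) list \<Rightarrow>\<^sub>0 'k) \<Rightarrow> (('v list \<Rightarrow>\<^sub>0 'k) list \<Rightarrow>\<^sub>0 'k)"
  where "prepend_left v =
    sweedler fscale (\<lambda>p q. if p \<in> TS \<and> q \<in> TS then tt (prepend v p) q else 0)"

lemma lin_prepend_left: "lin fscale fscale (prepend_left v)"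
  unfolding prepend_left_def by (rule lin_sweedler[OF vector_space_fscale])

lemma prepend_left_tt:
  assumes "v \<in> V" "p \<in> TS" "q \<in> TS"
  shows "prepend_left v (tt p q) = tt (prepend v p) q"
  unfolding prepend_left_def
  by (subst sweedler_tens[OF vector_space_fscale])
    (use assms in \<open>auto simp: TS_add TS_scale prepend_TS lin_add[OF lin_prepend] lin_scale[OF lin_prepend]
      tt_simps\<close>)

lemma lin_prepend_left_param:
  assumes f: "lin s' s f" and V: "range f \<subseteq> V"
  shows "lin s' fscale (\<lambda>x. prepend_left (f x) P)"
  unfolding prepend_left_def sweedler_def
proof (rule lin_ext_lin_param)
  show s': "vector_space s'" using lin_vs(1)[OF f] .
  have *: "lin s' fscale (\<lambda>x. if p \<in> TS \<and> q \<in> TS then tt (prepend (f x) p) q else 0)" for p q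
  proof (cases "p \<in> TS \<and> q \<in> TS")
    case True
    then show ?thesis
      using V lin_tt(1)[OF lin_prepend_param[OF f V, of p], of q] by (auto simp: prepend_TS image_subset_iff)
  qed (auto intro: lin_zero[OF s' vector_space_fscale])
  show "lin s' fscale (\<lambda>x. case w of [p, q] \<Rightarrow> if p \<in> TS \<and> q \<in> TS then tt (prepend (f x) p) q else 0
      | _ \<Rightarrow> 0)" for w
  proof (cases "\<exists>p q. w = [p, q]")
    case True
    then show ?thesis using * by auto
  next
    case False
    then have "(\<lambda>x. case w of [p, q] \<Rightarrow> if p \<in> TS \<and> q \<in> TS then tt (prepend (f x) p) q else 0
      | _ \<Rightarrow> 0) = (\<lambda>x. 0)" by (auto split: list.splits)
    then show ?thesis using lin_zero[OF s' vector_space_fscale] by (simp only:)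
  qed
qed (rule vector_space_fscale)

definition deconc :: "'v list \<Rightarrow> (('v list \<Rightarrow>\<^sub>0 'k) list \<Rightarrow>\<^sub>0 'k)"
  where "deconc w = (\<Sum>i\<le>length w. tt (t (take i w)) (t (drop i w)))"

lemma deconc_Cons:
  assumes "v \<in> V" "w \<in> lists V"
  shows "deconc (v # w) = tt (t []) (t (v # w)) + (\<Sum>i\<le>length w. tt (prepend v (t (take i w))) (t (drop i w)))"
proof -
  have "take i w \<in> lists V" for i using assms(2) set_take_subset by fastforce
  then have p: "prepend v (t (take i w)) = t (v # take i w)" for i
    using prepend_t[OF assms(1)] by blast
  have "deconc (v # w) = (\<Sum>i\<le>Suc (length w). tt (t (take i (v # w))) (t (drop i (v # w))))"
    unfolding deconc_def by simp
  also have "\<dots> = tt (t []) (t (v # w)) + (\<Sum>i\<le>length w. tt (t (v # take i w)) (t (drop i w)))"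
    by (subst sum.atMost_Suc_shift) (simp only: take_0 drop_0 take_Suc_Cons drop_Suc_Cons)
  finally show ?thesis unfolding p .
qed

lemma lists_take_drop: "w \<in> lists V \<Longrightarrow> take i w \<in> lists V \<and> drop i w \<in> lists V"
  using set_take_subset set_drop_subset by fastforce

lemma deconc_Cons':
  assumes "v \<in> V" "w \<in> lists V"
  shows "deconc (v # w) = tt (t []) (t (v # w)) + prepend_left v (deconc w)"
  unfolding deconc_Cons[OF assms]
  unfolding deconc_def lin_sum[OF lin_prepend_left]
  using assms lists_take_drop[OF assms(2)] by (simp add: prepend_left_tt TS_t)

lemma multilin_deconc: "multilin fscale deconc"
proof -
  have "deconc (u @ (s c x + y) # w) = fscale c (deconc (u @ x # w)) + deconc (u @ y # w)"
    if u: "u \<in> lists V" and w: "w \<in> lists V" and x: "x \<in> V" and y: "y \<in> V" for u w c x y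
    using u
  proof (induction u)
    case Nil
    have xy: "s c x + y \<in> V" using x y V_closed by auto
    have TS: "t (take i w) \<in> TS" "t (drop i w) \<in> TS" "t (x # take i w) \<in> TS" "t (y # take i w) \<in> TS"
      "t (x # w) \<in> TS" "t (y # w) \<in> TS" "t [] \<in> TS" for i
      using lists_take_drop[OF w, of i] x y w by (auto intro!: TS_t)
    have "t ((s c x + y) # w') = fscale c (t (x # w')) + t (y # w')" if "w' \<in> lists V" for w'
      using t_lin[of "[]" w' x y c] that x y by simp
    then show ?case
      using lists_take_drop[OF w] x y xy w TS
      by (simp add: deconc_Cons prepend_t tt_simps TS_scale sum.distrib algebra_simps
        vs_scale_simps[OF vector_space_fscale] vs_scale_sum[OF vector_space_fscale])
  next
    case (Cons a u)
    have uw: "u @ (s c x + y) # w \<in> lists V" "u @ x # w \<in> lists V" "u @ y # w \<in> lists V"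
      "s c x + y \<in> V"
      using Cons.hyps w x y V_closed by auto
    have TS: "t (a # u @ x # w) \<in> TS" "t (a # u @ y # w) \<in> TS" "t [] \<in> TS"
      using Cons.hyps uw by (auto intro!: TS_t)
    have "t (a # u @ (s c x + y) # w) = fscale c (t (a # u @ x # w)) + t (a # u @ y # w)"
      using t_lin[of "a # u" w x y c] Cons.hyps w x y by simp
    then show ?case
      using Cons uw TS
      by (simp add: deconc_Cons' tt_simps TS_scale lin_add[OF lin_prepend_left]
        lin_scale[OF lin_prepend_left] algebra_simps vs_scale_simps[OF vector_space_fscale])
  qed
  then show ?thesis unfolding multilin_def by blast
qed

lemma cop_SH: "cop SH = lin_ext fscale deconc"
  by (simp add: shuffle_bialg_def deconc_def[abs_def])

lemma lin_cop_SH: "lin fscale fscale (cop SH)"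
  unfolding cop_SH by (rule lin_lin_ext[OF vector_space_fscale])

lemma cop_SH_t: "cop SH (t w) = deconc w"
  unfolding cop_SH by (rule lin_ext_t[OF vector_space_fscale multilin_deconc])

text \<open>Prepending a letter is a 1-cocycle for deconcatenation: the cut at 0 gives the first
  term, and every other cut passes through the remaining word. This yields the recursion for the
  coproduct of \<psi>(x).\<close>

lemma cop_SH_prepend:
  assumes "v \<in> V" "p \<in> TS"
  shows "cop SH (prepend v p) = tt (t []) (prepend v p) + prepend_left v (cop SH p)"
  using assms(2)
proof (induction rule: TS_induct)
  case zero
  have "tt (t []) 0 = 0" using tt_simps(4)[of "t []" "t []" 0] by (simp add: TS_t)
  then show ?case by (simp add: lin_0[OF lin_prepend] lin_0[OF lin_cop_SH] lin_0[OF lin_prepend_left])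
next
  case (step c w p)
  then show ?case
    using assms(1)
    by (simp add: lin_add[OF lin_prepend] lin_add[OF lin_cop_SH] lin_add[OF lin_prepend_left]
      lin_scale[OF lin_prepend] lin_scale[OF lin_cop_SH] lin_scale[OF lin_prepend_left] prepend_t cop_SH_t
      deconc_Cons' tt_simps TS_t TS_scale prepend_TS vs_scale_simps[OF vector_space_fscale])
qed

text \<open>Every multilinearity relation involves only nonempty words, so the coefficient of the
  empty word is independent of the representative; thus the counit is well defined.\<close>

lemma lookup_Nil_t: "Poly_Mapping.lookup (t w) [] = (if w = [] then 1 else 0)"
proof -
  have "Poly_Mapping.lookup p [] = lin_ext (*) (\<lambda>w. if w = [] then 1 else 0) p" for p :: "'v list \<Rightarrow>\<^sub>0 'k"
    by (simp add: lin_ext_def if_distrib in_keys_iff cong: if_cong)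
  then show ?thesis
    using lin_ext_t[OF vector_space_mult, of "\<lambda>w. if w = [] then 1 else 0" w]
    by (simp add: multilin_def)
qed

lemma lin_lookup: "lin fscale (*) (\<lambda>p. Poly_Mapping.lookup p w)"
  unfolding lin_iff by (auto simp: lookup_add lookup_fscale vector_space_fscale vector_space_mult)

lemma lookup_Nil_prepend:
  assumes "v \<in> V" "p \<in> TS" shows "Poly_Mapping.lookup (prepend v p) [] = 0"
  by (rule lin_eq_on_TS[OF lin_comp[OF lin_prepend lin_lookup]
    lin_zero[OF vector_space_fscale vector_space_mult] _ assms(2)])
    (use assms in \<open>simp add: prepend_t lookup_Nil_t\<close>)

text \<open>The letter is recovered by the multilinear map that sends one-letter words to their
  letter and all other words to 0.\<close>

lemma t_letter_eq_0: "t [v] = 0 \<Longrightarrow> v = 0"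
proof -
  assume 0: "t [v] = 0"
  let ?f = "\<lambda>w. case w of [v] \<Rightarrow> v | _ \<Rightarrow> 0"
  have "multilin s ?f"
    unfolding multilin_def
    by (auto split: list.splits simp: append_eq_Cons_conv Cons_eq_append_conv vs_scale_simps[OF vs])
  from lin_ext_t[OF vs this, of "[v]"] 0 show ?thesis
    by (simp add: lin_0[OF lin_lin_ext[OF vs]])
qed

definition short :: "nat \<Rightarrow> ('v list \<Rightarrow>\<^sub>0 'k) set"
  where "short n = module.span fscale {t w | w. w \<in> lists V \<and> length w < n}"

lemma short_add: "p \<in> short n \<Longrightarrow> q \<in> short n \<Longrightarrow> p + q \<in> short n"
  and short_scale: "p \<in> short n \<Longrightarrow> fscale c p \<in> short n"
  and short_t: "w \<in> lists V \<Longrightarrow> length w < n \<Longrightarrow> t w \<in> short n"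
  and short_zero: "0 \<in> short n"
proof -
  interpret F: vector_space fscale by (rule vector_space_fscale)
  show "p \<in> short n \<Longrightarrow> q \<in> short n \<Longrightarrow> p + q \<in> short n" "p \<in> short n \<Longrightarrow> fscale c p \<in> short n"
    "w \<in> lists V \<Longrightarrow> length w < n \<Longrightarrow> t w \<in> short n" "0 \<in> short n"
    unfolding short_def by (auto intro: F.span_add F.span_scale F.span_base F.span_zero)
qed

lemma short_sum: "(\<And>i. i \<in> I \<Longrightarrow> f i \<in> short n) \<Longrightarrow> sum f I \<in> short n"
  by (induction I rule: infinite_finite_induct) (auto intro: short_zero short_add)

lemma short_mono: "k \<le> n \<Longrightarrow> short k \<subseteq> short n"
proof -
  interpret F: vector_space fscale by (rule vector_space_fscale)
  show "k \<le> n \<Longrightarrow> short k \<subseteq> short n" unfolding short_def by (rule F.span_mono) auto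
qed

lemma prepend_short:
  assumes v: "v \<in> V" and p: "p \<in> short n"
  shows "prepend v p \<in> short (Suc n)"
proof -
  interpret F: vector_space fscale by (rule vector_space_fscale)
  show ?thesis using p unfolding short_def
  proof (induction rule: F.span_induct_alt)
    case base
    show ?case by (simp add: lin_0[OF lin_prepend] F.span_zero)
  next
    case (step c x y)
    then obtain w where w: "x = t w" "w \<in> lists V" "length w < n" by auto
    then have "prepend v x \<in> short (Suc n)" using v by (auto simp: prepend_t intro!: short_t)
    then show ?case using step
      by (auto simp: lin_add[OF lin_prepend] lin_scale[OF lin_prepend] short_def
        intro!: F.span_add F.span_scale)
  qed
qed

end

section \<open>Transport of Hopf structures\<close>

lemma tensor_power_sum:
  fixes s :: "'k::field \<Rightarrow> 'v::ab_group_add \<Rightarrow> 'v"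
  assumes "\<And>i. i \<in> I \<Longrightarrow> w i \<in> lists V \<and> length (w i) = n"
  shows "(\<Sum>i\<in>I. tens s V (w i)) \<in> tensor_power s V n"
proof -
  have "(\<Sum>i\<in>I. tens s V (w i)) = quot_rep (tensor_rels s V) (\<Sum>i\<in>I. fbasis (w i))"
    unfolding tens_def by (rule lin_sum[OF lin_quot_tensor, symmetric])
  moreover have "Poly_Mapping.keys (\<Sum>i\<in>I. fbasis (w i) :: _ \<Rightarrow>\<^sub>0 'k) \<subseteq> w ` I"
    using Poly_Mapping.keys_sum[of "\<lambda>i. fbasis (w i) :: _ \<Rightarrow>\<^sub>0 'k" I] by (fastforce simp: fbasis_def)
  ultimately show ?thesis unfolding tensor_power_def using assms by fastforce
qed

context type_bialgebra
begin

text \<open>Serves to derive the Hopf axioms of the shuffle algebra from those of A. There is no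
  circularity: \<open>hopf_iso\<close> speaks of the operations of \<open>H'\<close>, not of their
  axioms.\<close>

lemma hopf_algebra_transport:
  fixes H' :: "('k, 'b::ab_group_add) bialg"
  assumes vs': "vector_space (scl H')" and iso: "hopf_iso (type_bialg scale m e \<Delta> \<epsilon>) H' \<phi>"
    and antipode: "is_antipode (type_bialg scale m e \<Delta> \<epsilon>) S"
  shows "hopf_algebra H'"
proof -
  let ?bt = "\<lambda>w. btens H' w"
  have bij: "bij_betw \<phi> UNIV (carr H')" using iso by (simp add: hopf_iso_def)
  then have inj: "inj \<phi>" and carr: "carr H' = range \<phi>"
    by (auto simp: bij_betw_def)
  have lin: "lin scale (scl H') \<phi>"
    unfolding lin_iff using vs vs' iso by (auto simp: hopf_iso_def)
  note add = lin_add[OF lin, symmetric] and scale = lin_scale[OF lin, symmetric]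
  have mul: "mul H' (\<phi> x) (\<phi> y) = \<phi> (m x y)" for x y
    using iso by (simp add: hopf_iso_def)
  have one: "one H' = \<phi> e" using iso by (simp add: hopf_iso_def)
  have cou: "cou H' (\<phi> x) = \<epsilon> x" for x using iso by (simp add: hopf_iso_def)
  have lists: "map \<phi> w \<in> lists (carr H')" for w by (auto simp: carr)
  have lin_bt: "lin scale fscale (\<lambda>x. ?bt (map \<phi> u @ \<phi> x # map \<phi> w))" for u w
    unfolding lin_iff using vs vector_space_fscale carr
      tens_add[OF lists[of u] lists[of w], of "\<phi> _" "\<phi> _" "scl H'"]
      tens_scale[OF lists[of u] lists[of w], of "\<phi> _" "scl H'"]
    by (auto simp: lin_add[OF lin] lin_scale[OF lin])
  have lin_bt2: "lin scale fscale (\<lambda>a. ?bt [\<phi> a, \<phi> b])" "lin scale fscale (\<lambda>b. ?bt [\<phi> a, \<phi> b])" for a b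
    using lin_bt[of "[]" "[b]"] lin_bt[of "[a]" "[]"] by auto
  have lin_bt3: "lin scale fscale (\<lambda>a. ?bt [\<phi> a, \<phi> b, \<phi> c])"
    "lin scale fscale (\<lambda>b. ?bt [\<phi> a, \<phi> b, \<phi> c])" "lin scale fscale (\<lambda>c. ?bt [\<phi> a, \<phi> b, \<phi> c])" for a b c
    using lin_bt[of "[]" "[b, c]"] lin_bt[of "[a]" "[c]"] lin_bt[of "[a, b]" "[]"] by auto
  have b2: "bilin scale scale fscale (\<lambda>a b. ?bt [\<phi> a, \<phi> b])" by (intro bilinI lin_bt2)
  have cop: "cop H' (\<phi> x) = Sw (\<lambda>a b. ?bt [\<phi> a, \<phi> b]) x" for x
    using iso by (simp add: hopf_iso_def sweedler_cop[OF b2])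
  have lin_cop': "lin scale fscale (\<lambda>x. cop H' (\<phi> x))" unfolding cop by (rule lin_Sw[OF b2])
  \<comment> \<open>Sweedler sums on the carrier of \<open>H'\<close> become sums over A;
    bilinearity is asked of \<open>g\<close> only after composition with \<phi>.\<close>
  have sw: "sweedler s g (cop H' (\<phi> x)) = Sw (\<lambda>a b. g (\<phi> a) (\<phi> b)) x"
    if g: "bilin scale scale s (\<lambda>a b. g (\<phi> a) (\<phi> b))"
    for s :: "'k \<Rightarrow> 'w::ab_group_add \<Rightarrow> 'w" and g x
  proof -
    have "sweedler s g (?bt [\<phi> a, \<phi> b]) = g (\<phi> a) (\<phi> b)" for a b
      by (rule sweedler_tens)
        (use bilin_vs[OF g] bilin_simps(1-4)[OF g] in \<open>auto simp: carr add scale\<close>)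
    then show ?thesis
      unfolding cop by (simp add: Sw_lin[OF lin_sweedler[OF bilin_vs(3)[OF g]]])
  qed
  have t3: "trilin scale fscale (\<lambda>a b c. ?bt [\<phi> a, \<phi> b, \<phi> c])" by (intro trilinI lin_bt3)
  have bi: "bialgebra H'"
  proof (rule bialgebra.intro)
    show "module.subspace (scl H') (carr H')"
    proof -
      interpret L: Vector_Spaces.linear scale "scl H'" \<phi> by (rule lin)
      show ?thesis unfolding carr by (rule L.subspace_image) (rule L.vs1.subspace_UNIV)
    qed
    show "cop H' x \<in> tensor_power (scl H') (carr H') 2" if x: "x \<in> carr H'" for x
    proof -
      obtain y where "x = \<phi> y" using x carr by auto
      then show ?thesis unfolding \<open>x = \<phi> y\<close> cop Sw_def by (intro tensor_power_sum) (use carr in auto)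
    qed
    show "sweedler fscale (\<lambda>x1 x2. sweedler fscale (\<lambda>y1 y2. ?bt [y1, y2, x2]) (cop H' x1)) (cop H' x) =
      sweedler fscale (\<lambda>x1 x2. sweedler fscale (\<lambda>y1 y2. ?bt [x1, y1, y2]) (cop H' x2)) (cop H' x)"
      if x: "x \<in> carr H'" for x
    proof -
      obtain y where y: "x = \<phi> y" using x carr by auto
      have 1: "sweedler fscale (\<lambda>y1 y2. ?bt [y1, y2, \<phi> b]) (cop H' (\<phi> a)) =
          Sw (\<lambda>c d. ?bt [\<phi> c, \<phi> d, \<phi> b]) a" for a b
        by (rule sw) (intro bilinI lin_bt3)
      have 2: "sweedler fscale (\<lambda>y1 y2. ?bt [\<phi> a, y1, y2]) (cop H' (\<phi> b)) =
          Sw (\<lambda>c d. ?bt [\<phi> a, \<phi> c, \<phi> d]) b" for a b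
        by (rule sw) (intro bilinI lin_bt3)
      show ?thesis
        unfolding y using Sw_coassoc[OF t3, of y]
        by (simp add: sw 1 2 bilin_Sw_left[OF t3] bilin_Sw_right[OF t3])
    qed
    show "sweedler (scl H') (\<lambda>x1 x2. scl H' (cou H' x1) x2) (cop H' x) = x" if x: "x \<in> carr H'" for x
    proof -
      obtain y where y: "x = \<phi> y" using x carr by auto
      have "bilin scale scale (scl H') (\<lambda>a b. scl H' (cou H' (\<phi> a)) (\<phi> b))"
        unfolding cou by (intro bilinI lin_scale_var lin_scale_const lin lin_counit vs')
      from sw[OF this, of y] show ?thesis by (simp add: y cou Sw_counit_left[OF lin])
    qed
    show "sweedler (scl H') (\<lambda>x1 x2. scl H' (cou H' x2) x1) (cop H' x) = x" if x: "x \<in> carr H'" for x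
    proof -
      obtain y where y: "x = \<phi> y" using x carr by auto
      have "bilin scale scale (scl H') (\<lambda>a b. scl H' (cou H' (\<phi> b)) (\<phi> a))"
        unfolding cou by (intro bilinI lin_scale_var lin_scale_const lin lin_counit vs')
      from sw[OF this, of y] show ?thesis by (simp add: y cou Sw_counit_right[OF lin])
    qed
    show "cop H' (mul H' x y) = sweedler fscale (\<lambda>x1 x2. sweedler fscale (\<lambda>y1 y2.
        ?bt [mul H' x1 y1, mul H' x2 y2]) (cop H' y)) (cop H' x)"
      if xy: "x \<in> carr H'" "y \<in> carr H'" for x y
    proof -
      obtain x' y' where xy': "x = \<phi> x'" "y = \<phi> y'" using xy carr by auto
      note l = lin_bt2[THEN lin_comp[rotated]] bilin_lin[OF bilin_m]
      have 1: "sweedler fscale (\<lambda>y1 y2. ?bt [mul H' (\<phi> a) y1, mul H' (\<phi> b) y2]) (cop H' (\<phi> y')) =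
          Sw (\<lambda>c d. ?bt [\<phi> (m a c), \<phi> (m b d)]) y'" for a b
        by (subst sw) (auto simp: mul intro!: bilinI l)
      have "bilin scale scale fscale (\<lambda>a b. Sw (\<lambda>c d. ?bt [\<phi> (m a c), \<phi> (m b d)]) y')"
        by (intro bilinI lin_Sw_par l)
      then show ?thesis
        unfolding xy' by (simp add: sw 1) (simp add: mul cop Sw_m[OF b2])
    qed
    show "cop H' (one H') = ?bt [one H', one H']"
      by (simp add: one cop Sw_e[OF b2])
    show "cop H' (x + y) = cop H' x + cop H' y" if "x \<in> carr H'" "y \<in> carr H'" for x y
      using that lin_add[OF lin_cop'] by (auto simp: carr add)
    show "cop H' (scl H' c x) = fscale c (cop H' x)" if "x \<in> carr H'" for c x
      using that lin_scale[OF lin_cop'] by (auto simp: carr scale)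
  qed (auto simp: vs' carr mul one cou add scale m_assoc bilin_simps[OF bilin_m]
      lin_add[OF lin_counit] lin_scale[OF lin_counit])
  have S: "lin scale scale S"
    unfolding lin_iff using antipode vs by (auto simp: is_antipode_def)
  have bS: "bilin scale scale scale (\<lambda>a b. m (S a) b)" "bilin scale scale scale (\<lambda>a b. m a (S b))"
    by (intro bilinI bilin_left[OF bilin_m] bilin_right[OF bilin_m] S lin_ident vs)+
  have eS: "Sw (\<lambda>a b. m (S a) b) x = scale (\<epsilon> x) e" "Sw (\<lambda>a b. m a (S b)) x = scale (\<epsilon> x) e" for x
    using antipode by (simp_all add: is_antipode_def sweedler_cop[OF bS(1)] sweedler_cop[OF bS(2)])
  define S' where "S' p = \<phi> (S (inv \<phi> p))" for p
  have S': "S' (\<phi> x) = \<phi> (S x)" for x using inj by (simp add: S'_def)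
  have bS': "bilin scale scale (scl H') (\<lambda>a b. mul H' (S' (\<phi> a)) (\<phi> b))"
    "bilin scale scale (scl H') (\<lambda>a b. mul H' (\<phi> a) (S' (\<phi> b)))"
    unfolding S' mul using bilin_lin[OF bS(1)] bilin_lin[OF bS(2)]
    by (auto intro!: bilinI lin_comp[OF _ lin])
  have "is_antipode H' S'"
    unfolding is_antipode_def carr
    by (auto simp: sw[OF bS'(1)] sw[OF bS'(2)])
      (auto simp: S' mul add scale lin_add[OF S] lin_scale[OF S] cou one Sw_lin[OF lin, symmetric] eS)
  with bi show ?thesis unfolding hopf_algebra_def by blast
qed

end

section \<open>The isomorphism\<close>

locale primitive_projection = commutative_connected_bialgebra scale m e \<Delta> \<epsilon>
  for scale :: "'k::field_char_0 \<Rightarrow> 'a::ab_group_add \<Rightarrow> 'a" and m :: "'a \<Rightarrow> 'a \<Rightarrow> 'a" and e :: 'a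
    and \<Delta> :: "'a \<Rightarrow> ('a list \<Rightarrow>\<^sub>0 'k)" and \<epsilon> :: "'a \<Rightarrow> 'k" +
  fixes \<pi> :: "'a \<Rightarrow> 'a"
  assumes lin_\<pi>: "lin scale scale \<pi>" and range_\<pi>: "range \<pi> \<subseteq> Pr" and \<pi>_Prim: "x \<in> Pr \<Longrightarrow> \<pi> x = x"
    and \<pi>_m: "\<pi> (m x y) = scale (\<epsilon> x) (\<pi> y) + scale (\<epsilon> y) (\<pi> x)"
begin

sublocale T: subspace_tensors scale Pr
  by (intro subspace_tensors.intro vs subspace_Prim)

abbreviation "t \<equiv> tens scale Pr"

definition prep :: "'a \<Rightarrow> ('a list \<Rightarrow>\<^sub>0 'k) \<Rightarrow> ('a list \<Rightarrow>\<^sub>0 'k)"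
  where "prep a = T.prepend (\<pi> a)"

definition \<psi> :: "'a \<Rightarrow> ('a list \<Rightarrow>\<^sub>0 'k)"
  where "\<psi> = conv_sum fscale prep (\<lambda>x. fscale (\<epsilon> x) (t []))"

lemma \<pi>_in_Prim: "\<pi> x \<in> Pr"
  using range_\<pi> by auto

lemma \<pi>_e: "\<pi> e = 0"
  using \<pi>_m[of e e] by (simp add: vs_simps)

lemma bilin_prep: "bilin scale fscale fscale prep"
  unfolding prep_def[abs_def]
  by (intro bilinI T.lin_prepend_param T.lin_prepend lin_\<pi> range_\<pi>)

lemma prep_e: "prep e p = 0"
  using bilin_simps(5)[OF bilin_prep] by (simp add: prep_def \<pi>_e lin_0[OF lin_\<pi>])

lemma lin_unit_tensor: "lin scale fscale (\<lambda>x. fscale (\<epsilon> x) (t []))"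
  by (intro lin_scale_var lin_counit vector_space_fscale)

lemma lin_\<psi>: "lin scale fscale \<psi>"
  unfolding \<psi>_def by (rule lin_conv_series[OF bilin_prep prep_e lin_unit_tensor])

lemma \<psi>_rec: "\<psi> x = fscale (\<epsilon> x) (t []) + Sw (\<lambda>a b. prep a (\<psi> b)) x"
  unfolding \<psi>_def by (rule conv_sum_rec[OF bilin_prep prep_e lin_unit_tensor])

lemma bilin_prep_\<psi>: "bilin scale scale fscale (\<lambda>a b. prep a (\<psi> b))"
  by (intro bilinI bilin_left[OF bilin_prep] bilin_right[OF bilin_prep] lin_\<psi> lin_ident vs)

lemma prep_TS: "p \<in> T.TS \<Longrightarrow> prep a p \<in> T.TS"
  unfolding prep_def by (rule T.prepend_TS[OF \<pi>_in_Prim])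

lemma Sw_TS: "(\<And>a b. g a b \<in> T.TS) \<Longrightarrow> Sw g x \<in> T.TS"
  unfolding Sw_def by (rule T.TS_sum)

lemma \<psi>_TS: "\<psi> x \<in> T.TS"
proof -
  have "conv_iter prep (\<lambda>x. fscale (\<epsilon> x) (t [])) n x \<in> T.TS" for n x
    by (induction n arbitrary: x) (auto intro!: T.TS_scale T.TS_t Sw_TS prep_TS)
  then show ?thesis unfolding \<psi>_def conv_series_def by (intro T.TS_sum T.TS_scale)
qed

lemma \<psi>_e: "\<psi> e = t []"
  using \<psi>_rec[of e] by (simp add: Sw_e[OF bilin_prep_\<psi>] prep_e)

lemma lookup_Nil_\<psi>: "Poly_Mapping.lookup (\<psi> x) [] = \<epsilon> x"
  unfolding \<psi>_rec[of x] lin_add[OF T.lin_lookup] lin_scale[OF T.lin_lookup] Sw_lin[OF T.lin_lookup]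
  by (simp add: prep_def T.lookup_Nil_prepend[OF \<pi>_in_Prim \<psi>_TS] T.lookup_Nil_t)

abbreviation "mulT p q \<equiv> mul T.SH p q"

lemma bilin_mulT: "bilin fscale fscale fscale (mul T.SH)"
  by (intro bilinI T.lin_mul_SH_left T.lin_mul_SH_right)

lemma prep_m: "prep (m a c) p = fscale (\<epsilon> a) (prep c p) + fscale (\<epsilon> c) (prep a p)"
proof -
  \<comment> \<open>\<open>prep\<close> sees its first argument only through \<pi>, which is
    idempotent.\<close>
  have "prep (m a c) p = prep (\<pi> (m a c)) p"
    by (simp add: prep_def \<pi>_Prim[OF \<pi>_in_Prim])
  also have "\<dots> = fscale (\<epsilon> a) (prep (\<pi> c) p) + fscale (\<epsilon> c) (prep (\<pi> a) p)"
    by (simp add: \<pi>_m bilin_simps[OF bilin_prep])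
  also have "\<dots> = fscale (\<epsilon> a) (prep c p) + fscale (\<epsilon> c) (prep a p)"
    by (simp add: prep_def \<pi>_Prim[OF \<pi>_in_Prim])
  finally show ?thesis .
qed

text \<open>By the derivation rule for \<pi>, the first letter comes from one of the two factors,
  and the counit contracts the corresponding part of the other. This is the recursion of the shuffle
  product.\<close>

lemma \<psi>_m_rec:
  "\<psi> (m x y) = fscale (\<epsilon> x * \<epsilon> y) (t []) + Sw (\<lambda>a b. prep a (\<psi> (m b y))) x
    + Sw (\<lambda>c d. prep c (\<psi> (m x d))) y"
proof -
  have l: "lin scale fscale (\<lambda>d. prep a (\<psi> (m b d)))" "lin scale fscale (\<lambda>b. prep a (\<psi> (m b d)))" for a b d
    by (intro bilin_right[OF bilin_prep] lin_comp[OF _ lin_\<psi>] bilin_lin[OF bilin_m])+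
  have "Sw (\<lambda>a b. prep a (\<psi> b)) (m x y) =
      Sw (\<lambda>a b. Sw (\<lambda>c d. fscale (\<epsilon> a) (prep c (\<psi> (m b d)))) y) x
      + Sw (\<lambda>a b. Sw (\<lambda>c d. fscale (\<epsilon> c) (prep a (\<psi> (m b d)))) y) x"
    by (simp add: Sw_m[OF bilin_prep_\<psi>] prep_m Sw_plus)
  also have "Sw (\<lambda>a b. Sw (\<lambda>c d. fscale (\<epsilon> a) (prep c (\<psi> (m b d)))) y) x =
      Sw (\<lambda>c d. prep c (\<psi> (m x d))) y"
    by (subst Sw_swap) (simp add: Sw_counit_left[OF l(2)])
  also have "Sw (\<lambda>a b. Sw (\<lambda>c d. fscale (\<epsilon> c) (prep a (\<psi> (m b d)))) y) x =
      Sw (\<lambda>a b. prep a (\<psi> (m b y))) x"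
    by (simp add: Sw_counit_left[OF l(1)])
  finally show ?thesis by (simp add: \<psi>_rec[of "m x y"])
qed

lemma mulT_\<psi>_rec:
  "mulT (\<psi> x) (\<psi> y) = fscale (\<epsilon> x * \<epsilon> y) (t []) + Sw (\<lambda>a b. prep a (mulT (\<psi> b) (\<psi> y))) x
    + Sw (\<lambda>c d. prep c (mulT (\<psi> x) (\<psi> d))) y"
proof -
  note simps = bilin_simps[OF bilin_mulT] bilin_simps[OF bilin_prep]
  \<comment> \<open>The shuffle recursion applies to tensors with a first letter, so the constant
    terms are split off.\<close>
  define X where "X = Sw (\<lambda>a b. prep a (\<psi> b)) x"
  define Y where "Y = Sw (\<lambda>a b. prep a (\<psi> b)) y"
  have X: "\<psi> x = fscale (\<epsilon> x) (t []) + X" and Y: "\<psi> y = fscale (\<epsilon> y) (t []) + Y"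
    unfolding X_def Y_def by (rule \<psi>_rec)+
  have X': "X = \<psi> x - fscale (\<epsilon> x) (t [])" and Y': "Y = \<psi> y - fscale (\<epsilon> y) (t [])"
    using X Y by auto
  have TS: "X \<in> T.TS" "Y \<in> T.TS" unfolding X_def Y_def by (intro Sw_TS prep_TS \<psi>_TS)+
  have one: "mulT (t []) p = p" "mulT p (t []) = p" if "p \<in> T.TS" for p
    using T.mul_SH_one that by auto
  have prod: "mulT (prep a (\<psi> b)) (prep c (\<psi> d)) =
      prep a (mulT (\<psi> b) (prep c (\<psi> d))) + prep c (mulT (prep a (\<psi> b)) (\<psi> d))" for a b c d
    unfolding prep_def by (intro T.mul_SH_prepend \<pi>_in_Prim \<psi>_TS)
  have "mulT X Y = Sw (\<lambda>a b. Sw (\<lambda>c d. mulT (prep a (\<psi> b)) (prep c (\<psi> d))) y) x"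
    unfolding X_def Y_def Sw_lin[OF T.lin_mul_SH_left] unfolding Sw_lin[OF T.lin_mul_SH_right] ..
  also have "\<dots> = Sw (\<lambda>a b. Sw (\<lambda>c d. prep a (mulT (\<psi> b) (prep c (\<psi> d)))) y) x
      + Sw (\<lambda>c d. Sw (\<lambda>a b. prep c (mulT (prep a (\<psi> b)) (\<psi> d))) x) y"
    unfolding prod Sw_plus by (simp add: Sw_swap[of _ x y])
  also have "\<dots> = Sw (\<lambda>a b. prep a (mulT (\<psi> b) Y)) x + Sw (\<lambda>c d. prep c (mulT X (\<psi> d))) y"
    unfolding X_def Y_def prep_def
    by (simp add: Sw_lin[OF T.lin_mul_SH_left] Sw_lin[OF T.lin_mul_SH_right] Sw_lin[OF T.lin_prepend])
  also have "Sw (\<lambda>a b. prep a (mulT (\<psi> b) Y)) x =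
      Sw (\<lambda>a b. prep a (mulT (\<psi> b) (\<psi> y))) x - fscale (\<epsilon> y) X"
    unfolding Y' X_def by (simp add: simps one \<psi>_TS Sw_minus Sw_scale[OF vector_space_fscale])
  also have "Sw (\<lambda>c d. prep c (mulT X (\<psi> d))) y =
      Sw (\<lambda>c d. prep c (mulT (\<psi> x) (\<psi> d))) y - fscale (\<epsilon> x) Y"
    unfolding X' Y_def by (simp add: simps one \<psi>_TS Sw_minus Sw_scale[OF vector_space_fscale])
  finally have XY: "mulT X Y = Sw (\<lambda>a b. prep a (mulT (\<psi> b) (\<psi> y))) x - fscale (\<epsilon> y) X +
      (Sw (\<lambda>c d. prep c (mulT (\<psi> x) (\<psi> d))) y - fscale (\<epsilon> x) Y)" .
  have "mulT (\<psi> x) (\<psi> y) = fscale (\<epsilon> x * \<epsilon> y) (t []) + fscale (\<epsilon> x) Y + fscale (\<epsilon> y) X + mulT X Y"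
    unfolding X Y by (simp add: simps one TS T.TS_t T.TS_scale T.TS_add
        vs_scale_simps[OF vector_space_fscale] algebra_simps)
  then show ?thesis unfolding XY by (simp add: algebra_simps)
qed

lemma \<psi>_m: "\<psi> (m x y) = mulT (\<psi> x) (\<psi> y)"
proof -
  define E where "E x y = \<psi> (m x y) - mulT (\<psi> x) (\<psi> y)" for x y
  have lE: "lin scale fscale (\<lambda>x. E x y)" "lin scale fscale (\<lambda>y. E x y)" for x y
    unfolding E_def
    by (intro lin_minus lin_comp[OF _ lin_\<psi>] bilin_lin[OF bilin_m] bilin_left[OF bilin_mulT]
      bilin_right[OF bilin_mulT] lin_\<psi>)+
  have rec: "E x y = Sw (\<lambda>a b. prep a (E b y)) x + Sw (\<lambda>c d. prep c (E x d)) y" for x y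
    unfolding E_def \<psi>_m_rec[of x y] mulT_\<psi>_rec[of x y]
    by (simp add: bilin_simps[OF bilin_prep] Sw_minus)
  \<comment> \<open>Each of the two sums in \<open>rec\<close> lowers the filtration of one argument
    and keeps the other, whence the nested inductions.\<close>
  have zero: "fil n x \<Longrightarrow> fil k y \<Longrightarrow> E x y = 0" for n k x y
  proof (induction n arbitrary: x k y)
    case 0
    then show ?case using lin_0[OF lE(1)] by simp
  next
    case (Suc n)
    note outer = Suc.IH and x = Suc.prems(1)
    from Suc.prems(2) show ?case
    proof (induction k arbitrary: y)
      case 0
      then show ?case using lin_0[OF lE(2)] by simp
    next
      case (Suc k)
      have "Sw (\<lambda>a b. prep a (E b y)) x = 0"
        by (rule Sw_eq_0I[OF bilin_prep prep_e lE(1)]) (use outer[OF fil_lcontr[OF x] Suc.prems] in blast)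
      moreover have "Sw (\<lambda>c d. prep c (E x d)) y = 0"
        by (rule Sw_eq_0I[OF bilin_prep prep_e lE(2)]) (use Suc.IH[OF fil_lcontr[OF Suc.prems]] in blast)
      ultimately show ?case unfolding rec[of x y] by simp
    qed
  qed
  show ?thesis using zero[OF fil_deg fil_deg, of x y] by (simp add: E_def)
qed

section \<open>Compatibility of \<psi> with the coproducts\<close>

lemma tt_sum:
  assumes "\<And>i. i \<in> I \<Longrightarrow> f i \<in> T.TS" and "p \<in> T.TS"
  shows "T.tt (sum f I) p = (\<Sum>i\<in>I. T.tt (f i) p)" "T.tt p (sum f I) = (\<Sum>i\<in>I. T.tt p (f i))"
proof -
  have zero: "T.tt 0 p = 0" "T.tt p 0 = 0"
    using T.tt_simps(3,4)[of p p 0] assms(2) by simp_all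
  have "f ` I \<subseteq> T.TS" using assms(1) by blast
  then show "T.tt (sum f I) p = (\<Sum>i\<in>I. T.tt (f i) p)" "T.tt p (sum f I) = (\<Sum>i\<in>I. T.tt p (f i))"
    using assms(2)
    by (induction I rule: infinite_finite_induct)
      (auto simp: zero T.tt_simps T.TS_sum image_subset_iff)
qed

lemma tt_Sw:
  assumes "\<And>a b. g a b \<in> T.TS" and "p \<in> T.TS"
  shows "T.tt (Sw g x) p = Sw (\<lambda>a b. T.tt (g a b) p) x" "T.tt p (Sw g x) = Sw (\<lambda>a b. T.tt p (g a b)) x"
  unfolding Sw_def by (rule tt_sum(1)[OF assms]) (rule tt_sum(2)[OF assms])

text \<open>Both sides solve the same recursion, in which \<open>B\<close> prepends a letter to the
  left tensor factor: the right one by coassociativity (\<open>D\<close>), the left one by the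
  cocycle property of prepending (\<open>C\<close>).\<close>

lemma cop_\<psi>: "cop T.SH (\<psi> x) = Sw (\<lambda>a b. T.tt (\<psi> a) (\<psi> b)) x"
proof -
  define B where "B a P = T.prepend_left (\<pi> a) P" for a P
  have B: "bilin scale fscale fscale B"
    unfolding B_def[abs_def]
    by (intro bilinI T.lin_prepend_left_param T.lin_prepend_left lin_\<pi> range_\<pi>)
  have Be: "B e P = 0" for P
    using bilin_simps(5)[OF B] by (simp add: B_def \<pi>_e lin_0[OF lin_\<pi>])
  have one: "t [] \<in> T.TS" by (simp add: T.TS_t)
  have l\<psi>: "lin scale fscale (\<lambda>b. T.tt p (\<psi> b))" "lin scale fscale (\<lambda>b. T.tt (\<psi> b) p)" if "p \<in> T.TS" for p
    using that by (auto intro!: T.lin_tt lin_\<psi> \<psi>_TS)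
  have b\<psi>: "bilin scale scale fscale (\<lambda>a b. T.tt (\<psi> a) (\<psi> b))"
    by (intro bilinI l\<psi> \<psi>_TS)
  have tri: "trilin scale fscale (\<lambda>a b c. T.tt (prep a (\<psi> b)) (\<psi> c))"
    by (intro trilinI l\<psi> T.lin_tt bilin_lin[OF bilin_prep_\<psi>] prep_TS \<psi>_TS image_subsetI)
  define D where "D = Sw (\<lambda>a b. T.tt (\<psi> a) (\<psi> b))"
  have D: "D x = T.tt (t []) (\<psi> x) + Sw (\<lambda>a b. B a (D b)) x" for x
  proof -
    have "T.tt (\<psi> a) (\<psi> b) = fscale (\<epsilon> a) (T.tt (t []) (\<psi> b)) + Sw (\<lambda>c d. T.tt (prep c (\<psi> d)) (\<psi> b)) a" for a b
      by (subst \<psi>_rec[of a])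
        (simp add: T.tt_simps T.TS_scale one \<psi>_TS Sw_TS prep_TS tt_Sw)
    then have "D x = T.tt (t []) (\<psi> x) + Sw (\<lambda>a b. Sw (\<lambda>c d. T.tt (prep c (\<psi> d)) (\<psi> b)) a) x"
      by (simp add: D_def Sw_plus Sw_counit_left[OF l\<psi>(1)[OF one]])
    also have "Sw (\<lambda>a b. Sw (\<lambda>c d. T.tt (prep c (\<psi> d)) (\<psi> b)) a) x =
        Sw (\<lambda>a b. Sw (\<lambda>c d. T.tt (prep a (\<psi> c)) (\<psi> d)) b) x"
      by (rule Sw_coassoc[OF tri])
    also have "\<dots> = Sw (\<lambda>a b. B a (D b)) x"
      unfolding D_def B_def Sw_lin[OF T.lin_prepend_left] prep_def
      by (simp add: T.prepend_left_tt \<pi>_in_Prim \<psi>_TS)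
    finally show ?thesis .
  qed
  have C: "cop T.SH (\<psi> x) = T.tt (t []) (\<psi> x) + Sw (\<lambda>a b. B a (cop T.SH (\<psi> b))) x" for x
  proof -
    have "cop T.SH (\<psi> x) = fscale (\<epsilon> x) (T.tt (t []) (t []))
        + Sw (\<lambda>a b. T.tt (t []) (prep a (\<psi> b)) + B a (cop T.SH (\<psi> b))) x"
      by (subst \<psi>_rec)
        (simp add: lin_add[OF T.lin_cop_SH] lin_scale[OF T.lin_cop_SH] Sw_lin[OF T.lin_cop_SH]
          T.cop_SH_t T.deconc_def prep_def B_def T.cop_SH_prepend \<pi>_in_Prim \<psi>_TS)
    also have "\<dots> = T.tt (t []) (fscale (\<epsilon> x) (t []) + Sw (\<lambda>a b. prep a (\<psi> b)) x)
        + Sw (\<lambda>a b. B a (cop T.SH (\<psi> b))) x"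
      by (simp add: T.tt_simps one T.TS_scale Sw_TS prep_TS \<psi>_TS tt_Sw Sw_plus)
    finally show ?thesis unfolding \<psi>_rec[of x, symmetric] .
  qed
  have "cop T.SH (\<psi> x) - D x = 0"
  proof (rule conv_fixed_point_eq_0[OF B Be, of "\<lambda>x. cop T.SH (\<psi> x) - D x"])
    show "lin scale fscale (\<lambda>x. cop T.SH (\<psi> x) - D x)"
      unfolding D_def by (intro lin_minus lin_comp[OF lin_\<psi> T.lin_cop_SH] lin_Sw b\<psi>)
    show "cop T.SH (\<psi> x) - D x = Sw (\<lambda>a b. B a (cop T.SH (\<psi> b) - D b)) x" for x
      by (subst C, subst D) (simp add: bilin_simps[OF B] Sw_minus)
  qed
  then show ?thesis by (simp add: D_def)
qed

section \<open>Injectivity of \<psi>\<close>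

lemma Prim_if_rcontr_trivial:
  assumes \<epsilon>x: "\<epsilon> x = 0" and r: "\<And>\<alpha>. aug_functional \<alpha> \<Longrightarrow> rcontr \<alpha> x = scale (\<alpha> x) e"
  shows "x \<in> Pr"
proof -
  let ?g = "\<lambda>a b. tp a b"
  note g = bilin_tens_UNIV[OF vs]
  note g_l = bilin_lin(1)[OF g] and g_r = bilin_lin(2)[OF g]
  have g': "bilin scale scale fscale (\<lambda>b a. tp a b)" by (intro bilinI g_l g_r)
  \<comment> \<open>This is the reduced coproduct of x. The hypothesis tests its second factor by
    functionals, hence the swapped arguments in \<open>g'\<close>.\<close>
  have "Sw (\<lambda>a b. tp (aug_proj a) (aug_proj b)) x = 0"
    unfolding Sw_def
  proof (rule bilin_sum_eq_0I[OF vs g' finite_lessThan])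
    fix \<gamma> :: "'a \<Rightarrow> 'k" assume \<gamma>: "lin scale (*) \<gamma>"
    have "aug_proj (rcontr (\<lambda>x. \<gamma> (aug_proj x)) x) = 0"
      by (simp add: r[OF aug_functional_aug_proj[OF \<gamma>]] lin_scale[OF lin_aug_proj] vs_simps)
    then show "(\<Sum>i<length (cterms x). scale (\<gamma> (aug_proj (snd (cterms x ! i)))) (aug_proj (fst (cterms x ! i)))) = 0"
      unfolding lin_rcontr_eq[OF lin_aug_proj] unfolding Sw_def .
  qed
  moreover have "tp (aug_proj a) (aug_proj b) = tp a b - fscale (\<epsilon> a) (tp e b)
      - fscale (\<epsilon> b) (tp a e) + fscale (\<epsilon> a) (fscale (\<epsilon> b) (tp e e))" for a b
    unfolding aug_proj_def
    by (simp add: bilin_simps[OF g] vs_scale_simps[OF vector_space_fscale] algebra_simps)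
  moreover have "Sw (\<lambda>a b. fscale (\<epsilon> a) (fscale (\<epsilon> b) (tp e e))) x = 0"
    using Sw_counit_left[OF lin_scale_var[OF vector_space_fscale lin_counit], of "tp e e" x] \<epsilon>x by simp
  ultimately have "\<Delta> x = tp x e + tp e x"
    using cop_eq_Sw[of x]
    by (simp add: Sw_plus Sw_minus Sw_counit_left[OF g_r] Sw_counit_right[OF g_l] algebra_simps)
  then show ?thesis by (simp add: Prim_def)
qed

lemma \<psi>_Prim:
  assumes x: "x \<in> Pr" shows "\<psi> x = t [x]"
proof -
  have "\<psi> x = prep x (t [])"
    using \<psi>_rec[of x] by (simp add: Sw_Prim[OF bilin_prep_\<psi> x] counit_Prim[OF x] prep_e \<psi>_e)
  then show ?thesis using x by (simp add: prep_def \<pi>_Prim T.prepend_t)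
qed

text \<open>The kernel of \<psi> is stable under contractions by functionals that factor through
  \<psi>, because the contraction can be read off from the coproduct of \<psi>(x) = 0.\<close>

lemma lcontr_\<psi>_eq_0:
  assumes "\<psi> x = 0" and \<beta>: "lin fscale (*) \<beta>"
  shows "\<psi> (lcontr (\<lambda>a. \<beta> (\<psi> a)) x) = 0"
proof -
  let ?s = "sweedler fscale (\<lambda>p q. fscale (\<beta> p) q)"
  have "?s (T.tt (\<psi> a) (\<psi> b)) = fscale (\<beta> (\<psi> a)) (\<psi> b)" for a b
    by (rule sweedler_tens)
      (auto simp: \<psi>_TS vector_space_fscale lin_add[OF \<beta>] lin_scale[OF \<beta>]
        vs_scale_simps[OF vector_space_fscale] mult.commute)
  then have "?s (cop T.SH (\<psi> x)) = Sw (\<lambda>a b. fscale (\<beta> (\<psi> a)) (\<psi> b)) x"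
    unfolding cop_\<psi> by (simp add: Sw_lin[OF lin_sweedler[OF vector_space_fscale]])
  then show ?thesis
    unfolding lin_lcontr_eq[OF lin_\<psi>]
    by (simp add: assms(1) lin_0[OF T.lin_cop_SH] lin_0[OF lin_sweedler[OF vector_space_fscale]])
qed

text \<open>A coalgebra morphism on a connected coalgebra is injective once it is so on primitives.
  The induction hypothesis determines first the left contractions of x by functionals through \<psi>
  (\<open>l\<close>), then by duality all right contractions by augmentation functionals
  (\<open>r\<close>); the latter show that x is primitive.\<close>

lemma \<psi>_eq_0:
  "fil n x \<Longrightarrow> \<psi> x = 0 \<Longrightarrow> x = 0"
proof (induction n arbitrary: x)
  case 0
  then show ?case by simp
next
  case (Suc n)
  have \<epsilon>x: "\<epsilon> x = 0" using lookup_Nil_\<psi>[of x] Suc.prems(2) by simp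
  show ?case
  \<comment> \<open>The unit \<open>e\<close> lies in \<open>fil n\<close> only for positive n, and
    the argument below subtracts a multiple of it.\<close>
  proof (cases n)
    case 0
    then have "fil 1 x" using Suc.prems(1) by simp
    from fil_1[OF this] \<epsilon>x show ?thesis by (simp add: vs_simps)
  next
    case (Suc k)
    have l: "lcontr (\<lambda>a. \<beta> (\<psi> a)) x = scale (\<beta> (t [])) x" if \<beta>: "lin fscale (*) \<beta>" for \<beta>
    proof -
      define \<gamma> where "\<gamma> a = \<beta> (\<psi> a) - \<beta> (t []) * \<epsilon> a" for a
      \<comment> \<open>The multiple of the counit makes \<gamma> vanish at \<open>e\<close>, so
        that contracting by \<gamma> lowers the filtration.\<close>
      have \<gamma>: "aug_functional \<gamma>"
        unfolding aug_functional_def \<gamma>_def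
        by (auto intro!: lin_minus lin_comp[OF lin_\<psi> \<beta>] lin_scale_const[OF lin_counit] simp: \<psi>_e)
      have eq: "lcontr \<gamma> x = lcontr (\<lambda>a. \<beta> (\<psi> a)) x - scale (\<beta> (t [])) x"
      proof -
        have "scale (\<gamma> a) b = scale (\<beta> (\<psi> a)) b - scale (\<epsilon> a) (scale (\<beta> (t [])) b)" for a b
          by (simp add: \<gamma>_def vs_simps mult.commute)
        then have "lcontr \<gamma> x = Sw (\<lambda>a b. scale (\<beta> (\<psi> a)) b - scale (\<epsilon> a) (scale (\<beta> (t [])) b)) x"
          unfolding lcontr_def by (rule Sw_cong)
        moreover have "Sw (\<lambda>a b. scale (\<epsilon> a) (scale (\<beta> (t [])) b)) x = scale (\<beta> (t [])) x"
          by (rule Sw_counit_left[OF lin_scale_const[OF lin_ident[OF vs]]])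
        ultimately show ?thesis unfolding lcontr_def by (simp only: Sw_minus)
      qed
      have "\<psi> (lcontr \<gamma> x) = 0"
        unfolding eq
        by (simp add: lin_diff[OF lin_\<psi>] lin_scale[OF lin_\<psi>] lcontr_\<psi>_eq_0[OF Suc.prems(2) \<beta>] Suc.prems(2))
      then have "lcontr \<gamma> x = 0" using fil_lcontr[OF Suc.prems(1) \<gamma>] Suc.IH by blast
      then show ?thesis using eq by simp
    qed
    have r: "rcontr \<alpha> x = scale (\<alpha> x) e" if \<alpha>: "aug_functional \<alpha>" for \<alpha>
    proof -
      note \<alpha>l = aug_functional_lin[OF \<alpha>]
      \<comment> \<open>The correction makes \<psi>(y) vanish: each coefficient of
        \<psi>(\<open>rcontr \<alpha> x\<close>) is \<alpha> of a left contraction, which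
        \<open>l\<close> computes.\<close>
      define y where "y = rcontr \<alpha> x + scale (- \<alpha> x) e"
      have "fil n y" unfolding y_def using Suc.prems(1) \<alpha> fil_e[of k] Suc by (intro fil_lin) auto
      moreover have "\<psi> y = 0"
      proof (rule poly_mapping_eqI)
        fix w
        let ?\<beta> = "\<lambda>p :: 'a list \<Rightarrow>\<^sub>0 'k. Poly_Mapping.lookup p w"
        note \<beta> = T.lin_lookup[of w]
        have "?\<beta> (\<psi> y) = ?\<beta> (\<psi> (rcontr \<alpha> x)) - \<alpha> x * ?\<beta> (t [])"
          unfolding y_def by (simp add: lin_add[OF lin_\<psi>] lin_scale[OF lin_\<psi>] \<psi>_e lookup_add lookup_fscale)
        also have "?\<beta> (\<psi> (rcontr \<alpha> x)) = \<alpha> (lcontr (\<lambda>a. ?\<beta> (\<psi> a)) x)"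
          by (rule functional_rcontr_lcontr[OF lin_comp[OF lin_\<psi> \<beta>] \<alpha>l])
        finally show "?\<beta> (\<psi> y) = Poly_Mapping.lookup 0 w"
          by (simp add: l[OF \<beta>] lin_scale[OF \<alpha>l])
      qed
      ultimately have "y = 0" by (rule Suc.IH)
      then show ?thesis by (simp add: y_def vs_simps)
    qed
    have "x \<in> Pr" using \<epsilon>x r by (rule Prim_if_rcontr_trivial)
    then show ?thesis using Suc.prems(2) \<psi>_Prim[of x] T.t_letter_eq_0[of x] by simp
  qed
qed

lemma inj_\<psi>: "inj \<psi>"
proof (rule injI)
  fix x y assume "\<psi> x = \<psi> y"
  then have "\<psi> (x - y) = 0" by (simp add: lin_diff[OF lin_\<psi>])
  then show "x = y" using \<psi>_eq_0[OF fil_deg] by force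
qed

section \<open>Surjectivity of \<psi>\<close>

lemma range_\<psi>:
  assumes e: "\<phi> [] = e" and letter: "\<And>v. v \<in> Pr \<Longrightarrow> \<phi> [v] = v"
    and deconc: "\<And>w g. w \<in> lists Pr \<Longrightarrow>
      bilin scale scale (fscale :: 'k \<Rightarrow> ('a list \<Rightarrow>\<^sub>0 'k) \<Rightarrow> _) g \<Longrightarrow>
      Sw g (\<phi> w) = (\<Sum>i\<le>length w. g (\<phi> (take i w)) (\<phi> (drop i w)))"
  shows "range \<psi> = T.TS"
proof -
  have diff: "w \<in> lists Pr \<Longrightarrow> \<exists>r\<in>T.short (length w). \<psi> (\<phi> w) = t w + r" for w
  proof (induction "length w" arbitrary: w rule: less_induct)
    case less
    show ?case
    proof (cases w)
      case Nil
      then show ?thesis using T.short_zero by (auto simp: e \<psi>_e)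
    next
      case (Cons v u)
      have vu: "v \<in> Pr" "u \<in> lists Pr" using less.prems Cons by auto
      obtain r where r: "r \<in> T.short (length u)" "\<psi> (\<phi> u) = t u + r"
        using less.hyps[of u] vu Cons by auto
      let ?f = "\<lambda>i. prep (\<phi> (take i w)) (\<psi> (\<phi> (drop i w)))"
      \<comment> \<open>A cut at i replaces the first i letters by a single one: the cut at 0 gives
        0, the cut at 1 gives the word itself up to shorter ones, and all later cuts give shorter
        words.\<close>
      let ?I = "{..length w} - {0} - {1}"
      have f0: "?f 0 = 0" by (simp add: e prep_e)
      have f1: "?f 1 = t w + T.prepend v r"
        using vu r(2) Cons by (simp add: letter prep_def \<pi>_Prim lin_add[OF T.lin_prepend] T.prepend_t)
      have fi: "?f i \<in> T.short (length w)" if "i \<in> ?I" for i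
      proof -
        have i: "2 \<le> i" "i \<le> length w" using that by auto
        have len: "length (drop i w) < length w" "Suc (Suc (length (drop i w))) \<le> length w"
          using i by simp_all
        have d: "drop i w \<in> lists Pr" using T.lists_take_drop[OF less.prems] by blast
        obtain r' where r': "r' \<in> T.short (length (drop i w))" "\<psi> (\<phi> (drop i w)) = t (drop i w) + r'"
          using less.hyps[OF len(1) d] by blast
        have "\<psi> (\<phi> (drop i w)) \<in> T.short (Suc (length (drop i w)))"
          unfolding r'(2) using r'(1) T.short_mono[of "length (drop i w)" "Suc (length (drop i w))"] d
          by (intro T.short_add T.short_t) auto
        from T.prepend_short[OF \<pi>_in_Prim this] show ?thesis
          unfolding prep_def using T.short_mono[OF len(2)] by blast
      qed
      have "\<psi> (\<phi> w) = fscale (\<epsilon> (\<phi> w)) (t []) + (\<Sum>i\<le>length w. ?f i)"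
        by (subst \<psi>_rec) (simp add: deconc[OF less.prems bilin_prep_\<psi>])
      also have "(\<Sum>i\<le>length w. ?f i) = ?f 0 + (?f 1 + (\<Sum>i\<in>?I. ?f i))"
        using Cons by (subst sum.remove[of _ 0], simp, simp, subst sum.remove[of _ 1]) auto
      finally have "\<psi> (\<phi> w) = t w + (fscale (\<epsilon> (\<phi> w)) (t []) + T.prepend v r + (\<Sum>i\<in>?I. ?f i))"
        unfolding f0 f1 by (simp add: algebra_simps)
      moreover have "fscale (\<epsilon> (\<phi> w)) (t []) + T.prepend v r + (\<Sum>i\<in>?I. ?f i) \<in> T.short (length w)"
        using T.prepend_short[OF vu(1) r(1)] Cons
        by (intro T.short_add T.short_scale T.short_t T.short_sum fi) auto
      ultimately show ?thesis by blast
    qed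
  qed
  interpret L: Vector_Spaces.linear scale fscale \<psi> by (rule lin_\<psi>)
  have sub: "L.vs2.subspace (range \<psi>)" by (rule L.subspace_image) (rule L.vs1.subspace_UNIV)
  \<comment> \<open>Triangularity: \<open>r\<close> is a combination of shorter words, which lie in
    the range by induction.\<close>
  have t_in: "w \<in> lists Pr \<Longrightarrow> t w \<in> range \<psi>" for w
  proof (induction "length w" arbitrary: w rule: less_induct)
    case less
    obtain r where r: "r \<in> T.short (length w)" "\<psi> (\<phi> w) = t w + r" using diff[OF less.prems] by blast
    have "T.short (length w) \<subseteq> range \<psi>"
      unfolding T.short_def by (rule L.vs2.span_minimal[OF _ sub]) (use less.hyps in blast)
    then have "\<psi> (\<phi> w) - r \<in> range \<psi>" using r(1) L.vs2.subspace_diff[OF sub] by blast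
    then show ?case using r(2) by simp
  qed
  have "p \<in> range \<psi>" if "p \<in> T.TS" for p
    using that
    by (induction rule: T.TS_induct)
      (auto intro!: L.vs2.subspace_add[OF sub] L.vs2.subspace_scale[OF sub] t_in L.vs2.subspace_0[OF sub]
        simp del: in_lists_conv_set)
  then show ?thesis using \<psi>_TS by blast
qed

lemma hopf_iso_\<psi>:
  assumes "range \<psi> = T.TS"
  shows "hopf_iso (type_bialg scale m e \<Delta> \<epsilon>) T.SH \<psi>"
proof -
  have b: "bilin scale scale fscale (\<lambda>a b. T.tt (\<psi> a) (\<psi> b))"
    by (intro bilinI T.lin_tt lin_\<psi> \<psi>_TS image_subsetI)
  have c: "carr T.SH = T.TS" "scl T.SH = fscale" "one T.SH = t []"
    "cou T.SH = (\<lambda>p. Poly_Mapping.lookup p [])"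
    by (simp_all add: shuffle_bialg_def)
  show ?thesis
    unfolding hopf_iso_def
    by (simp add: c bij_betw_def inj_\<psi> assms lin_add[OF lin_\<psi>] lin_scale[OF lin_\<psi>] \<psi>_m \<psi>_e
      cop_\<psi> sweedler_cop[OF b] lookup_Nil_\<psi>)
qed

end

section \<open>The coproduct of a pre-Lie product with a primitive left factor\<close>

context com_prelie_bialgebra
begin

sublocale B: type_bialgebra scale m e \<Delta> \<epsilon>
  by (rule type_bialgebra.intro) (rule bialg)

text \<open>The Leibniz rule for e = e e gives e \<bullet> b = 2 (e \<bullet> b).\<close>

lemma bul_e: "bul e b = 0"
  using leibniz[of e e b] m_comm[of "bul e b" e] by (simp add: unit)

lemma bilin_bul: "bilin scale scale scale bul"
  using bul_linear_left bul_linear_right by (intro bilinI)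

text \<open>Each summand of \<Delta>(a) = a \<otimes> e + e \<otimes> a survives in only one of the
  two terms of the axiom; in the other it produces a factor e \<bullet> _ = 0.\<close>

lemma Sw_bul:
  assumes a: "a \<in> Prim (type_bialg scale m e \<Delta> \<epsilon>)" and h: "bilin scale scale s h"
  shows "B.Sw h (bul a b) = h e (bul a b) + B.Sw (\<lambda>b1 b2. h (bul a b1) b2) b"
proof -
  note l = B.bilin_lin[OF bilin_bul] B.bilin_lin[OF B.bilin_m]
  have b1: "bilin scale scale s' (\<lambda>a1 a2. g a1 (bul a2 b))" if "bilin scale scale s' g"
    for s' :: "'k \<Rightarrow> 'w::ab_group_add \<Rightarrow> 'w" and g
    by (intro bilinI B.bilin_lin[OF that] lin_comp[OF _ B.bilin_lin(2)[OF that]] l)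
  have b2: "bilin scale scale s' (\<lambda>b1 b2. g (bul a1 b1) (m a2 b2))" if "bilin scale scale s' g"
    for s' :: "'k \<Rightarrow> 'w::ab_group_add \<Rightarrow> 'w" and g a1 a2
    by (intro bilinI lin_comp[OF _ B.bilin_lin(1)[OF that]] lin_comp[OF _ B.bilin_lin(2)[OF that]] l)
  have b3: "bilin scale scale s' (\<lambda>a1 a2. B.Sw (\<lambda>b1 b2. g (bul a1 b1) (m a2 b2)) b)"
    if "bilin scale scale s' g" for s' :: "'k \<Rightarrow> 'w::ab_group_add \<Rightarrow> 'w" and g
    by (intro bilinI B.lin_Sw_par lin_comp[OF _ B.bilin_lin(1)[OF that]]
      lin_comp[OF _ B.bilin_lin(2)[OF that]] l)
  note t = bilin_tens_UNIV[OF B.vs]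
  have "\<Delta> (bul a b) = B.Sw (\<lambda>a1 a2. B.tp a1 (bul a2 b)) a
      + B.Sw (\<lambda>a1 a2. B.Sw (\<lambda>b1 b2. B.tp (bul a1 b1) (m a2 b2)) b) a"
    unfolding \<Delta>_bul by (simp only: B.sweedler_cop[OF b1[OF t]] B.sweedler_cop[OF b2[OF t]]
      B.sweedler_cop[OF b3[OF t]])
  then have "sweedler s h (\<Delta> (bul a b)) = sweedler s h \<dots>" by simp
  note lh = lin_sweedler[OF bilin_vs(3)[OF h]]
  have "B.Sw h (bul a b) = B.Sw (\<lambda>a1 a2. h a1 (bul a2 b)) a
      + B.Sw (\<lambda>a1 a2. B.Sw (\<lambda>b1 b2. h (bul a1 b1) (m a2 b2)) b) a"
    using \<open>sweedler s h _ = _\<close>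
    by (simp add: B.sweedler_cop[OF h] lin_add[OF lh] B.Sw_lin[OF lh] B.sweedler_tp[OF h])
  then show ?thesis
    by (simp add: B.Sw_Prim[OF b1[OF h] a] B.Sw_Prim[OF b3[OF h] a] bul_e bilin_simps[OF h])
qed

end

theorem theorem4p8:
  fixes scale :: "'k::field_char_0 \<Rightarrow> 'a::ab_group_add \<Rightarrow> 'a"
    and m bul :: "'a \<Rightarrow> 'a \<Rightarrow> 'a"
    and e :: 'a
    and \<Delta> :: "'a \<Rightarrow> ('a list \<Rightarrow>\<^sub>0 'k)"
    and \<epsilon> :: "'a \<Rightarrow> 'k"
  assumes "com_prelie_bialgebra scale m bul e \<Delta> \<epsilon>"
    and "connected_bialgebra (type_bialg scale m e \<Delta> \<epsilon>)"
    and "(\<lambda>a. bul a e) ` Prim (type_bialg scale m e \<Delta> \<epsilon>) = Prim (type_bialg scale m e \<Delta> \<epsilon>)"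
  shows "hopf_isomorphic (type_bialg scale m e \<Delta> \<epsilon>)
    (shuffle_bialg scale (Prim (type_bialg scale m e \<Delta> \<epsilon>)))"
proof -
  interpret C: com_prelie_bialgebra scale m bul e \<Delta> \<epsilon> by fact
  interpret A: commutative_connected_bialgebra scale m e \<Delta> \<epsilon>
    by (intro commutative_connected_bialgebra.intro connected_type_bialgebra.intro
      commutative_connected_bialgebra_axioms.intro connected_type_bialgebra_axioms.intro
      C.B.type_bialgebra_axioms assms(2) C.m_comm)
  obtain \<pi> where "lin scale scale \<pi>" "range \<pi> \<subseteq> A.Pr" "\<And>x. x \<in> A.Pr \<Longrightarrow> \<pi> x = x"
    "\<And>x y. \<pi> (m x y) = scale (\<epsilon> x) (\<pi> y) + scale (\<epsilon> y) (\<pi> x)"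
    using A.ex_primitive_projection by blast
  then have \<pi>: "primitive_projection scale m e \<Delta> \<epsilon> \<pi>"
    by (intro primitive_projection.intro primitive_projection_axioms.intro
      A.commutative_connected_bialgebra_axioms)
  interpret P: primitive_projection scale m e \<Delta> \<epsilon> \<pi> by (rule \<pi>)
  \<comment> \<open>An arbitrary section of f_A, in general not linear: \<phi> below is a map on
    words, which is all that \<open>range_\<psi>\<close> asks for.\<close>
  define g where "g v = (SOME a. a \<in> A.Pr \<and> bul a e = v)" for v
  have g: "g v \<in> A.Pr \<and> bul (g v) e = v" if "v \<in> A.Pr" for v
  proof -
    have "v \<in> (\<lambda>a. bul a e) ` A.Pr" using that by (simp only: assms(3))
    then have "\<exists>a. a \<in> A.Pr \<and> bul a e = v" by auto
    then show ?thesis unfolding g_def by (rule someI_ex)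
  qed
  define \<phi> where "\<phi> w = foldr (\<lambda>v. bul (g v)) w e" for w
  have \<phi>: "\<phi> [] = e" "\<phi> (v # w) = bul (g v) (\<phi> w)" for v w by (simp_all add: \<phi>_def)
  have deconc: "C.B.Sw h (\<phi> w) = (\<Sum>i\<le>length w. h (\<phi> (take i w)) (\<phi> (drop i w)))"
    if "w \<in> lists A.Pr" "bilin scale scale fscale h" for w and h :: "'a \<Rightarrow> 'a \<Rightarrow> 'a list \<Rightarrow>\<^sub>0 'k"
    using that
  proof (induction w arbitrary: h)
    case Nil
    then show ?case by (simp add: \<phi> C.B.Sw_e)
  next
    case (Cons v w)
    have b: "bilin scale scale fscale (\<lambda>b1 b2. h (bul (g v) b1) b2)"
      by (intro bilinI C.B.bilin_lin[OF Cons.prems] lin_comp[OF _ C.B.bilin_lin(1)[OF Cons.prems]]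
        C.B.bilin_lin(2)[OF C.bilin_bul])
    have "C.B.Sw h (\<phi> (v # w)) = h e (\<phi> (v # w)) + C.B.Sw (\<lambda>b1 b2. h (bul (g v) b1) b2) (\<phi> w)"
      unfolding \<phi> using Cons g by (intro C.Sw_bul) auto
    also have "C.B.Sw (\<lambda>b1 b2. h (bul (g v) b1) b2) (\<phi> w) =
        (\<Sum>i\<le>length w. h (\<phi> (v # take i w)) (\<phi> (drop i w)))"
      using Cons.IH[OF b] by (simp add: \<phi>)
    also have "h e (\<phi> (v # w)) + \<dots> =
        (\<Sum>i\<le>Suc (length w). h (\<phi> (take i (v # w))) (\<phi> (drop i (v # w))))"
      by (subst sum.atMost_Suc_shift) (simp add: \<phi>(1))
    finally show ?case by simp
  qed
  \<comment> \<open>The one-letter hypothesis is g(v) \<bullet> e = v, which is where the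
    surjectivity of f_A enters.\<close>
  have "range P.\<psi> = P.T.TS"
    by (rule P.range_\<psi>[of \<phi>]) (use g deconc in \<open>auto simp: \<phi>\<close>)
  then have iso: "hopf_iso (type_bialg scale m e \<Delta> \<epsilon>) P.T.SH P.\<psi>" by (rule P.hopf_iso_\<psi>)
  obtain S where S: "is_antipode (type_bialg scale m e \<Delta> \<epsilon>) S" using A.ex_antipode by blast
  have "vector_space (scl P.T.SH)" by (simp add: shuffle_bialg_def vector_space_fscale)
  from C.B.hopf_algebra_transport[OF this iso S] have "hopf_algebra P.T.SH" .
  moreover have "hopf_algebra (type_bialg scale m e \<Delta> \<epsilon>)"
    unfolding hopf_algebra_def using C.B.bialg S by blast
  ultimately show ?thesis unfolding hopf_isomorphic_def using iso by blast
qed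

end
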